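(* Let $\mathcal C$ be a small category and $\mathcal E\to\mathcal C$ a Grothendieck opfibration. Let $\mathbb C$ be the simplicial replacement of $\mathcal C$ and $\mathbf E\to\mathbb C$ the simplicial extension of $\mathcal E\to\mathcal C$. Then the category $\mathrm{Sect}(\mathcal C,\mathcal E)$ is equivalent to the full subcategory of $\mathrm{Sect}(\mathbb C,\mathbf E)$ consisting of those sections $X$ such that for each Segal map $\alpha:\mathbf c\to\mathbf c'$ of $\mathbb C$ the image $X(\alpha)$ is cartesian, meaning that the induced map $X(\mathbf c)\to\alpha^*X(\mathbf c')$ is an isomorphism in $\mathbf E(\mathbf c)$.
   Context: For a functor $p:\mathcal F\to\mathcal B$, $\mathrm{Sect}(\mathcal B,\mathcal F)$ denotes the category of functors $X:\mathcal B\to\mathcal F$ with $pX=\mathrm{id}$, with natural transformations over the identity as morphisms. For an opfibration $\mathcal E\to\mathcal C$, $\mathcal E(c)$ is the fibre over $c$ and $f_!:\mathcal E(c)\to\mathcal E(c')$ the transition functor along $f:c\to c'$. Simplicial replacement: $\mathbb C$ has as objects functors $\mathbf c=\mathbf c_{[n]}:[n]\to\mathcal C$, $n\ge 0$, i.e. strings $c_0\to\dots\to c_n$; a morphism $\mathbf c_{[n]}\to\mathbf c'_{[m]}$ is a monotone map $a:[m]\to[n]$ with $\mathbf c'=\mathbf c\circ a$. It comes with the projection $\mathbb C\to\Delta^{op}$. A map of $\mathbb C$ is Segal if its underlying map $a:[m]\to[n]$ satisfies $a(i)=i$ for $0\le i\le m$. Transpose fibration: for an opfibration $p:\mathcal E\to\mathcal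 C$, $\mathcal E^\top\to\mathcal C^{op}$ is the Grothendieck fibration where $\mathcal E^\top$ has the same objects as $\mathcal E$ and a morphism $x\to z$ is an isomorphism class of cospans $x\to y\leftarrow z$ in $\mathcal E$ with $p(x\to y)$ an identity and $z\to y$ opcartesian; the map lies over $p(z\to y)$. It has the same fibres and transition functors as $\mathcal E\to\mathcal C$, read contravariantly over $\mathcal C^{op}$. Simplicial extension: $\mathbf E\to\mathbb C$ is the opfibration obtained by the covariant Grothendieck construction from $\mathbf c_{[n]}\mapsto \mathbf E(\mathbf c_{[n]})=\mathrm{Sect}([n]^{op},(\mathbf c_{[n]}^{op})^*\mathcal E^\top)$, where a map $\alpha:\mathbf c\to\mathbf c'$ acts by restriction of sections $\alpha_!:\mathbf E(\mathbf c)\to\mathbf E(\mathbf c')$ along the underlying map of ordinals. For each Segal map $\alpha$, $\alpha_!$ has a right adjoint $\alpha^*$, so $\mathbf E\to\mathbb C$ is also a fibration along Segal maps. *)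

theory Defs
  imports "HOL-Library.FuncSet"
begin

section \<open>Categories, functors, natural transformations\<close>

record ('o, 'a) cat =
  Ob :: "'o set"
  Arr :: "'a set"
  Dom :: "'a \<Rightarrow> 'o"
  Cod :: "'a \<Rightarrow> 'o"
  Ident :: "'o \<Rightarrow> 'a"
  Comp :: "'a \<Rightarrow> 'a \<Rightarrow> 'a"

text \<open>\<open>Comp A g f\<close> is "g after f"; it is meaningful only if \<open>Cod A f = Dom A g\<close>.
  Objects and arrows form sets of some HOL type, so every category here is small relative to the
  universe of HOL types.\<close>

definition hom :: "('o, 'a) cat \<Rightarrow> 'o \<Rightarrow> 'o \<Rightarrow> 'a set" where
  "hom A x y = {f \<in> Arr A. Dom A f = x \<and> Cod A f = y}"

locale category =
  fixes A :: "('o, 'a) cat"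
  assumes Dom_in_Ob: "f \<in> Arr A \<Longrightarrow> Dom A f \<in> Ob A"
    and Cod_in_Ob: "f \<in> Arr A \<Longrightarrow> Cod A f \<in> Ob A"
    and Ident_in_hom: "x \<in> Ob A \<Longrightarrow> Ident A x \<in> hom A x x"
    and Comp_in_hom: "f \<in> hom A x y \<Longrightarrow> g \<in> hom A y z \<Longrightarrow> Comp A g f \<in> hom A x z"
    and Comp_Ident_left: "f \<in> hom A x y \<Longrightarrow> Comp A (Ident A y) f = f"
    and Comp_Ident_right: "f \<in> hom A x y \<Longrightarrow> Comp A f (Ident A x) = f"
    and Comp_assoc: "f \<in> hom A w x \<Longrightarrow> g \<in> hom A x y \<Longrightarrow> h \<in> hom A y z \<Longrightarrow>
      Comp A h (Comp A g f) = Comp A (Comp A h g) f"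

definition is_iso :: "('o, 'a) cat \<Rightarrow> 'a \<Rightarrow> bool" where
  "is_iso A f \<longleftrightarrow> f \<in> Arr A \<and>
    (\<exists>g \<in> hom A (Cod A f) (Dom A f).
      Comp A g f = Ident A (Dom A f) \<and> Comp A f g = Ident A (Cod A f))"

definition op_cat :: "('o, 'a) cat \<Rightarrow> ('o, 'a) cat" where
  "op_cat A = \<lparr>Ob = Ob A, Arr = Arr A, Dom = Cod A, Cod = Dom A, Ident = Ident A,
    Comp = (\<lambda>g f. Comp A f g)\<rparr>"

definition full_subcat :: "('o, 'a) cat \<Rightarrow> ('o \<Rightarrow> bool) \<Rightarrow> ('o, 'a) cat" where
  "full_subcat A P = A\<lparr>Ob := {x \<in> Ob A. P x},
    Arr := {f \<in> Arr A. P (Dom A f) \<and> P (Cod A f)}\<rparr>"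

record ('o, 'a, 'p, 'b) fctr =
  obm :: "'o \<Rightarrow> 'p"
  arm :: "'a \<Rightarrow> 'b"

definition is_functor :: "('o, 'a) cat \<Rightarrow> ('p, 'b) cat \<Rightarrow> ('o, 'a, 'p, 'b) fctr \<Rightarrow> bool" where
  "is_functor A B F \<longleftrightarrow>
    (\<forall>x \<in> Ob A. obm F x \<in> Ob B) \<and>
    (\<forall>f \<in> Arr A. arm F f \<in> hom B (obm F (Dom A f)) (obm F (Cod A f))) \<and>
    (\<forall>x \<in> Ob A. arm F (Ident A x) = Ident B (obm F x)) \<and>
    (\<forall>f \<in> Arr A. \<forall>g \<in> Arr A. Cod A f = Dom A g \<longrightarrow>
      arm F (Comp A g f) = Comp B (arm F g) (arm F f))"

text \<open>A functor with source \<open>A\<close> is only constrained on \<open>A\<close>. Where functors are themselves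
  objects of a category, they are normalised to be \<open>undefined\<close> elsewhere, so that HOL equality
  is equality of functors.\<close>

definition ext_functor :: "('o, 'a) cat \<Rightarrow> ('o, 'a, 'p, 'b) fctr \<Rightarrow> bool" where
  "ext_functor A F \<longleftrightarrow> obm F \<in> extensional (Ob A) \<and> arm F \<in> extensional (Arr A)"

definition restrict_functor ::
  "('o, 'a) cat \<Rightarrow> ('o, 'a, 'p, 'b) fctr \<Rightarrow> ('o, 'a, 'p, 'b) fctr" where
  "restrict_functor A F = \<lparr>obm = restrict (obm F) (Ob A), arm = restrict (arm F) (Arr A)\<rparr>"

definition id_functor :: "('o, 'a, 'o, 'a) fctr" where
  "id_functor = \<lparr>obm = (\<lambda>x. x), arm = (\<lambda>f. f)\<rparr>"

definition comp_functor ::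
  "('p, 'b, 'q, 'c) fctr \<Rightarrow> ('o, 'a, 'p, 'b) fctr \<Rightarrow> ('o, 'a, 'q, 'c) fctr" where
  "comp_functor G F = \<lparr>obm = obm G \<circ> obm F, arm = arm G \<circ> arm F\<rparr>"

definition nat_trans :: "('o, 'a) cat \<Rightarrow> ('p, 'b) cat \<Rightarrow> ('o, 'a, 'p, 'b) fctr \<Rightarrow>
    ('o, 'a, 'p, 'b) fctr \<Rightarrow> ('o \<Rightarrow> 'b) \<Rightarrow> bool" where
  "nat_trans A B F G \<tau> \<longleftrightarrow>
    (\<forall>x \<in> Ob A. \<tau> x \<in> hom B (obm F x) (obm G x)) \<and>
    (\<forall>f \<in> Arr A. Comp B (\<tau> (Cod A f)) (arm F f) = Comp B (arm G f) (\<tau> (Dom A f)))"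

definition nat_iso :: "('o, 'a) cat \<Rightarrow> ('p, 'b) cat \<Rightarrow> ('o, 'a, 'p, 'b) fctr \<Rightarrow>
    ('o, 'a, 'p, 'b) fctr \<Rightarrow> ('o \<Rightarrow> 'b) \<Rightarrow> bool" where
  "nat_iso A B F G \<tau> \<longleftrightarrow> nat_trans A B F G \<tau> \<and> (\<forall>x \<in> Ob A. is_iso B (\<tau> x))"

definition equivalent_cats :: "('o, 'a) cat \<Rightarrow> ('p, 'b) cat \<Rightarrow> bool" where
  "equivalent_cats A B \<longleftrightarrow> category A \<and> category B \<and>
    (\<exists>F G \<eta> \<epsilon>. is_functor A B F \<and> is_functor B A G \<and>
      nat_iso A A id_functor (comp_functor G F) \<eta> \<and>
      nat_iso B B (comp_functor F G) id_functor \<epsilon>)"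

definition adjunction :: "('o, 'a) cat \<Rightarrow> ('p, 'b) cat \<Rightarrow> ('o, 'a, 'p, 'b) fctr \<Rightarrow>
    ('p, 'b, 'o, 'a) fctr \<Rightarrow> ('o \<Rightarrow> 'a) \<Rightarrow> ('p \<Rightarrow> 'b) \<Rightarrow> bool" where
  "adjunction A B L R \<eta> \<epsilon> \<longleftrightarrow>
    is_functor A B L \<and> is_functor B A R \<and>
    nat_trans A A id_functor (comp_functor R L) \<eta> \<and>
    nat_trans B B (comp_functor L R) id_functor \<epsilon> \<and>
    (\<forall>x \<in> Ob A. Comp B (\<epsilon> (obm L x)) (arm L (\<eta> x)) = Ident B (obm L x)) \<and>
    (\<forall>y \<in> Ob B. Comp A (arm R (\<epsilon> y)) (\<eta> (obm R y)) = Ident A (obm R y))"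

section \<open>Sections, opfibrations, pullbacks, Grothendieck construction\<close>

definition is_section :: "('o, 'a) cat \<Rightarrow> ('p, 'b) cat \<Rightarrow> ('p, 'b, 'o, 'a) fctr \<Rightarrow>
    ('o, 'a, 'p, 'b) fctr \<Rightarrow> bool" where
  "is_section B F p X \<longleftrightarrow> is_functor B F X \<and> ext_functor B X \<and>
    (\<forall>x \<in> Ob B. obm p (obm X x) = x) \<and> (\<forall>f \<in> Arr B. arm p (arm X f) = f)"

text \<open>An arrow of \<open>Sect B F p\<close> is a triple (source, target, components).\<close>

definition Sect :: "('o, 'a) cat \<Rightarrow> ('p, 'b) cat \<Rightarrow> ('p, 'b, 'o, 'a) fctr \<Rightarrow>
    (('o, 'a, 'p, 'b) fctr,
     ('o, 'a, 'p, 'b) fctr \<times> ('o, 'a, 'p, 'b) fctr \<times> ('o \<Rightarrow> 'b)) cat" where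
  "Sect B F p = \<lparr>
    Ob = {X. is_section B F p X},
    Arr = {(X, Y, \<tau>). is_section B F p X \<and> is_section B F p Y \<and> nat_trans B F X Y \<tau> \<and>
      \<tau> \<in> extensional (Ob B) \<and> (\<forall>x \<in> Ob B. arm p (\<tau> x) = Ident B x)},
    Dom = (\<lambda>(X, Y, \<tau>). X),
    Cod = (\<lambda>(X, Y, \<tau>). Y),
    Ident = (\<lambda>X. (X, X, \<lambda>x \<in> Ob B. Ident F (obm X x))),
    Comp = (\<lambda>(Y', Z, \<sigma>) (X, Y, \<tau>). (X, Z, \<lambda>x \<in> Ob B. Comp F (\<sigma> x) (\<tau> x)))\<rparr>"

definition opcartesian :: "('p, 'b) cat \<Rightarrow> ('o, 'a) cat \<Rightarrow> ('p, 'b, 'o, 'a) fctr \<Rightarrow> 'b \<Rightarrow> bool" where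
  "opcartesian E C p f \<longleftrightarrow> f \<in> Arr E \<and>
    (\<forall>g \<in> Arr E. \<forall>h \<in> hom C (obm p (Cod E f)) (obm p (Cod E g)).
      Dom E g = Dom E f \<and> arm p g = Comp C h (arm p f) \<longrightarrow>
      (\<exists>!k. k \<in> hom E (Cod E f) (Cod E g) \<and> arm p k = h \<and> Comp E k f = g))"

definition opfibration :: "('p, 'b) cat \<Rightarrow> ('o, 'a) cat \<Rightarrow> ('p, 'b, 'o, 'a) fctr \<Rightarrow> bool" where
  "opfibration E C p \<longleftrightarrow> category E \<and> category C \<and> is_functor E C p \<and>
    (\<forall>x \<in> Ob E. \<forall>f \<in> Arr C. Dom C f = obm p x \<longrightarrow>
      (\<exists>g. opcartesian E C p g \<and> Dom E g = x \<and> arm p g = f))"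

definition pullback :: "('q, 'c) cat \<Rightarrow> ('p, 'b) cat \<Rightarrow> ('q, 'c, 'o, 'a) fctr \<Rightarrow>
    ('p, 'b, 'o, 'a) fctr \<Rightarrow> ('q \<times> 'p, 'c \<times> 'b) cat" where
  "pullback B X F q = \<lparr>
    Ob = {(b, x). b \<in> Ob B \<and> x \<in> Ob X \<and> obm F b = obm q x},
    Arr = {(\<beta>, \<xi>). \<beta> \<in> Arr B \<and> \<xi> \<in> Arr X \<and> arm F \<beta> = arm q \<xi>},
    Dom = (\<lambda>(\<beta>, \<xi>). (Dom B \<beta>, Dom X \<xi>)),
    Cod = (\<lambda>(\<beta>, \<xi>). (Cod B \<beta>, Cod X \<xi>)),
    Ident = (\<lambda>(b, x). (Ident B b, Ident X x)),
    Comp = (\<lambda>(\<beta>', \<xi>') (\<beta>, \<xi>). (Comp B \<beta>' \<beta>, Comp X \<xi>' \<xi>))\<rparr>"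

definition pullback_proj :: "('q \<times> 'p, 'c \<times> 'b, 'q, 'c) fctr" where
  "pullback_proj = \<lparr>obm = fst, arm = fst\<rparr>"

text \<open>The covariant Grothendieck construction of a functor from \<open>B\<close> to categories, given by its
  values \<open>\<Phi>\<close> on objects and \<open>\<Theta>\<close> on arrows. An arrow from \<open>(b, x)\<close> to \<open>(b', x')\<close> is a pair of
  \<open>\<beta> : b \<rightarrow> b'\<close> and \<open>\<phi> : \<Theta> \<beta> x \<rightarrow> x'\<close>, stored together with its source and target.\<close>

definition grothendieck :: "('o, 'a) cat \<Rightarrow> ('o \<Rightarrow> ('p, 'b) cat) \<Rightarrow>
    ('a \<Rightarrow> ('p, 'b, 'p, 'b) fctr) \<Rightarrow>
    ('o \<times> 'p, ('o \<times> 'p) \<times> ('o \<times> 'p) \<times> ('a \<times> 'b)) cat" where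
  "grothendieck B \<Phi> \<Theta> = \<lparr>
    Ob = {(b, x). b \<in> Ob B \<and> x \<in> Ob (\<Phi> b)},
    Arr = {((b, x), (b', x'), (\<beta>, \<phi>)). \<beta> \<in> hom B b b' \<and> x \<in> Ob (\<Phi> b) \<and> x' \<in> Ob (\<Phi> b') \<and>
      \<phi> \<in> hom (\<Phi> b') (obm (\<Theta> \<beta>) x) x'},
    Dom = (\<lambda>(s, t, u). s),
    Cod = (\<lambda>(s, t, u). t),
    Ident = (\<lambda>(b, x). ((b, x), (b, x), (Ident B b, Ident (\<Phi> b) x))),
    Comp = (\<lambda>(t', (b'', z), (\<gamma>, \<psi>)) (s, t, (\<beta>, \<phi>)).
      (s, (b'', z), (Comp B \<gamma> \<beta>, Comp (\<Phi> b'') \<psi> (arm (\<Theta> \<gamma>) \<phi>))))\<rparr>"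

definition grothendieck_proj ::
  "('o \<times> 'p, ('o \<times> 'p) \<times> ('o \<times> 'p) \<times> ('a \<times> 'b), 'o, 'a) fctr" where
  "grothendieck_proj = \<lparr>obm = fst, arm = (\<lambda>(s, t, (\<beta>, \<phi>)). \<beta>)\<rparr>"

section \<open>The transpose fibration\<close>

text \<open>A cospan \<open>x \<rightarrow> y \<leftarrow> z\<close> is the pair \<open>(u, v)\<close> of its legs \<open>u : x \<rightarrow> y\<close> and \<open>v : z \<rightarrow> y\<close>.\<close>

definition tcospan :: "('p, 'b) cat \<Rightarrow> ('o, 'a) cat \<Rightarrow> ('p, 'b, 'o, 'a) fctr \<Rightarrow>
    'p \<Rightarrow> 'p \<Rightarrow> 'b \<times> 'b \<Rightarrow> bool" where
  "tcospan E C p x z = (\<lambda>(u, v). u \<in> Arr E \<and> Dom E u = x \<and> v \<in> Arr E \<and> Dom E v = z \<and>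
    Cod E u = Cod E v \<and> arm p u = Ident C (obm p x) \<and> opcartesian E C p v)"

definition cospan_iso :: "('p, 'b) cat \<Rightarrow> 'b \<times> 'b \<Rightarrow> 'b \<times> 'b \<Rightarrow> bool" where
  "cospan_iso E = (\<lambda>(u, v) (u', v'). \<exists>w \<in> hom E (Cod E v) (Cod E v').
    is_iso E w \<and> Comp E w u = u' \<and> Comp E w v = v')"

definition tclass :: "('p, 'b) cat \<Rightarrow> ('o, 'a) cat \<Rightarrow> ('p, 'b, 'o, 'a) fctr \<Rightarrow>
    'p \<Rightarrow> 'p \<Rightarrow> 'b \<times> 'b \<Rightarrow> ('b \<times> 'b) set" where
  "tclass E C p x z k = {k'. tcospan E C p x z k' \<and> cospan_iso E k k'}"

text \<open>To compose \<open>x \<rightarrow> y \<leftarrow> z\<close> with \<open>z \<rightarrow> w \<leftarrow> z'\<close>, complete \<open>y \<leftarrow> z \<rightarrow> w\<close> to a commutative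
  square by an opcartesian \<open>e : w \<rightarrow> w'\<close> over the image of \<open>v : z \<rightarrow> y\<close> and the induced
  \<open>t : y \<rightarrow> w'\<close> over an identity, giving \<open>x \<rightarrow> y \<rightarrow> w' \<leftarrow> w \<leftarrow> z'\<close>. The composites obtained from all
  representatives and all choices of \<open>e\<close> and \<open>t\<close> make up exactly one isomorphism class.\<close>

definition tcomp :: "('p, 'b) cat \<Rightarrow> ('o, 'a) cat \<Rightarrow> ('p, 'b, 'o, 'a) fctr \<Rightarrow>
    ('b \<times> 'b) set \<Rightarrow> ('b \<times> 'b) set \<Rightarrow> ('b \<times> 'b) set" where
  "tcomp E C p L K = {(Comp E t u, Comp E e v') | t u e v'.
    \<exists>v u'. (u, v) \<in> K \<and> (u', v') \<in> L \<and>
      opcartesian E C p e \<and> Dom E e = Cod E u' \<and> arm p e = arm p v \<and>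
      t \<in> hom E (Cod E v) (Cod E e) \<and> arm p t = Ident C (obm p (Cod E v)) \<and>
      Comp E t v = Comp E e u'}"

definition transpose :: "('p, 'b) cat \<Rightarrow> ('o, 'a) cat \<Rightarrow> ('p, 'b, 'o, 'a) fctr \<Rightarrow>
    ('p, 'p \<times> 'p \<times> ('b \<times> 'b) set) cat" where
  "transpose E C p = \<lparr>
    Ob = Ob E,
    Arr = {(x, z, K). x \<in> Ob E \<and> z \<in> Ob E \<and> (\<exists>k. tcospan E C p x z k \<and> K = tclass E C p x z k)},
    Dom = (\<lambda>(x, z, K). x),
    Cod = (\<lambda>(x, z, K). z),
    Ident = (\<lambda>x. (x, x, tclass E C p x x (Ident E x, Ident E x))),
    Comp = (\<lambda>(z', w, L) (x, z, K). (x, w, tcomp E C p L K))\<rparr>"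

text \<open>The projection of the transpose to \<open>op_cat C\<close>; all representatives \<open>(u, v)\<close> of an
  isomorphism class have the same \<open>arm p v\<close>.\<close>

definition transpose_proj :: "('p, 'b, 'o, 'a) fctr \<Rightarrow>
    ('p, 'p \<times> 'p \<times> ('b \<times> 'b) set, 'o, 'a) fctr" where
  "transpose_proj p = \<lparr>obm = obm p,
    arm = (\<lambda>(x, z, K). THE f. \<exists>u v. (u, v) \<in> K \<and> f = arm p v)\<rparr>"

section \<open>The simplicial replacement\<close>

definition ord_cat :: "nat \<Rightarrow> (nat, nat \<times> nat) cat" where
  "ord_cat n = \<lparr>Ob = {0..n}, Arr = {(i, j). i \<le> j \<and> j \<le> n}, Dom = fst, Cod = snd,
    Ident = (\<lambda>i. (i, i)), Comp = (\<lambda>(j', k) (i, j). (i, k))\<rparr>"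

definition ord_map :: "(nat \<Rightarrow> nat) \<Rightarrow> (nat, nat \<times> nat, nat, nat \<times> nat) fctr" where
  "ord_map a = \<lparr>obm = a, arm = (\<lambda>(i, j). (a i, a j))\<rparr>"

type_synonym ('o, 'a) simplex = "nat \<times> (nat, nat \<times> nat, 'o, 'a) fctr"

type_synonym ('o, 'a) simplex_arr =
  "('o, 'a) simplex \<times> ('o, 'a) simplex \<times> (nat \<Rightarrow> nat)"

definition is_simplex :: "('o, 'a) cat \<Rightarrow> ('o, 'a) simplex \<Rightarrow> bool" where
  "is_simplex C = (\<lambda>(n, c). is_functor (ord_cat n) C c \<and> ext_functor (ord_cat n) c)"

definition simp_repl :: "('o, 'a) cat \<Rightarrow> (('o, 'a) simplex, ('o, 'a) simplex_arr) cat" where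
  "simp_repl C = \<lparr>
    Ob = {c. is_simplex C c},
    Arr = {((n, c), (m, c'), a). is_simplex C (n, c) \<and> is_simplex C (m, c') \<and>
      a \<in> {0..m} \<rightarrow>\<^sub>E {0..n} \<and> mono_on {0..m} a \<and>
      c' = restrict_functor (ord_cat m) (comp_functor c (ord_map a))},
    Dom = (\<lambda>(s, t, a). s),
    Cod = (\<lambda>(s, t, a). t),
    Ident = (\<lambda>(n, c). ((n, c), (n, c), \<lambda>i \<in> {0..n}. i)),
    Comp = (\<lambda>(t', (k, c''), b) (s, t, a). (s, (k, c''), \<lambda>i \<in> {0..k}. a (b i)))\<rparr>"

definition segal :: "('o, 'a) cat \<Rightarrow> ('o, 'a) simplex_arr \<Rightarrow> bool" where
  "segal C = (\<lambda>((n, c), (m, c'), a).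
    ((n, c), (m, c'), a) \<in> Arr (simp_repl C) \<and> (\<forall>i \<in> {0..m}. a i = i))"

section \<open>The simplicial extension\<close>

type_synonym ('p, 'b) lifted_simplex =
  "(nat, nat \<times> nat, nat \<times> 'p, (nat \<times> nat) \<times> ('p \<times> 'p \<times> ('b \<times> 'b) set)) fctr"

type_synonym ('p, 'b) lifted_simplex_arr =
  "('p, 'b) lifted_simplex \<times> ('p, 'b) lifted_simplex \<times>
   (nat \<Rightarrow> (nat \<times> nat) \<times> ('p \<times> 'p \<times> ('b \<times> 'b) set))"

text \<open>A functor and its opposite have the same object and arrow maps, so \<open>c\<close> below also serves as
  a functor from \<open>op_cat (ord_cat n)\<close> to \<open>op_cat C\<close>.\<close>

definition ext_fibre :: "('p, 'b) cat \<Rightarrow> ('o, 'a) cat \<Rightarrow> ('p, 'b, 'o, 'a) fctr \<Rightarrow>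
    ('o, 'a) simplex \<Rightarrow> (('p, 'b) lifted_simplex, ('p, 'b) lifted_simplex_arr) cat" where
  "ext_fibre E C p = (\<lambda>(n, c). Sect (op_cat (ord_cat n))
    (pullback (op_cat (ord_cat n)) (transpose E C p) c (transpose_proj p)) pullback_proj)"

text \<open>Restriction of sections along the ordinal map \<open>a\<close>: the pullback of \<open>F\<close> along \<open>c \<circ> a\<close> is
  the pullback along \<open>a\<close> of the pullback along \<open>c\<close>, so only the first coordinate is re-indexed.\<close>

definition restrict_section :: "nat \<Rightarrow> (nat \<Rightarrow> nat) \<Rightarrow>
    ('p, 'b) lifted_simplex \<Rightarrow> ('p, 'b) lifted_simplex" where
  "restrict_section m a S = \<lparr>
    obm = (\<lambda>i \<in> Ob (op_cat (ord_cat m)). (i, snd (obm S (a i)))),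
    arm = (\<lambda>f \<in> Arr (op_cat (ord_cat m)). (f, snd (arm S (arm (ord_map a) f))))\<rparr>"

definition ext_trans ::
  "('o, 'a) simplex_arr \<Rightarrow>
   (('p, 'b) lifted_simplex, ('p, 'b) lifted_simplex_arr,
    ('p, 'b) lifted_simplex, ('p, 'b) lifted_simplex_arr) fctr" where
  "ext_trans = (\<lambda>((n, c), (m, c'), a). \<lparr>
    obm = restrict_section m a,
    arm = (\<lambda>(S, T, \<tau>). (restrict_section m a S, restrict_section m a T,
      \<lambda>i \<in> Ob (op_cat (ord_cat m)). (Ident (op_cat (ord_cat m)) i, snd (\<tau> (a i)))))\<rparr>)"

definition simp_ext where
  "simp_ext E C p = grothendieck (simp_repl C) (ext_fibre E C p) ext_trans"

text \<open>For a section \<open>X\<close> and \<open>\<alpha> : c \<rightarrow> c'\<close>, write \<open>X c = (c, S)\<close> and \<open>X \<alpha> = (\<alpha>, \<phi>)\<close> with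
  \<open>\<phi> : \<alpha>\<^sub>! S \<rightarrow> X c'\<close>. The induced map \<open>X c \<rightarrow> \<alpha>\<^sup>* (X c')\<close> is the transpose of \<open>\<phi>\<close> under the
  adjunction of \<open>\<alpha>\<^sub>!\<close> with its right adjoint \<open>R = \<alpha>\<^sup>*\<close>. Right adjoints being unique up to
  isomorphism, the choice of \<open>R\<close> is immaterial; with the existential quantifier the condition is
  not vacuous if there is none.\<close>

definition cartesian_at where
  "cartesian_at E C p X \<alpha> \<longleftrightarrow>
    (let c = Dom (simp_repl C) \<alpha>; c' = Cod (simp_repl C) \<alpha>;
         S = snd (obm X c); \<phi> = snd (snd (snd (arm X \<alpha>)))
     in \<exists>R \<eta> \<epsilon>. adjunction (ext_fibre E C p c) (ext_fibre E C p c') (ext_trans \<alpha>) R \<eta> \<epsilon> \<and>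
          is_iso (ext_fibre E C p c) (Comp (ext_fibre E C p c) (arm R \<phi>) (\<eta> S)))"

end

theory Submission
  imports Defs
begin

text \<open>
  Sections of \<open>E \<rightarrow> C\<close> are recovered from sections \<open>X\<close> of the simplicial extension by looking only at
  vertices and edges. A section \<open>X\<close> assigns to a simplex \<open>s = (c\<^sub>0 \<rightarrow> \<dots> \<rightarrow> c\<^sub>n)\<close> objects
  \<open>x s i\<close> over \<open>c\<^sub>i\<close>, arrows \<open>x s j \<rightarrow> x s i\<close> of the transpose for \<open>i \<le> j\<close>, and to a map \<open>a\<close>
  from \<open>s\<close> to \<open>u\<close> vertical arrows \<open>x s (a i) \<rightarrow> x u i\<close>.

  Two facts about the transpose carry the argument. An arrow \<open>x \<rightarrow> z\<close> of it factors as a vertical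
  arrow of \<open>E\<close> (\<open>vert\<close>) followed by a reversed opcartesian arrow of \<open>E\<close> (\<open>cart\<close>), both embeddings are
  faithful, and an equation between mixed composites amounts to a commutative square in \<open>E\<close>
  (\<open>interchange\<close>). The arrows \<open>cart v\<close> are the cartesian ones: arrows of the transpose lift uniquely
  through them (\<open>is_cart_lift\<close>, \<open>is_cart_cancel\<close>).

  Restriction to an initial segment \<open>c\<^sub>0 \<rightarrow> \<dots> \<rightarrow> c\<^sub>m\<close> has a right adjoint, which prolongs a section by
  cartesian lifts of its last object (\<open>segal_extension\<close>). An isomorphism into the value of the right
  adjoint is the same as a couniversal arrow (\<open>couniversal_iff_iso\<close>), so \<open>X\<close> is cartesian at a Segal map
  exactly if the arrows \<open>x s i \<rightarrow> x s k \<rightarrow> x u k\<close> with \<open>k = min i m\<close> are cartesian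
  (\<open>cartesian_at_iff\<close>).

  For the Segal map from \<open>s\<close> to its first vertex this gives opcartesian arrows
  \<open>v s i : Y c\<^sub>0 \<rightarrow> x s i\<close> of \<open>E\<close>, where \<open>Y c\<close> is the value at the vertex \<open>c\<close>. For an
  edge \<open>f : c \<rightarrow> d\<close> let \<open>Y f\<close> be \<open>Y c \<rightarrow> x f 1 \<rightarrow> Y d\<close>. The key
  identity is that the vertical action \<open>t\<close> of a map \<open>a\<close> from \<open>s\<close> to \<open>u\<close> satisfies
  \<open>t i \<cdot> v s (a i) = v u i \<cdot> Y (c\<^sub>0 \<rightarrow> c\<^sub>k)\<close> with \<open>k = a 0\<close> (\<open>vtr_opc\<close>). Applied to triangles, it
  yields functoriality of \<open>Y\<close>. A map \<open>h\<close> of cartesian sections satisfies \<open>h s i \<cdot> v s i = v' s i \<cdot> h c\<^sub>0 0\<close>, and since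
  \<open>v s i\<close> is opcartesian this determines \<open>h\<close> from its values on vertices and, read as a definition,
  extends every map of sections of \<open>E\<close>; naturality of the extension is the key identity again. So
  \<open>X \<mapsto> Y\<close> is fully faithful. With a cleavage in which lifts of identities are identities, a section
  \<open>Y\<close> is the image of the cartesian section with \<open>v s i\<close> the chosen lift of \<open>c\<^sub>0 \<rightarrow> c\<^sub>i\<close> at
  \<open>Y c\<^sub>0\<close>. Thus \<open>X \<mapsto> Y\<close> is fully faithful and surjective on objects.
\<close>

section \<open>Categories, functors and equivalences\<close>

lemma in_hom_iff: "f \<in> hom A x y \<longleftrightarrow> f \<in> Arr A \<and> Dom A f = x \<and> Cod A f = y"
  by (simp add: hom_def)

context category begin

lemma Ident_simps [simp]:
  assumes "x \<in> Ob A"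
  shows "Ident A x \<in> Arr A" "Dom A (Ident A x) = x" "Cod A (Ident A x) = x"
  using Ident_in_hom[OF assms] by (auto simp: hom_def)

lemma Comp_simps [simp]:
  assumes "f \<in> Arr A" "g \<in> Arr A" "Cod A f = Dom A g"
  shows "Comp A g f \<in> Arr A" "Dom A (Comp A g f) = Dom A f" "Cod A (Comp A g f) = Cod A g"
  using Comp_in_hom[of f "Dom A f" "Cod A f" g "Cod A g"] assms by (auto simp: hom_def)

lemma Ob_simps [simp]:
  assumes "f \<in> Arr A" shows "Dom A f \<in> Ob A" "Cod A f \<in> Ob A"
  using assms Dom_in_Ob Cod_in_Ob by auto

lemma Ident_left [simp]: "f \<in> Arr A \<Longrightarrow> Cod A f = y \<Longrightarrow> Comp A (Ident A y) f = f"
  using Comp_Ident_left[of f "Dom A f"] by (auto simp: hom_def)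

lemma Ident_right [simp]: "f \<in> Arr A \<Longrightarrow> Dom A f = x \<Longrightarrow> Comp A f (Ident A x) = f"
  using Comp_Ident_right[of f x "Cod A f"] by (auto simp: hom_def)

lemma assoc:
  "f \<in> Arr A \<Longrightarrow> g \<in> Arr A \<Longrightarrow> h \<in> Arr A \<Longrightarrow> Cod A f = Dom A g \<Longrightarrow> Cod A g = Dom A h \<Longrightarrow>
   Comp A (Comp A h g) f = Comp A h (Comp A g f)"
  using Comp_assoc[of f "Dom A f" "Cod A f" g "Cod A g" h "Cod A h"] by (auto simp: hom_def)

lemma is_isoI:
  "f \<in> Arr A \<Longrightarrow> g \<in> Arr A \<Longrightarrow> Dom A g = Cod A f \<Longrightarrow> Cod A g = Dom A f \<Longrightarrow>
   Comp A g f = Ident A (Dom A f) \<Longrightarrow> Comp A f g = Ident A (Cod A f) \<Longrightarrow> is_iso A f"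
  unfolding is_iso_def by (auto simp: hom_def)

lemma is_isoE:
  assumes "is_iso A f"
  obtains g where "f \<in> Arr A" "g \<in> Arr A" "Dom A g = Cod A f" "Cod A g = Dom A f"
    "Comp A g f = Ident A (Dom A f)" "Comp A f g = Ident A (Cod A f)"
  using assms unfolding is_iso_def by (auto simp: hom_def)

lemma is_iso_Ident: "x \<in> Ob A \<Longrightarrow> is_iso A (Ident A x)"
  by (rule is_isoI[of _ "Ident A x"]) auto

end

lemma categoryI:
  assumes "\<And>f. f \<in> Arr A \<Longrightarrow> Dom A f \<in> Ob A"
    and "\<And>f. f \<in> Arr A \<Longrightarrow> Cod A f \<in> Ob A"
    and "\<And>x. x \<in> Ob A \<Longrightarrow> Ident A x \<in> Arr A \<and> Dom A (Ident A x) = x \<and> Cod A (Ident A x) = x"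
    and "\<And>f g. f \<in> Arr A \<Longrightarrow> g \<in> Arr A \<Longrightarrow> Cod A f = Dom A g \<Longrightarrow>
      Comp A g f \<in> Arr A \<and> Dom A (Comp A g f) = Dom A f \<and> Cod A (Comp A g f) = Cod A g"
    and "\<And>f. f \<in> Arr A \<Longrightarrow> Comp A (Ident A (Cod A f)) f = f"
    and "\<And>f. f \<in> Arr A \<Longrightarrow> Comp A f (Ident A (Dom A f)) = f"
    and "\<And>f g h. f \<in> Arr A \<Longrightarrow> g \<in> Arr A \<Longrightarrow> h \<in> Arr A \<Longrightarrow> Cod A f = Dom A g \<Longrightarrow>
      Cod A g = Dom A h \<Longrightarrow> Comp A h (Comp A g f) = Comp A (Comp A h g) f"
  shows "category A"
  by unfold_locales (use assms in \<open>auto simp: hom_def\<close>)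

lemma is_functorI:
  assumes "\<And>x. x \<in> Ob A \<Longrightarrow> obm F x \<in> Ob B"
    and "\<And>f. f \<in> Arr A \<Longrightarrow> arm F f \<in> Arr B \<and> Dom B (arm F f) = obm F (Dom A f) \<and>
      Cod B (arm F f) = obm F (Cod A f)"
    and "\<And>x. x \<in> Ob A \<Longrightarrow> arm F (Ident A x) = Ident B (obm F x)"
    and "\<And>f g. f \<in> Arr A \<Longrightarrow> g \<in> Arr A \<Longrightarrow> Cod A f = Dom A g \<Longrightarrow>
      arm F (Comp A g f) = Comp B (arm F g) (arm F f)"
  shows "is_functor A B F"
  unfolding is_functor_def using assms by (auto simp: hom_def)

lemma is_functorD:
  assumes "is_functor A B F"
  shows "x \<in> Ob A \<Longrightarrow> obm F x \<in> Ob B"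
    and "f \<in> Arr A \<Longrightarrow> arm F f \<in> Arr B"
    and "f \<in> Arr A \<Longrightarrow> Dom B (arm F f) = obm F (Dom A f)"
    and "f \<in> Arr A \<Longrightarrow> Cod B (arm F f) = obm F (Cod A f)"
    and "x \<in> Ob A \<Longrightarrow> arm F (Ident A x) = Ident B (obm F x)"
    and "f \<in> Arr A \<Longrightarrow> g \<in> Arr A \<Longrightarrow> Cod A f = Dom A g \<Longrightarrow>
      arm F (Comp A g f) = Comp B (arm F g) (arm F f)"
  using assms unfolding is_functor_def by (auto simp: hom_def)

lemma category_full_subcat:
  assumes "category A" shows "category (full_subcat A P)"
proof -
  interpret A: category A by fact
  show ?thesis
    by (rule categoryI) (auto simp: full_subcat_def A.assoc)
qed

lemma full_subcat_simps [simp]: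
  "Dom (full_subcat A P) = Dom A" "Cod (full_subcat A P) = Cod A"
  "Ident (full_subcat A P) = Ident A" "Comp (full_subcat A P) = Comp A"
  by (simp_all add: full_subcat_def)

lemma category_op_cat:
  assumes "category A" shows "category (op_cat A)"
proof -
  interpret A: category A by fact
  show ?thesis
    by (rule categoryI) (auto simp: op_cat_def A.assoc)
qed

text \<open>Surjectivity on objects, in place of essential surjectivity, lets the unit be the identity; the
  counit is the unique preimage of an identity.\<close>

lemma equivalent_cats_if_fully_faithful:
  assumes A: "category A" and B: "category B" and G: "is_functor B A G"
    and surj: "\<And>y. y \<in> Ob A \<Longrightarrow> \<exists>x \<in> Ob B. obm G x = y"
    and ff: "\<And>x x' g. x \<in> Ob B \<Longrightarrow> x' \<in> Ob B \<Longrightarrow> g \<in> Arr A \<Longrightarrow> Dom A g = obm G x \<Longrightarrow>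
      Cod A g = obm G x' \<Longrightarrow> \<exists>!f. f \<in> Arr B \<and> Dom B f = x \<and> Cod B f = x' \<and> arm G f = g"
  shows "equivalent_cats A B"
proof -
  interpret A: category A by fact
  interpret B: category B by fact
  note G = is_functorD[OF G]
  have faithful: "f = f'" if "f \<in> Arr B" "f' \<in> Arr B" "Dom B f = Dom B f'" "Cod B f = Cod B f'"
    "arm G f = arm G f'" for f f'
    using ff[of "Dom B f'" "Cod B f'" "arm G f'"] that G(2,3,4) by auto
  define Fo where "Fo y = (SOME x. x \<in> Ob B \<and> obm G x = y)" for y
  have Fo: "Fo y \<in> Ob B" "obm G (Fo y) = y" if "y \<in> Ob A" for y
    using someI_ex[of "\<lambda>x. x \<in> Ob B \<and> obm G x = y"] surj[OF that] unfolding Fo_def by auto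
  define lift where "lift x x' g = (THE f. f \<in> Arr B \<and> Dom B f = x \<and> Cod B f = x' \<and> arm G f = g)"
    for x x' g
  have lift: "lift x x' g \<in> Arr B" "Dom B (lift x x' g) = x" "Cod B (lift x x' g) = x'"
      "arm G (lift x x' g) = g"
    if "x \<in> Ob B" "x' \<in> Ob B" "g \<in> Arr A" "Dom A g = obm G x" "Cod A g = obm G x'" for x x' g
    using theI'[OF ff[OF that]] unfolding lift_def by auto
  define F where "F = \<lparr>obm = Fo, arm = (\<lambda>g. lift (Fo (Dom A g)) (Fo (Cod A g)) g)\<rparr>"
  have F_obm: "obm F y = Fo y" for y by (simp add: F_def)
  have F_arm: "arm F g \<in> Arr B" "Dom B (arm F g) = Fo (Dom A g)"
      "Cod B (arm F g) = Fo (Cod A g)" "arm G (arm F g) = g" if "g \<in> Arr A" for g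
    using that lift[of "Fo (Dom A g)" "Fo (Cod A g)" g] Fo by (auto simp: F_def)
  have F: "is_functor A B F"
    by (rule is_functorI) (auto simp: F_obm F_arm Fo G intro!: faithful)
  define counit where "counit x = lift (Fo (obm G x)) x (Ident A (obm G x))" for x
  have counit: "counit x \<in> Arr B" "Dom B (counit x) = Fo (obm G x)" "Cod B (counit x) = x"
      "arm G (counit x) = Ident A (obm G x)" if "x \<in> Ob B" for x
    using that lift[of "Fo (obm G x)" x "Ident A (obm G x)"] by (auto simp: counit_def G Fo)
  have counit_iso: "is_iso B (counit x)" if x: "x \<in> Ob B" for x
  proof (rule B.is_isoI)
    let ?g = "lift x (Fo (obm G x)) (Ident A (obm G x))"
    note g = lift[of x "Fo (obm G x)" "Ident A (obm G x)"]
    show "?g \<in> Arr B" "Dom B ?g = Cod B (counit x)" "Cod B ?g = Dom B (counit x)"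
      using x g by (auto simp: counit G Fo)
    show "Comp B ?g (counit x) = Ident B (Dom B (counit x))"
      "Comp B (counit x) ?g = Ident B (Cod B (counit x))"
      using x g by (auto simp: counit G Fo intro!: faithful)
  qed (use x counit in auto)
  have "nat_iso A A id_functor (comp_functor G F) (\<lambda>y. Ident A y)"
    unfolding nat_iso_def nat_trans_def id_functor_def comp_functor_def
    by (auto simp: hom_def F_arm F_obm Fo A.is_iso_Ident)
  moreover have "nat_iso B B (comp_functor F G) id_functor counit"
    unfolding nat_iso_def nat_trans_def id_functor_def comp_functor_def
    by (auto simp: hom_def F_arm F_obm Fo counit counit_iso G intro!: faithful)
  ultimately show ?thesis
    unfolding equivalent_cats_def using A B F assms(3) by blast
qed

section \<open>Couniversal arrows\<close>

text \<open>A terminal object of the comma category of \<open>L\<close> over \<open>y\<close>. Phrasing the cartesian condition through it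
  removes the choice of a right adjoint.\<close>

definition couniversal :: "('o, 'a) cat \<Rightarrow> ('p, 'b) cat \<Rightarrow> ('o, 'a, 'p, 'b) fctr \<Rightarrow>
    'p \<Rightarrow> 'o \<Rightarrow> 'b \<Rightarrow> bool" where
  "couniversal A B L y x f \<longleftrightarrow> x \<in> Ob A \<and> f \<in> hom B (obm L x) y \<and>
    (\<forall>x' \<in> Ob A. \<forall>g \<in> hom B (obm L x') y. \<exists>!h. h \<in> hom A x' x \<and> Comp B f (arm L h) = g)"

lemma couniversalD:
  assumes "couniversal A B L y x f"
  shows "x \<in> Ob A" "f \<in> Arr B" "Dom B f = obm L x" "Cod B f = y"
  using assms by (auto simp: couniversal_def hom_def)

lemma couniversal_lift:
  assumes "couniversal A B L y x f" "x' \<in> Ob A" "g \<in> Arr B" "Dom B g = obm L x'" "Cod B g = y"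
  obtains h where "h \<in> Arr A" "Dom A h = x'" "Cod A h = x" "Comp B f (arm L h) = g"
  using assms unfolding couniversal_def by (metis in_hom_iff)

lemma couniversal_cancel:
  assumes "couniversal A B L y x f" and L: "is_functor A B L" and "category A" "category B"
    and "h \<in> Arr A" "h' \<in> Arr A" "Dom A h = Dom A h'" "Cod A h = x" "Cod A h' = x"
    and "Comp B f (arm L h) = Comp B f (arm L h')"
  shows "h = h'"
proof -
  interpret A: category A by fact
  interpret B: category B by fact
  note L = is_functorD[OF L] and u = couniversalD[OF assms(1)]
  have "Dom A h \<in> Ob A" "Comp B f (arm L h) \<in> hom B (obm L (Dom A h)) y"
    using assms u L by (auto simp: hom_def)
  then show ?thesis
    using assms unfolding couniversal_def by (metis in_hom_iff)
qed

text \<open>Terminal objects are unique up to isomorphism, and whatever is isomorphic to a terminal object is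
  terminal.\<close>

lemma couniversal_iff_iso:
  assumes A: "category A" and B: "category B" and L: "is_functor A B L"
    and u0: "couniversal A B L y x0 f0"
    and k: "k \<in> Arr A" "Dom A k = x" "Cod A k = x0" "Comp B f0 (arm L k) = f"
  shows "is_iso A k \<longleftrightarrow> couniversal A B L y x f"
proof
  interpret A: category A by fact
  interpret B: category B by fact
  note L' = is_functorD[OF L] and u0' = couniversalD[OF u0]
  note cancel0 = couniversal_cancel[OF u0 L A B]
  {
    assume "is_iso A k"
    then obtain k' where k': "k' \<in> Arr A" "Dom A k' = x0" "Cod A k' = x"
      "Comp A k' k = Ident A x" "Comp A k k' = Ident A x0" using k by (auto elim: A.is_isoE)
    have f: "f \<in> hom B (obm L x) y" using k L' u0' by (auto simp: hom_def)
    have Lf: "Comp B f (arm L h) = Comp B f0 (arm L (Comp A k h))"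
      if "h \<in> Arr A" "Cod A h = x" for h
      using that k k' L' u0' by (auto simp: B.assoc simp flip: k(4))
    have "\<exists>!h. h \<in> hom A x' x \<and> Comp B f (arm L h) = g"
      if x': "x' \<in> Ob A" and g: "g \<in> hom B (obm L x') y" for x' g
    proof -
      from g couniversal_lift[OF u0 x', of g] obtain h where
        h: "h \<in> Arr A" "Dom A h = x'" "Cod A h = x0" "Comp B f0 (arm L h) = g"
        by (auto simp: hom_def)
      show ?thesis
      proof (rule ex1I[of _ "Comp A k' h"])
        have "Comp A k (Comp A k' h) = h"
          using h k k' by (auto simp flip: A.assoc)
        then show "Comp A k' h \<in> hom A x' x \<and> Comp B f (arm L (Comp A k' h)) = g"
          using h k' by (auto simp: hom_def Lf)
      next
        fix h' assume h': "h' \<in> hom A x' x \<and> Comp B f (arm L h') = g"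
        have "Comp A k h' = h"
          by (rule cancel0) (use h h' k Lf[of h'] in \<open>auto simp: hom_def\<close>)
        then show "h' = Comp A k' h" using h' k k' by (auto simp: hom_def simp flip: A.assoc)
      qed
    qed
    then show "couniversal A B L y x f"
      unfolding couniversal_def using f k by auto
  next
    assume u: "couniversal A B L y x f"
    note u' = couniversalD[OF u]
    obtain h where h: "h \<in> Arr A" "Dom A h = x0" "Cod A h = x" "Comp B f (arm L h) = f0"
      using couniversal_lift[OF u u0'] by blast
    have "Comp A h k = Ident A x"
      by (rule couniversal_cancel[OF u L A B])
        (use h k u' L' u0' in \<open>auto simp flip: B.assoc\<close>)
    moreover have "Comp A k h = Ident A x0"
      by (rule cancel0) (use h k u' L' u0' in \<open>auto simp flip: B.assoc\<close>)
    ultimately show "is_iso A k" using h k by (auto intro!: A.is_isoI)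
  }
qed

text \<open>The transpose of \<open>f\<close> under an adjunction is the comparison arrow to which
  \<open>couniversal_iff_iso\<close> applies.\<close>

lemma couniversal_counit:
  assumes A: "category A" and B: "category B" and adj: "adjunction A B L R \<eta> \<epsilon>"
    and y: "y \<in> Ob B"
  shows "couniversal A B L y (obm R y) (\<epsilon> y)"
    and "x \<in> Ob A \<Longrightarrow> f \<in> hom B (obm L x) y \<Longrightarrow>
      Comp A (arm R f) (\<eta> x) \<in> hom A x (obm R y) \<and>
      Comp B (\<epsilon> y) (arm L (Comp A (arm R f) (\<eta> x))) = f"
proof -
  interpret A: category A by fact
  interpret B: category B by fact
  have L: "is_functor A B L" and R: "is_functor B A R" using adj by (auto simp: adjunction_def)
  note L = is_functorD[OF L] and R = is_functorD[OF R]
  have eta: "\<eta> x \<in> Arr A" "Dom A (\<eta> x) = x" "Cod A (\<eta> x) = obm R (obm L x)" if "x \<in> Ob A" for x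
    using adj that by (auto simp: adjunction_def nat_trans_def id_functor_def comp_functor_def hom_def)
  have eta_nat: "Comp A (\<eta> (Cod A h)) h = Comp A (arm R (arm L h)) (\<eta> (Dom A h))" if "h \<in> Arr A" for h
    using adj that by (auto simp: adjunction_def nat_trans_def id_functor_def comp_functor_def)
  have eps: "\<epsilon> z \<in> Arr B" "Dom B (\<epsilon> z) = obm L (obm R z)" "Cod B (\<epsilon> z) = z" if "z \<in> Ob B" for z
    using adj that by (auto simp: adjunction_def nat_trans_def id_functor_def comp_functor_def hom_def)
  have eps_nat: "Comp B (\<epsilon> (Cod B h)) (arm L (arm R h)) = Comp B h (\<epsilon> (Dom B h))" if "h \<in> Arr B" for h
    using adj that by (auto simp: adjunction_def nat_trans_def id_functor_def comp_functor_def)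
  have tri: "Comp B (\<epsilon> (obm L x)) (arm L (\<eta> x)) = Ident B (obm L x)" if "x \<in> Ob A" for x
    using adj that by (auto simp: adjunction_def)
  have tri': "Comp A (arm R (\<epsilon> z)) (\<eta> (obm R z)) = Ident A (obm R z)" if "z \<in> Ob B" for z
    using adj that by (auto simp: adjunction_def)
  have ex: "Comp A (arm R f) (\<eta> x) \<in> hom A x (obm R y) \<and>
      Comp B (\<epsilon> y) (arm L (Comp A (arm R f) (\<eta> x))) = f"
    if x: "x \<in> Ob A" and f: "f \<in> hom B (obm L x) y" for x f
  proof -
    have "Comp B (\<epsilon> y) (arm L (Comp A (arm R f) (\<eta> x)))
        = Comp B (Comp B (\<epsilon> y) (arm L (arm R f))) (arm L (\<eta> x))"
      using x f y by (auto simp: hom_def L R eta eps B.assoc)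
    also have "\<dots> = Comp B f (Comp B (\<epsilon> (obm L x)) (arm L (\<eta> x)))"
      using x f y eps_nat[of f] by (auto simp: hom_def L R eta eps B.assoc)
    finally show ?thesis using x f tri[OF x] by (auto simp: hom_def L R eta)
  qed
  then show "x \<in> Ob A \<Longrightarrow> f \<in> hom B (obm L x) y \<Longrightarrow>
      Comp A (arm R f) (\<eta> x) \<in> hom A x (obm R y) \<and>
      Comp B (\<epsilon> y) (arm L (Comp A (arm R f) (\<eta> x))) = f" .
  have un: "h = Comp A (arm R f) (\<eta> x)"
    if x: "x \<in> Ob A" and h: "h \<in> hom A x (obm R y)" "Comp B (\<epsilon> y) (arm L h) = f" for x f h
  proof -
    have "Comp A (arm R f) (\<eta> x) = Comp A (arm R (\<epsilon> y)) (Comp A (arm R (arm L h)) (\<eta> x))"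
      using x h(1) y by (auto simp: hom_def L R eta eps A.assoc simp flip: h(2))
    also have "\<dots> = Comp A (Comp A (arm R (\<epsilon> y)) (\<eta> (obm R y))) h"
      using x h(1) y eta_nat[of h] by (auto simp: hom_def L R eta eps A.assoc)
    finally show ?thesis using tri'[OF y] h(1) by (auto simp: hom_def)
  qed
  show "couniversal A B L y (obm R y) (\<epsilon> y)"
    unfolding couniversal_def using y ex un by (auto simp: R eps hom_def) (metis in_hom_iff)+
qed

lemma adjunction_if_couniversal:
  assumes A: "category A" and B: "category B" and L: "is_functor A B L"
    and ex: "\<And>y. y \<in> Ob B \<Longrightarrow> \<exists>x f. couniversal A B L y x f"
  shows "\<exists>R \<eta> \<epsilon>. adjunction A B L R \<eta> \<epsilon>"
proof -
  interpret A: category A by fact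
  interpret B: category B by fact
  note L' = is_functorD[OF L]
  obtain Ro \<epsilon> where u: "\<And>y. y \<in> Ob B \<Longrightarrow> couniversal A B L y (Ro y) (\<epsilon> y)"
    using ex by metis
  note u' = couniversalD[OF u]
  note cancel = couniversal_cancel[OF u L A B]
  have "\<exists>h. h \<in> Arr A \<and> Dom A h = x \<and> Cod A h = Ro y \<and> Comp B (\<epsilon> y) (arm L h) = g"
    if "x \<in> Ob A" "y \<in> Ob B" "g \<in> hom B (obm L x) y" for x y g
    using couniversal_lift[OF u[OF that(2)] that(1), of g] that(3) by (auto simp: hom_def)
  then obtain tr where tr: "\<And>x y g. x \<in> Ob A \<Longrightarrow> y \<in> Ob B \<Longrightarrow> g \<in> hom B (obm L x) y \<Longrightarrow>
      tr x y g \<in> Arr A \<and> Dom A (tr x y g) = x \<and> Cod A (tr x y g) = Ro y \<and>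
      Comp B (\<epsilon> y) (arm L (tr x y g)) = g"
    by metis
  define R where "R = \<lparr>obm = Ro, arm = (\<lambda>g. tr (Ro (Dom B g)) (Cod B g) (Comp B g (\<epsilon> (Dom B g))))\<rparr>"
  define \<eta> where "\<eta> x = tr x (obm L x) (Ident B (obm L x))" for x
  have Ra: "arm R g \<in> Arr A" "Dom A (arm R g) = Ro (Dom B g)" "Cod A (arm R g) = Ro (Cod B g)"
    "Comp B (\<epsilon> (Cod B g)) (arm L (arm R g)) = Comp B g (\<epsilon> (Dom B g))" if "g \<in> Arr B" for g
    using that tr[of "Ro (Dom B g)" "Cod B g" "Comp B g (\<epsilon> (Dom B g))"]
    by (auto simp: R_def u' hom_def)
  have Ro: "obm R y = Ro y" for y by (simp add: R_def)
  have eta: "\<eta> x \<in> Arr A" "Dom A (\<eta> x) = x" "Cod A (\<eta> x) = Ro (obm L x)"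
    "Comp B (\<epsilon> (obm L x)) (arm L (\<eta> x)) = Ident B (obm L x)" if "x \<in> Ob A" for x
    using that tr[of x "obm L x" "Ident B (obm L x)"]
    by (auto simp: \<eta>_def L' hom_def)
  have R: "is_functor B A R"
  proof (rule is_functorI)
    fix f g assume fg: "f \<in> Arr B" "g \<in> Arr B" "Cod B f = Dom B g"
    have "Comp B (\<epsilon> (Cod B g)) (arm L (Comp A (arm R g) (arm R f)))
        = Comp B (Comp B (\<epsilon> (Cod B g)) (arm L (arm R g))) (arm L (arm R f))"
      using fg by (auto simp: Ra(1-3) u' L' B.assoc)
    also have "\<dots> = Comp B (Comp B g (\<epsilon> (Cod B f))) (arm L (arm R f))"
      using fg Ra(4)[of g] by simp
    also have "\<dots> = Comp B g (Comp B (\<epsilon> (Cod B f)) (arm L (arm R f)))"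
      using fg by (auto simp: Ra(1-3) u' L' B.assoc)
    also have "\<dots> = Comp B (Comp B g f) (\<epsilon> (Dom B f))"
      unfolding Ra(4)[OF fg(1)] using fg by (auto simp: u' B.assoc)
    finally show "arm R (Comp B g f) = Comp A (arm R g) (arm R f)"
      using fg Ra(4)[of "Comp B g f"] by (intro cancel[of "Cod B g"]) (auto simp: Ra(1-3))
  next
    fix y assume "y \<in> Ob B"
    then show "arm R (Ident B y) = Ident A (obm R y)"
      using Ra(4)[of "Ident B y"] by (intro cancel[of y]) (auto simp: Ra(1-3) Ro u' L')
  qed (auto simp: Ro Ra u')
  have "Comp A (\<eta> (Cod A f)) f = Comp A (arm R (arm L f)) (\<eta> (Dom A f))" if f: "f \<in> Arr A" for f
  proof -
    have "Comp B (\<epsilon> (obm L (Cod A f))) (arm L (Comp A (\<eta> (Cod A f)) f))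
        = Comp B (Comp B (\<epsilon> (obm L (Cod A f))) (arm L (\<eta> (Cod A f)))) (arm L f)"
      using f by (auto simp: eta(1-3) u' L' B.assoc)
    also have "\<dots> = Comp B (arm L f) (Comp B (\<epsilon> (obm L (Dom A f))) (arm L (\<eta> (Dom A f))))"
      using f by (auto simp: eta u' L')
    also have "\<dots> = Comp B (Comp B (\<epsilon> (obm L (Cod A f))) (arm L (arm R (arm L f)))) (arm L (\<eta> (Dom A f)))"
      using f Ra(4)[of "arm L f"] by (auto simp: eta(1-3) u' L' Ra(1-3) B.assoc)
    also have "\<dots> = Comp B (\<epsilon> (obm L (Cod A f))) (arm L (Comp A (arm R (arm L f)) (\<eta> (Dom A f))))"
      using f by (auto simp: eta(1-3) u' L' Ra(1-3) B.assoc)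
    finally show ?thesis
      using f by (intro cancel[of "obm L (Cod A f)"]) (auto simp: Ra(1-3) eta L')
  qed
  then have n1: "nat_trans A A id_functor (comp_functor R L) \<eta>"
    unfolding nat_trans_def id_functor_def comp_functor_def by (auto simp: hom_def Ro eta)
  have n2: "nat_trans B B (comp_functor L R) id_functor \<epsilon>"
    unfolding nat_trans_def id_functor_def comp_functor_def by (auto simp: hom_def Ro Ra u')
  have "Comp A (arm R (\<epsilon> y)) (\<eta> (obm R y)) = Ident A (obm R y)" if y: "y \<in> Ob B" for y
  proof -
    have "Comp B (\<epsilon> y) (arm L (Comp A (arm R (\<epsilon> y)) (\<eta> (Ro y))))
      = Comp B (Comp B (\<epsilon> y) (arm L (arm R (\<epsilon> y)))) (arm L (\<eta> (Ro y)))"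
      using y by (auto simp: eta(1-3) u' L' Ra(1-3) B.assoc)
    also have "\<dots> = Comp B (\<epsilon> y) (Comp B (\<epsilon> (obm L (Ro y))) (arm L (\<eta> (Ro y))))"
      using y Ra(4)[of "\<epsilon> y"] by (auto simp: eta(1-3) u' L' Ra(1-3) B.assoc)
    also have "\<dots> = \<epsilon> y" using y by (simp add: eta u')
    finally show ?thesis
      using y by (intro cancel[of y]) (auto simp: Ra(1-3) eta L' u' Ro)
  qed
  then have "adjunction A B L R \<eta> \<epsilon>"
    unfolding adjunction_def using L R n1 n2 eta by (auto simp: Ro)
  then show ?thesis by blast
qed

section \<open>Sections and the Grothendieck construction\<close>

lemma category_Sect:
  assumes B: "category B" and F: "category F" and p: "is_functor F B p"
  shows "category (Sect B F p)"
proof -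
  interpret B: category B by fact
  interpret F: category F by fact
  note p = is_functorD[OF p]
  show ?thesis
  proof (rule categoryI)
    fix X assume X: "X \<in> Ob (Sect B F p)"
    then have "is_functor B F X" by (simp add: Sect_def is_section_def)
    note X' = is_functorD[OF this]
    show "Ident (Sect B F p) X \<in> Arr (Sect B F p) \<and> Dom (Sect B F p) (Ident (Sect B F p) X) = X \<and>
      Cod (Sect B F p) (Ident (Sect B F p) X) = X"
      using X by (auto simp: Sect_def nat_trans_def hom_def X' is_section_def p)
  next
    fix f g assume fg: "f \<in> Arr (Sect B F p)" "g \<in> Arr (Sect B F p)"
      "Cod (Sect B F p) f = Dom (Sect B F p) g"
    then obtain X Y Z \<sigma> \<tau> where [simp]: "f = (X, Y, \<sigma>)" "g = (Y, Z, \<tau>)" by (auto simp: Sect_def)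
    have "is_functor B F X" "is_functor B F Y" "is_functor B F Z"
      using fg by (auto simp: Sect_def is_section_def)
    note XYZ = this[THEN is_functorD(2)] this[THEN is_functorD(3)] this[THEN is_functorD(4)]
    have st: "nat_trans B F X Y \<sigma>" "nat_trans B F Y Z \<tau>"
      "\<And>x. x \<in> Ob B \<Longrightarrow> arm p (\<sigma> x) = Ident B x" "\<And>x. x \<in> Ob B \<Longrightarrow> arm p (\<tau> x) = Ident B x"
      using fg by (auto simp: Sect_def)
    have s: "\<sigma> x \<in> Arr F" "Dom F (\<sigma> x) = obm X x" "Cod F (\<sigma> x) = obm Y x"
      "\<tau> x \<in> Arr F" "Dom F (\<tau> x) = obm Y x" "Cod F (\<tau> x) = obm Z x" if "x \<in> Ob B" for x
      using st that by (auto simp: nat_trans_def hom_def)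
    have nat: "nat_trans B F X Z (\<lambda>x\<in>Ob B. Comp F (\<tau> x) (\<sigma> x))"
    proof -
      have "Comp F (Comp F (\<tau> (Cod B f)) (\<sigma> (Cod B f))) (arm X f) =
         Comp F (arm Z f) (Comp F (\<tau> (Dom B f)) (\<sigma> (Dom B f)))" if f: "f \<in> Arr B" for f
      proof -
        have "Comp F (Comp F (\<tau> (Cod B f)) (\<sigma> (Cod B f))) (arm X f)
            = Comp F (\<tau> (Cod B f)) (Comp F (arm Y f) (\<sigma> (Dom B f)))"
          using f st by (auto simp: nat_trans_def F.assoc s XYZ)
        also have "\<dots> = Comp F (Comp F (\<tau> (Cod B f)) (arm Y f)) (\<sigma> (Dom B f))"
          using f by (auto simp: F.assoc s XYZ)
        also have "\<dots> = Comp F (arm Z f) (Comp F (\<tau> (Dom B f)) (\<sigma> (Dom B f)))"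
          using f st by (auto simp: nat_trans_def F.assoc s XYZ)
        finally show ?thesis .
      qed
      then show ?thesis
        by (auto simp: nat_trans_def hom_def s)
    qed
    show "Comp (Sect B F p) g f \<in> Arr (Sect B F p) \<and>
      Dom (Sect B F p) (Comp (Sect B F p) g f) = Dom (Sect B F p) f \<and>
      Cod (Sect B F p) (Comp (Sect B F p) g f) = Cod (Sect B F p) g"
      using fg nat by (auto simp: Sect_def s p st)
  next
    fix f assume f: "f \<in> Arr (Sect B F p)"
    show "Comp (Sect B F p) (Ident (Sect B F p) (Cod (Sect B F p) f)) f = f"
      "Comp (Sect B F p) f (Ident (Sect B F p) (Dom (Sect B F p) f)) = f"
      using f by (auto simp: Sect_def nat_trans_def hom_def fun_eq_iff extensional_def)
  next
    fix f g h assume "f \<in> Arr (Sect B F p)" "g \<in> Arr (Sect B F p)" "h \<in> Arr (Sect B F p)"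
      "Cod (Sect B F p) f = Dom (Sect B F p) g" "Cod (Sect B F p) g = Dom (Sect B F p) h"
    then show "Comp (Sect B F p) h (Comp (Sect B F p) g f) = Comp (Sect B F p) (Comp (Sect B F p) h g) f"
      by (auto simp: Sect_def nat_trans_def hom_def fun_eq_iff F.assoc)
  qed (auto simp: Sect_def)
qed

lemma is_isoE_Sect:
  assumes "is_iso (Sect B F p) (X, Y, \<tau>)" "x \<in> Ob B"
  shows "is_iso F (\<tau> x)"
  using assms unfolding is_iso_def
  by (auto simp: Sect_def nat_trans_def hom_def fun_eq_iff split: if_splits)

lemma category_grothendieck:
  assumes B: "category B" and \<Phi>: "\<And>b. b \<in> Ob B \<Longrightarrow> category (\<Phi> b)"
    and \<Theta>: "\<And>\<beta>. \<beta> \<in> Arr B \<Longrightarrow> is_functor (\<Phi> (Dom B \<beta>)) (\<Phi> (Cod B \<beta>)) (\<Theta> \<beta>)"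
    and id_ob: "\<And>b x. b \<in> Ob B \<Longrightarrow> x \<in> Ob (\<Phi> b) \<Longrightarrow> obm (\<Theta> (Ident B b)) x = x"
    and id_arr: "\<And>b f. b \<in> Ob B \<Longrightarrow> f \<in> Arr (\<Phi> b) \<Longrightarrow> arm (\<Theta> (Ident B b)) f = f"
    and comp_ob: "\<And>\<beta> \<gamma> x. \<beta> \<in> Arr B \<Longrightarrow> \<gamma> \<in> Arr B \<Longrightarrow> Cod B \<beta> = Dom B \<gamma> \<Longrightarrow> x \<in> Ob (\<Phi> (Dom B \<beta>)) \<Longrightarrow>
      obm (\<Theta> (Comp B \<gamma> \<beta>)) x = obm (\<Theta> \<gamma>) (obm (\<Theta> \<beta>) x)"
    and comp_arr: "\<And>\<beta> \<gamma> f. \<beta> \<in> Arr B \<Longrightarrow> \<gamma> \<in> Arr B \<Longrightarrow> Cod B \<beta> = Dom B \<gamma> \<Longrightarrow> f \<in> Arr (\<Phi> (Dom B \<beta>)) \<Longrightarrow>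
      arm (\<Theta> (Comp B \<gamma> \<beta>)) f = arm (\<Theta> \<gamma>) (arm (\<Theta> \<beta>) f)"
  shows "category (grothendieck B \<Phi> \<Theta>)"
proof -
  interpret B: category B by fact
  note ids = category.Ident_simps[OF \<Phi>] and comps = category.Comp_simps[OF \<Phi>]
    and assoc = category.assoc[OF \<Phi>] and idl = category.Ident_left[OF \<Phi>] and idr = category.Ident_right[OF \<Phi>]
  note T = is_functorD[OF \<Theta>]
  let ?G = "grothendieck B \<Phi> \<Theta>"
  show ?thesis
  proof (rule categoryI)
    fix f assume "f \<in> Arr ?G"
    then show "Dom ?G f \<in> Ob ?G" "Cod ?G f \<in> Ob ?G"
      by (auto simp: grothendieck_def hom_def)
  next
    fix x assume "x \<in> Ob ?G"
    then show "Ident ?G x \<in> Arr ?G \<and> Dom ?G (Ident ?G x) = x \<and> Cod ?G (Ident ?G x) = x"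
      by (auto simp: grothendieck_def hom_def ids id_ob)
  next
    fix f g assume "f \<in> Arr ?G" "g \<in> Arr ?G" "Cod ?G f = Dom ?G g"
    then show "Comp ?G g f \<in> Arr ?G \<and> Dom ?G (Comp ?G g f) = Dom ?G f \<and> Cod ?G (Comp ?G g f) = Cod ?G g"
      by (auto simp: grothendieck_def hom_def comps T comp_ob)
  next
    fix f assume "f \<in> Arr ?G"
    then show "Comp ?G (Ident ?G (Cod ?G f)) f = f"
      by (auto simp: grothendieck_def hom_def idl id_arr)
  next
    fix f assume "f \<in> Arr ?G"
    then obtain b x b' x' \<beta> \<phi> where [simp]: "f = ((b, x), (b', x'), (\<beta>, \<phi>))" and
      f: "\<beta> \<in> Arr B" "Dom B \<beta> = b" "Cod B \<beta> = b'" "x \<in> Ob (\<Phi> b)" "x' \<in> Ob (\<Phi> b')"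
      "\<phi> \<in> Arr (\<Phi> b')" "Dom (\<Phi> b') \<phi> = obm (\<Theta> \<beta>) x" "Cod (\<Phi> b') \<phi> = x'"
      by (auto simp: grothendieck_def hom_def)
    have "arm (\<Theta> \<beta>) (Ident (\<Phi> b) x) = Ident (\<Phi> b') (obm (\<Theta> \<beta>) x)"
      using T(5)[of \<beta> x] f by auto
    then show "Comp ?G f (Ident ?G (Dom ?G f)) = f"
      using f idr[of b' \<phi>] by (auto simp: grothendieck_def hom_def)
  next
    fix f g h assume "f \<in> Arr ?G" "g \<in> Arr ?G" "h \<in> Arr ?G" "Cod ?G f = Dom ?G g"
      "Cod ?G g = Dom ?G h"
    then obtain b0 x0 b1 x1 b2 x2 b3 x3 \<alpha> \<beta> \<gamma> \<phi> \<psi> \<chi> where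
      [simp]: "f = ((b0, x0), (b1, x1), (\<alpha>, \<phi>))" "g = ((b1, x1), (b2, x2), (\<beta>, \<psi>))"
        "h = ((b2, x2), (b3, x3), (\<gamma>, \<chi>))" and
      base: "\<alpha> \<in> hom B b0 b1" "\<beta> \<in> hom B b1 b2" "\<gamma> \<in> hom B b2 b3" and
      fib: "\<phi> \<in> hom (\<Phi> b1) (obm (\<Theta> \<alpha>) x0) x1" "\<psi> \<in> hom (\<Phi> b2) (obm (\<Theta> \<beta>) x1) x2"
        "\<chi> \<in> hom (\<Phi> b3) (obm (\<Theta> \<gamma>) x2) x3"
      by (auto simp: grothendieck_def)
    have b: "b0 \<in> Ob B" "b1 \<in> Ob B" "b2 \<in> Ob B" "b3 \<in> Ob B"
      using base by (auto simp: hom_def)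
    have 1: "arm (\<Theta> \<beta>) \<phi> \<in> hom (\<Phi> b2) (obm (\<Theta> \<beta>) (obm (\<Theta> \<alpha>) x0)) (obm (\<Theta> \<beta>) x1)"
      using T(2-4)[of \<beta> \<phi>] base fib by (auto simp: hom_def)
    have 2: "arm (\<Theta> \<gamma>) f \<in> hom (\<Phi> b3) (obm (\<Theta> \<gamma>) x) (obm (\<Theta> \<gamma>) y)"
      if "f \<in> hom (\<Phi> b2) x y" for f x y
      using T(2-4)[of \<gamma> f] base that by (auto simp: hom_def)
    have "arm (\<Theta> \<gamma>) (Comp (\<Phi> b2) \<psi> (arm (\<Theta> \<beta>) \<phi>))
        = Comp (\<Phi> b3) (arm (\<Theta> \<gamma>) \<psi>) (arm (\<Theta> \<gamma>) (arm (\<Theta> \<beta>) \<phi>))"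
      using T(6)[of \<gamma> "arm (\<Theta> \<beta>) \<phi>" \<psi>] base fib 1 by (auto simp: hom_def)
    moreover have "arm (\<Theta> (Comp B \<gamma> \<beta>)) \<phi> = arm (\<Theta> \<gamma>) (arm (\<Theta> \<beta>) \<phi>)"
      using comp_arr[of \<beta> \<gamma> \<phi>] base fib by (auto simp: hom_def)
    ultimately show "Comp ?G h (Comp ?G g f) = Comp ?G (Comp ?G h g) f"
      using base fib b category.Comp_assoc[OF \<Phi>[OF b(4)] 2[OF 1] 2[OF fib(2)] fib(3)]
      by (auto simp: grothendieck_def B.assoc hom_def)
  qed
qed

lemma is_functor_grothendieck_proj:
  "is_functor (grothendieck B \<Phi> \<Theta>) B grothendieck_proj"
  by (rule is_functorI) (auto simp: grothendieck_def grothendieck_proj_def hom_def)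

lemma category_pullback:
  assumes "category B" "category X" "category A" and F: "is_functor B A F" and q: "is_functor X A q"
  shows "category (pullback B X F q)"
proof -
  interpret B: category B by fact
  interpret X: category X by fact
  note F = is_functorD[OF F] and q = is_functorD[OF q]
  show ?thesis
    by (rule categoryI) (auto simp: pullback_def F q B.assoc X.assoc simp flip: F(3,4))
qed

lemma is_functor_pullback_proj: "is_functor (pullback B X F q) B pullback_proj"
  by (rule is_functorI) (auto simp: pullback_def pullback_proj_def)


section \<open>Opcartesian arrows\<close>

locale opfib =
  fixes C :: "('o, 'a) cat" and E :: "('p, 'b) cat" and p :: "('p, 'b, 'o, 'a) fctr"
  assumes C: "category C" and E: "category E" and opfib: "opfibration E C p"
begin

sublocale C: category C by (rule C)
sublocale E: category E by (rule E)

abbreviation compE (infixr "\<cdot>" 70) where "g \<cdot> f \<equiv> Comp E g f"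
abbreviation opcart where "opcart \<equiv> opcartesian E C p"
abbreviation vertical where "vertical u \<equiv> u \<in> Arr E \<and> arm p u = Ident C (obm p (Dom E u))"

lemma p_functor: "is_functor E C p" using opfib by (simp add: opfibration_def)
lemmas p_simps [simp] = is_functorD[OF p_functor]

lemma vertical_Cod: "vertical u \<Longrightarrow> obm p (Cod E u) = obm p (Dom E u)"
  by (metis p_simps(1) p_simps(4) C.Ident_simps(3) E.Ob_simps(1))

lemma opcart_Arr [simp]: "opcart f \<Longrightarrow> f \<in> Arr E"
  by (simp add: opcartesian_def)

lemma opcart_lift:
  assumes "opcart f" "g \<in> Arr E" "Dom E g = Dom E f" "h \<in> Arr C" "Dom C h = obm p (Cod E f)"
    "Cod C h = obm p (Cod E g)" "arm p g = Comp C h (arm p f)"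
  obtains k where "k \<in> Arr E" "Dom E k = Cod E f" "Cod E k = Cod E g" "arm p k = h" "k \<cdot> f = g"
  using assms unfolding opcartesian_def by (metis in_hom_iff)

lemma opcart_cancel:
  assumes f: "opcart f" and k: "k \<in> Arr E" "k' \<in> Arr E" "Dom E k = Cod E f" "Dom E k' = Cod E f"
    and "Cod E k = Cod E k'" "arm p k = arm p k'" "k \<cdot> f = k' \<cdot> f"
  shows "k = k'"
proof -
  have "arm p k \<in> hom C (obm p (Cod E f)) (obm p (Cod E (k \<cdot> f)))" "k \<cdot> f \<in> Arr E"
    "Dom E (k \<cdot> f) = Dom E f" "arm p (k \<cdot> f) = Comp C (arm p k) (arm p f)"
    using assms by (auto simp: hom_def)
  then have "\<exists>!l. l \<in> hom E (Cod E f) (Cod E (k \<cdot> f)) \<and> arm p l = arm p k \<and> l \<cdot> f = k \<cdot> f"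
    using f unfolding opcartesian_def by blast
  moreover have "k \<in> hom E (Cod E f) (Cod E (k \<cdot> f))" "k' \<in> hom E (Cod E f) (Cod E (k \<cdot> f))"
    using assms by (auto simp: hom_def)
  ultimately show ?thesis using assms by metis
qed

lemma opcartI:
  assumes "f \<in> Arr E"
    and "\<And>g h. g \<in> Arr E \<Longrightarrow> Dom E g = Dom E f \<Longrightarrow> h \<in> Arr C \<Longrightarrow> Dom C h = obm p (Cod E f) \<Longrightarrow>
      Cod C h = obm p (Cod E g) \<Longrightarrow> arm p g = Comp C h (arm p f) \<Longrightarrow>
      \<exists>k \<in> Arr E. Dom E k = Cod E f \<and> Cod E k = Cod E g \<and> arm p k = h \<and> k \<cdot> f = g"
    and "\<And>k k'. k \<in> Arr E \<Longrightarrow> k' \<in> Arr E \<Longrightarrow> Dom E k = Cod E f \<Longrightarrow> Dom E k' = Cod E f \<Longrightarrow>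
      Cod E k = Cod E k' \<Longrightarrow> arm p k = arm p k' \<Longrightarrow> k \<cdot> f = k' \<cdot> f \<Longrightarrow> k = k'"
  shows "opcart f"
  unfolding opcartesian_def
proof (intro conjI ballI impI)
  fix g h assume "g \<in> Arr E" "h \<in> hom C (obm p (Cod E f)) (obm p (Cod E g))"
    "Dom E g = Dom E f \<and> arm p g = Comp C h (arm p f)"
  then show "\<exists>!k. k \<in> hom E (Cod E f) (Cod E g) \<and> arm p k = h \<and> k \<cdot> f = g"
    using assms(2)[of g h] assms(3) by (auto simp: hom_def)
qed (rule assms(1))

lemma opcart_comp:
  assumes f: "opcart f" and g: "opcart g" and fg: "Cod E f = Dom E g"
  shows "opcart (g \<cdot> f)"
proof (rule opcartI)
  fix k h assume k: "k \<in> Arr E" "Dom E k = Dom E (g \<cdot> f)" and h: "h \<in> Arr C"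
    "Dom C h = obm p (Cod E (g \<cdot> f))" "Cod C h = obm p (Cod E k)"
    "arm p k = Comp C h (arm p (g \<cdot> f))"
  obtain l where l: "l \<in> Arr E" "Dom E l = Cod E f" "Cod E l = Cod E k"
    "arm p l = Comp C h (arm p g)" "l \<cdot> f = k"
    by (rule opcart_lift[OF f, of k "Comp C h (arm p g)"]) (use f g fg k h in \<open>auto simp: C.assoc\<close>)
  obtain m where "m \<in> Arr E" "Dom E m = Cod E g" "Cod E m = Cod E l" "arm p m = h" "m \<cdot> g = l"
    by (rule opcart_lift[OF g, of l h]) (use f g fg k h l in auto)
  then show "\<exists>m \<in> Arr E. Dom E m = Cod E (g \<cdot> f) \<and> Cod E m = Cod E k \<and> arm p m = h \<and> m \<cdot> g \<cdot> f = k"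
    using f g fg k h l by (intro bexI[of _ m]) (auto simp flip: E.assoc)
next
  fix k k' assume k: "k \<in> Arr E" "k' \<in> Arr E" "Dom E k = Cod E (g \<cdot> f)" "Dom E k' = Cod E (g \<cdot> f)"
    "Cod E k = Cod E k'" "arm p k = arm p k'" "k \<cdot> g \<cdot> f = k' \<cdot> g \<cdot> f"
  have "k \<cdot> g = k' \<cdot> g"
    by (rule opcart_cancel[OF f]) (use f g fg k in \<open>auto simp: E.assoc\<close>)
  then show "k = k'"
    by - (rule opcart_cancel[OF g], use f g fg k in auto)
qed (use assms in auto)

lemma opcart_cancel_right:
  assumes f: "opcart f" and gf: "opcart (g \<cdot> f)" and g: "g \<in> Arr E" "Cod E f = Dom E g"
  shows "opcart g"
proof (rule opcartI)
  fix k h assume k: "k \<in> Arr E" "Dom E k = Dom E g" and h: "h \<in> Arr C"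
    "Dom C h = obm p (Cod E g)" "Cod C h = obm p (Cod E k)"
    "arm p k = Comp C h (arm p g)"
  obtain l where l: "l \<in> Arr E" "Dom E l = Cod E g" "Cod E l = Cod E k"
    "arm p l = h" "l \<cdot> g \<cdot> f = k \<cdot> f"
    by (rule opcart_lift[OF gf, of "k \<cdot> f" h]) (use f g k h in \<open>auto simp: C.assoc\<close>)
  have "l \<cdot> g = k"
    by (rule opcart_cancel[OF f]) (use f g k h l in \<open>auto simp: E.assoc\<close>)
  then show "\<exists>m \<in> Arr E. Dom E m = Cod E g \<and> Cod E m = Cod E k \<and> arm p m = h \<and> m \<cdot> g = k"
    using l by auto
next
  fix k k' assume k: "k \<in> Arr E" "k' \<in> Arr E" "Dom E k = Cod E g" "Dom E k' = Cod E g"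
    "Cod E k = Cod E k'" "arm p k = arm p k'" "k \<cdot> g = k' \<cdot> g"
  show "k = k'"
    by (rule opcart_cancel[OF gf]) (use f g k in \<open>auto simp flip: E.assoc\<close>)
qed (use assms in auto)

text \<open>The lift of \<open>k\<close> along an isomorphism \<open>f\<close> is forced to be \<open>k \<cdot> f\<inverse>\<close>.\<close>

lemma opcart_iso:
  assumes "is_iso E f" shows "opcart f"
proof -
  from assms obtain f' where f: "f \<in> Arr E" "f' \<in> Arr E" "Dom E f' = Cod E f" "Cod E f' = Dom E f"
    "f' \<cdot> f = Ident E (Dom E f)" "f \<cdot> f' = Ident E (Cod E f)" by (rule E.is_isoE)
  show ?thesis
  proof (rule opcartI)
    fix k h assume k: "k \<in> Arr E" "Dom E k = Dom E f" and h: "h \<in> Arr C"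
      "Dom C h = obm p (Cod E f)" "Cod C h = obm p (Cod E k)"
      "arm p k = Comp C h (arm p f)"
    have "Comp C (arm p f) (arm p f') = Ident C (obm p (Cod E f))"
      using arg_cong[OF f(6), of "arm p"] f(1-4) by simp
    then show "\<exists>l \<in> Arr E. Dom E l = Cod E f \<and> Cod E l = Cod E k \<and> arm p l = h \<and> l \<cdot> f = k"
      using f k h by (intro bexI[of _ "k \<cdot> f'"]) (auto simp: C.assoc E.assoc)
  next
    fix k k' assume k: "k \<in> Arr E" "k' \<in> Arr E" "Dom E k = Cod E f" "Dom E k' = Cod E f"
      "k \<cdot> f = k' \<cdot> f"
    have "k = (k \<cdot> f) \<cdot> f'" "k' = (k' \<cdot> f) \<cdot> f'" using f k(1-4) by (simp_all add: E.assoc)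
    then show "k = k'" using k(5) by simp
  qed (use f in auto)
qed

lemma opcart_Ident [simp]: "x \<in> Ob E \<Longrightarrow> opcart (Ident E x)"
  by (rule opcart_iso) (rule E.is_iso_Ident)

lemma vertical_opcart_iso:
  assumes "opcart u" "vertical u" shows "is_iso E u"
proof -
  note c = vertical_Cod[OF assms(2)]
  obtain k where k: "k \<in> Arr E" "Dom E k = Cod E u" "Cod E k = Cod E (Ident E (Dom E u))"
    "arm p k = Ident C (obm p (Dom E u))" "k \<cdot> u = Ident E (Dom E u)"
    by (rule opcart_lift[OF assms(1), of "Ident E (Dom E u)" "Ident C (obm p (Dom E u))"])
      (use assms c in auto)
  have "u \<cdot> k = Ident E (Cod E u)"
    by (rule opcart_cancel[OF assms(1)]) (use assms k c in \<open>auto simp: E.assoc\<close>)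
  then show ?thesis using k assms by (intro E.is_isoI) auto
qed

lemma opcart_unique:
  assumes f: "opcart f" and f': "opcart f'" and "Dom E f = Dom E f'" "arm p f = arm p f'"
  obtains w where "w \<in> Arr E" "Dom E w = Cod E f" "Cod E w = Cod E f'" "is_iso E w"
    "vertical w" "w \<cdot> f = f'"
proof -
  have c: "obm p (Cod E f) = obm p (Cod E f')"
    using assms by (metis p_simps(4) opcart_Arr)
  obtain w where w: "w \<in> Arr E" "Dom E w = Cod E f" "Cod E w = Cod E f'"
      "arm p w = Ident C (obm p (Cod E f))" "w \<cdot> f = f'"
    by (rule opcart_lift[OF f, of f' "Ident C (obm p (Cod E f))"]) (use assms c in auto)
  moreover have "opcart w" by (rule opcart_cancel_right[OF f]) (use w f f' in auto)
  ultimately show ?thesis using vertical_opcart_iso that by auto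
qed

lemma opcart_exists:
  assumes "x \<in> Ob E" "f \<in> Arr C" "Dom C f = obm p x"
  obtains g where "opcart g" "Dom E g = x" "arm p g = f"
  using opfib assms unfolding opfibration_def by blast

section \<open>The transpose\<close>

abbreviation D where "D \<equiv> transpose E C p"
abbreviation q where "q \<equiv> transpose_proj p"
abbreviation compD (infixr "\<diamondop>" 70) where "g \<diamondop> f \<equiv> Comp (transpose E C p) g f"

text \<open>The cospans \<open>(u, v)\<close> that represent an arrow of the transpose; below, \<open>tmor u v\<close> is the arrow with
  representative \<open>(u, v)\<close>.\<close>

abbreviation legs where "legs u v \<equiv> vertical u \<and> opcart v \<and> Cod E u = Cod E v"

definition tmor :: "'b \<Rightarrow> 'b \<Rightarrow> 'p \<times> 'p \<times> ('b \<times> 'b) set" where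
  "tmor u v = (Dom E u, Dom E v, tclass E C p (Dom E u) (Dom E v) (u, v))"

lemma tclass_iff:
  "(u', v') \<in> tclass E C p x z (u, v) \<longleftrightarrow> legs u' v' \<and> Dom E u' = x \<and> Dom E v' = z \<and>
    (\<exists>w. w \<in> Arr E \<and> Dom E w = Cod E v \<and> Cod E w = Cod E v' \<and> is_iso E w \<and>
      w \<cdot> u = u' \<and> w \<cdot> v = v')"
  unfolding tclass_def tcospan_def cospan_iso_def by (auto simp: hom_def)

text \<open>The comparison of two representatives of an arrow of the transpose is automatically vertical, because
  it is compatible with the vertical legs.\<close>

lemma vertical_left:
  assumes "vertical u" "w \<in> Arr E" "Dom E w = Cod E u" "vertical (w \<cdot> u)"
  shows "vertical w"
  using assms vertical_Cod[OF assms(1)] by auto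

lemma vertical_comp [simp]:
  assumes "vertical u" "vertical w" "Dom E w = Cod E u"
  shows "arm p (w \<cdot> u) = Ident C (obm p (Dom E u))"
  using assms vertical_Cod[OF assms(1)] by auto

lemma tmor_eqI:
  assumes "legs u v" "legs u' v'" "w \<in> Arr E" "Dom E w = Cod E v" "Cod E w = Cod E v'" "is_iso E w"
    "w \<cdot> u = u'" "w \<cdot> v = v'"
  shows "tmor u v = tmor u' v'"
proof -
  from assms(6) obtain w' where w: "w' \<in> Arr E" "Dom E w' = Cod E w" "Cod E w' = Dom E w"
    "w' \<cdot> w = Ident E (Dom E w)" "w \<cdot> w' = Ident E (Cod E w)" by (rule E.is_isoE)
  have w': "is_iso E w'" by (rule E.is_isoI[of _ w]) (use w assms in auto)
  have iso_comp: "is_iso E (b \<cdot> a)" if ab: "is_iso E a" "is_iso E b" "Cod E a = Dom E b" for a b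
  proof -
    obtain a' where a: "a \<in> Arr E" "a' \<in> Arr E" "Dom E a' = Cod E a" "Cod E a' = Dom E a"
      "a' \<cdot> a = Ident E (Dom E a)" "a \<cdot> a' = Ident E (Cod E a)" using ab(1) by (rule E.is_isoE)
    obtain b' where b: "b \<in> Arr E" "b' \<in> Arr E" "Dom E b' = Cod E b" "Cod E b' = Dom E b"
      "b' \<cdot> b = Ident E (Dom E b)" "b \<cdot> b' = Ident E (Cod E b)" using ab(2) by (rule E.is_isoE)
    have "b' \<cdot> b \<cdot> a = a" "a \<cdot> a' \<cdot> b' = b'" using a b ab(3) by (auto simp flip: E.assoc)
    then show ?thesis using a b ab(3)
      by (intro E.is_isoI[of _ "a' \<cdot> b'"]) (auto simp: E.assoc)
  qed
  have "(a, b) \<in> tclass E C p (Dom E u) (Dom E v) (u, v) \<longleftrightarrow>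
      (a, b) \<in> tclass E C p (Dom E u) (Dom E v) (u', v')" for a b
  proof
    assume "(a, b) \<in> tclass E C p (Dom E u) (Dom E v) (u, v)"
    then obtain x where x: "legs a b \<and> Dom E a = Dom E u \<and> Dom E b = Dom E v" "x \<in> Arr E"
      "Dom E x = Cod E v" "Cod E x = Cod E b" "is_iso E x" "x \<cdot> u = a" "x \<cdot> v = b"
      unfolding tclass_iff by blast
    have "w' \<cdot> u' = u" "w' \<cdot> v' = v"
      unfolding assms(7,8)[symmetric] using w assms(1-6) by (simp_all flip: E.assoc)
    then have "(x \<cdot> w') \<cdot> u' = a" "(x \<cdot> w') \<cdot> v' = b"
      using x(2-7) w(1-3) assms(1-6) by (simp_all add: E.assoc)
    moreover have "is_iso E (x \<cdot> w')" by (rule iso_comp[OF w' x(5)]) (use x(3) w(3) assms(4) in simp)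
    moreover have "x \<cdot> w' \<in> Arr E" "Dom E (x \<cdot> w') = Cod E v'" "Cod E (x \<cdot> w') = Cod E b"
      using x(2-4) w(1-3) assms(4,5) by simp_all
    ultimately show "(a, b) \<in> tclass E C p (Dom E u) (Dom E v) (u', v')"
      unfolding tclass_iff using x(1) by blast
  next
    assume "(a, b) \<in> tclass E C p (Dom E u) (Dom E v) (u', v')"
    then obtain x where x: "legs a b \<and> Dom E a = Dom E u \<and> Dom E b = Dom E v" "x \<in> Arr E"
      "Dom E x = Cod E v'" "Cod E x = Cod E b" "is_iso E x" "x \<cdot> u' = a" "x \<cdot> v' = b"
      unfolding tclass_iff by blast
    have "(x \<cdot> w) \<cdot> u = a" "(x \<cdot> w) \<cdot> v = b"
      using x(2-7) assms by (simp_all add: E.assoc)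
    moreover have "is_iso E (x \<cdot> w)" by (rule iso_comp[OF assms(6) x(5)]) (use x(3) assms(5) in simp)
    moreover have "x \<cdot> w \<in> Arr E" "Dom E (x \<cdot> w) = Cod E v" "Cod E (x \<cdot> w) = Cod E b"
      using x(2-4) assms(3-5) by simp_all
    ultimately show "(a, b) \<in> tclass E C p (Dom E u) (Dom E v) (u, v)"
      unfolding tclass_iff using x(1) by blast
  qed
  then have "tclass E C p (Dom E u) (Dom E v) (u, v) = tclass E C p (Dom E u) (Dom E v) (u', v')"
    by auto
  moreover have "Dom E u' = Dom E u" "Dom E v' = Dom E v"
    unfolding assms(7,8)[symmetric] using assms(1-4) by simp_all
  ultimately show ?thesis unfolding tmor_def by simp
qed

lemma legs_in_tclass:
  assumes "legs u v" shows "(u, v) \<in> tclass E C p (Dom E u) (Dom E v) (u, v)"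
  unfolding tclass_iff using assms E.is_iso_Ident by (auto intro!: exI[of _ "Ident E (Cod E v)"])

lemma tmor_eqE:
  assumes "tmor u v = tmor u' v'" "legs u' v'"
  obtains w where "w \<in> Arr E" "Dom E w = Cod E v" "Cod E w = Cod E v'" "is_iso E w"
    "w \<cdot> u = u'" "w \<cdot> v = v'"
proof -
  have "(u', v') \<in> tclass E C p (Dom E u) (Dom E v) (u, v)"
    using legs_in_tclass[OF assms(2)] assms(1) by (auto simp: tmor_def)
  then show ?thesis using that unfolding tclass_iff by blast
qed

text \<open>A vertical endomorphism that fixes the opcartesian leg is the identity.\<close>

lemma tmor_eq_same_right:
  assumes "tmor u v = tmor u' v" "legs u v" "legs u' v"
  shows "u = u'"
proof -
  from tmor_eqE[OF assms(1,3)] obtain w where w: "w \<in> Arr E" "Dom E w = Cod E v"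
    "Cod E w = Cod E v" "w \<cdot> u = u'" "w \<cdot> v = v" by metis
  have "vertical w" using vertical_left[of u w] w assms(2,3) by auto
  then have "w = Ident E (Cod E v)"
    by - (rule opcart_cancel[of v], use w assms in auto)
  then show ?thesis using w assms(2) by auto
qed

lemma D_Arr_iff: "f \<in> Arr D \<longleftrightarrow> (\<exists>u v. legs u v \<and> f = tmor u v)"
proof
  assume "f \<in> Arr D"
  then show "\<exists>u v. legs u v \<and> f = tmor u v"
    unfolding transpose_def tcospan_def tmor_def by auto
next
  assume "\<exists>u v. legs u v \<and> f = tmor u v"
  then obtain u v where l: "legs u v" and f: "f = tmor u v" by blast
  have "tcospan E C p (Dom E u) (Dom E v) (u, v)" using l by (simp add: tcospan_def)
  then show "f \<in> Arr D" unfolding transpose_def f tmor_def using l by auto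
qed

lemma tmor_simps [simp]:
  assumes "legs u v"
  shows "tmor u v \<in> Arr D" "Dom D (tmor u v) = Dom E u" "Cod D (tmor u v) = Dom E v"
    "arm q (tmor u v) = arm p v"
proof -
  show "tmor u v \<in> Arr D" using assms by (auto simp: D_Arr_iff)
  show "Dom D (tmor u v) = Dom E u" "Cod D (tmor u v) = Dom E v"
    by (auto simp: tmor_def transpose_def)
  have unique: "arm p v' = arm p v" if "(u', v') \<in> tclass E C p (Dom E u) (Dom E v) (u, v)" for u' v'
  proof -
    from that obtain w where w: "legs u' v'" "w \<in> Arr E" "Dom E w = Cod E v" "Cod E w = Cod E v'"
      "w \<cdot> u = u'" "w \<cdot> v = v'" "Dom E u' = Dom E u"
      unfolding tclass_iff by blast
    then have "vertical w" using vertical_left[of u w] assms by auto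
    then have "arm p (w \<cdot> v) = arm p v" using w(2,3,4) assms by auto
    then show ?thesis using w by simp
  qed
  have "(THE f. \<exists>u' v'. (u', v') \<in> tclass E C p (Dom E u) (Dom E v) (u, v) \<and> f = arm p v') = arm p v"
    by (rule the_equality) (use legs_in_tclass[OF assms] unique in blast)+
  then show "arm q (tmor u v) = arm p v"
    by (simp add: transpose_proj_def tmor_def)
qed

lemma D_Ob [simp]: "Ob D = Ob E" by (simp add: transpose_def)
lemma q_obm [simp]: "obm q = obm p" by (simp add: transpose_proj_def)

lemma D_Arr_cases:
  assumes "f \<in> Arr D"
  obtains u v where "legs u v" "f = tmor u v" "Dom D f = Dom E u" "Cod D f = Dom E v"
    "arm q f = arm p v"
proof -
  from assms obtain u v where "legs u v" "f = tmor u v" unfolding D_Arr_iff by blast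
  then show ?thesis using that by simp
qed

text \<open>Composition may be computed from arbitrary representatives and an arbitrary completion of the
  square. Any other choice is compared with the given one by the essentially unique isomorphism
  between two opcartesian arrows with the same source and image; conversely, any representative of the
  class arises by composing the given completion with an isomorphism.\<close>

lemma compD_tmor:
  assumes K: "legs u v" and L: "legs u' v'" and vu': "Dom E v = Dom E u'"
    and e: "opcart e" "Dom E e = Cod E u'" "arm p e = arm p v"
    and t: "vertical t" "Dom E t = Cod E v" "Cod E t = Cod E e" and sq: "t \<cdot> v = e \<cdot> u'"
  shows "tmor u' v' \<diamondop> tmor u v = tmor (t \<cdot> u) (e \<cdot> v')" and "legs (t \<cdot> u) (e \<cdot> v')"
proof -
  show l: "legs (t \<cdot> u) (e \<cdot> v')"
    using assms vertical_Cod[of u] by (auto simp: opcart_comp)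
  let ?K = "tclass E C p (Dom E u) (Dom E v) (u, v)"
  let ?L = "tclass E C p (Dom E u') (Dom E v') (u', v')"
  have "(a, b) \<in> tcomp E C p ?L ?K \<longleftrightarrow> (a, b) \<in> tclass E C p (Dom E u) (Dom E v') (t \<cdot> u, e \<cdot> v')" for a b
  proof
    assume "(a, b) \<in> tcomp E C p ?L ?K"
    then obtain t0 u0 e0 v0' v0 u0' where ab: "a = t0 \<cdot> u0" "b = e0 \<cdot> v0'" and
      0: "(u0, v0) \<in> ?K" "(u0', v0') \<in> ?L" "opcart e0" "Dom E e0 = Cod E u0'" "arm p e0 = arm p v0"
      "t0 \<in> Arr E" "Dom E t0 = Cod E v0" "Cod E t0 = Cod E e0" "arm p t0 = Ident C (obm p (Cod E v0))"
      "t0 \<cdot> v0 = e0 \<cdot> u0'"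
      unfolding tcomp_def hom_def by blast
    obtain w where w: "legs u0 v0" "Dom E u0 = Dom E u" "Dom E v0 = Dom E v" "w \<in> Arr E"
      "Dom E w = Cod E v" "Cod E w = Cod E v0" "is_iso E w" "w \<cdot> u = u0" "w \<cdot> v = v0"
      using 0(1) unfolding tclass_iff by blast
    obtain w' where w': "legs u0' v0'" "Dom E u0' = Dom E u'" "Dom E v0' = Dom E v'" "w' \<in> Arr E"
      "Dom E w' = Cod E v'" "Cod E w' = Cod E v0'" "is_iso E w'" "w' \<cdot> u' = u0'" "w' \<cdot> v' = v0'"
      using 0(2) unfolding tclass_iff by blast
    have vw: "vertical w" using vertical_left[of u w] K w by auto
    have vw': "vertical w'" using vertical_left[of u' w'] L w' by auto
    have ew: "opcart (e0 \<cdot> w')" by (rule opcart_comp) (use 0 w' opcart_iso in auto)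
    have pv: "arm p v0 = arm p v" unfolding w(9)[symmetric] using vw w(4-6) K by auto
    have pe: "arm p (e0 \<cdot> w') = arm p e"
    proof -
      have "arm p (e0 \<cdot> w') = Comp C (arm p e0) (Ident C (obm p (Dom E w')))"
        using 0 w' vw' by auto
      also have "\<dots> = arm p e0"
        using 0(3,4) w'(1,5,6) vertical_Cod[OF vw'] by simp
      finally show ?thesis using 0 pv e by simp
    qed
    obtain \<omega> where \<omega>: "\<omega> \<in> Arr E" "Dom E \<omega> = Cod E e" "Cod E \<omega> = Cod E (e0 \<cdot> w')" "is_iso E \<omega>"
      "vertical \<omega>" "\<omega> \<cdot> e = e0 \<cdot> w'"
      by (rule opcart_unique[OF e(1) ew]) (use pe e 0 w' L in auto)
    have ut: "\<omega> \<cdot> t = t0 \<cdot> w"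
    proof (rule opcart_cancel[of v])
      have "(\<omega> \<cdot> t) \<cdot> v = (\<omega> \<cdot> e) \<cdot> u'"
        using \<omega>(1,2) t e K L sq by (simp add: E.assoc)
      also have "\<dots> = e0 \<cdot> u0'" using \<omega> 0 w' L by (simp add: E.assoc)
      also have "\<dots> = (t0 \<cdot> w) \<cdot> v" using 0 w K by (simp add: E.assoc)
      finally show "(\<omega> \<cdot> t) \<cdot> v = (t0 \<cdot> w) \<cdot> v" .
      show "arm p (\<omega> \<cdot> t) = arm p (t0 \<cdot> w)"
        using vertical_comp[of t \<omega>] vertical_comp[of w t0] \<omega> t w 0 vw by auto
    qed (use \<omega> t K 0 w w' in auto)
    have "\<omega> \<cdot> t \<cdot> u = a" unfolding ab
      using ut w \<omega> t K 0 by (simp add: E.assoc flip: E.assoc[of u t \<omega>])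
    moreover have "\<omega> \<cdot> e \<cdot> v' = b" unfolding ab
      using w' \<omega> e L 0 by (simp add: E.assoc flip: E.assoc[of v' e \<omega>])
    moreover have "legs a b" "Dom E a = Dom E u" "Dom E b = Dom E v'" unfolding ab
      using 0(3-9) K w(1-3) w'(1-3) vertical_Cod[of u0] by (auto simp: opcart_comp)
    moreover have "Dom E \<omega> = Cod E (e \<cdot> v')" "Cod E \<omega> = Cod E b" unfolding ab
      using \<omega>(1-3) e(1,2) L 0(3,4) w'(1,4-6) by simp_all
    ultimately show "(a, b) \<in> tclass E C p (Dom E u) (Dom E v') (t \<cdot> u, e \<cdot> v')"
      unfolding tclass_iff using \<omega>(1,4) by blast
  next
    assume "(a, b) \<in> tclass E C p (Dom E u) (Dom E v') (t \<cdot> u, e \<cdot> v')"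
    then obtain \<omega> where \<omega>: "legs a b" "Dom E a = Dom E u" "Dom E b = Dom E v'" "\<omega> \<in> Arr E"
      "Dom E \<omega> = Cod E (e \<cdot> v')" "Cod E \<omega> = Cod E b" "is_iso E \<omega>" "\<omega> \<cdot> t \<cdot> u = a" "\<omega> \<cdot> e \<cdot> v' = b"
      unfolding tclass_iff by blast
    have vo: "vertical \<omega>" by (rule vertical_left[of "t \<cdot> u"]) (use \<omega> l e L in auto)
    have *: "(u, v) \<in> ?K" "(u', v') \<in> ?L" using K L legs_in_tclass by auto
    have "opcart (\<omega> \<cdot> e)" by (rule opcart_comp) (use e \<omega> L opcart_iso in auto)
    moreover have "arm p (\<omega> \<cdot> e) = arm p v"
      using \<omega>(4-6) vo e(1,2) L by (simp flip: e(3))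
    moreover have "arm p (\<omega> \<cdot> t) = Ident C (obm p (Cod E v))"
      using vertical_comp[of t \<omega>] t vo \<omega>(4-6) e L by auto
    moreover have "(\<omega> \<cdot> t) \<cdot> v = (\<omega> \<cdot> e) \<cdot> u'"
      using sq \<omega>(4,5) e L K t by (simp add: E.assoc)
    moreover have "a = (\<omega> \<cdot> t) \<cdot> u" "b = (\<omega> \<cdot> e) \<cdot> v'"
      unfolding \<omega>(8,9)[symmetric] using \<omega>(4,5) e L K t by (simp_all add: E.assoc)
    moreover have "Dom E (\<omega> \<cdot> e) = Cod E u'" "\<omega> \<cdot> t \<in> hom E (Cod E v) (Cod E (\<omega> \<cdot> e))"
      using \<omega>(4,5) e L t by (simp_all add: hom_def)
    ultimately show "(a, b) \<in> tcomp E C p ?L ?K"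
      unfolding tcomp_def using * by blast
  qed
  then have "tcomp E C p ?L ?K = tclass E C p (Dom E u) (Dom E v') (t \<cdot> u, e \<cdot> v')"
    by auto
  then show "tmor u' v' \<diamondop> tmor u v = tmor (t \<cdot> u) (e \<cdot> v')"
    unfolding tmor_def transpose_def using assms by auto
qed

text \<open>Any opcartesian lift \<open>e\<close> of the image of \<open>v\<close> will do; \<open>t\<close> is then induced by \<open>v\<close>.\<close>

lemma complete_square:
  assumes "opcart v" "vertical u'" "Dom E v = Dom E u'"
  obtains e t where "opcart e" "Dom E e = Cod E u'" "arm p e = arm p v"
    "vertical t" "Dom E t = Cod E v" "Cod E t = Cod E e" "t \<cdot> v = e \<cdot> u'"
proof -
  note c = vertical_Cod[OF assms(2)]
  obtain e where e: "opcart e" "Dom E e = Cod E u'" "arm p e = arm p v"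
    by (rule opcart_exists[of "Cod E u'" "arm p v"]) (use assms c in auto)
  have ce: "obm p (Cod E e) = obm p (Cod E v)"
    using e assms by (metis p_simps(4) opcart_Arr)
  obtain t where "t \<in> Arr E" "Dom E t = Cod E v" "Cod E t = Cod E (e \<cdot> u')"
    "arm p t = Ident C (obm p (Cod E v))" "t \<cdot> v = e \<cdot> u'"
    by (rule opcart_lift[OF assms(1), of "e \<cdot> u'" "Ident C (obm p (Cod E v))"])
      (use assms e ce in \<open>auto simp flip: c\<close>)
  then show ?thesis using that e assms by auto
qed

lemma D_Ident: "x \<in> Ob E \<Longrightarrow> Ident D x = tmor (Ident E x) (Ident E x)"
  by (simp add: tmor_def transpose_def)

lemma category_D: "category D"
proof (rule categoryI)
  fix f assume "f \<in> Arr D"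
  then show "Dom D f \<in> Ob D" "Cod D f \<in> Ob D" by (auto elim!: D_Arr_cases)
next
  fix x assume "x \<in> Ob D"
  then show "Ident D x \<in> Arr D \<and> Dom D (Ident D x) = x \<and> Cod D (Ident D x) = x"
    by (auto simp: D_Ident)
next
  fix f g assume "f \<in> Arr D" "g \<in> Arr D" and fg: "Cod D f = Dom D g"
  then obtain u v u' v' where *: "legs u v" "f = tmor u v" "legs u' v'" "g = tmor u' v'"
    unfolding D_Arr_iff by blast
  then have vu: "Dom E v = Dom E u'" using fg by auto
  obtain e t where et: "opcart e" "Dom E e = Cod E u'" "arm p e = arm p v"
    "vertical t" "Dom E t = Cod E v" "Cod E t = Cod E e" "t \<cdot> v = e \<cdot> u'"
    by (rule complete_square[of v u']) (use * vu in auto)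
  have "g \<diamondop> f = tmor (t \<cdot> u) (e \<cdot> v')" "legs (t \<cdot> u) (e \<cdot> v')"
    unfolding * using compD_tmor[OF *(1,3) vu et] by auto
  moreover have "Dom E (t \<cdot> u) = Dom E u" "Dom E (e \<cdot> v') = Dom E v'" using * et by auto
  ultimately show "g \<diamondop> f \<in> Arr D \<and> Dom D (g \<diamondop> f) = Dom D f \<and> Cod D (g \<diamondop> f) = Cod D g"
    using * tmor_simps by metis
next
  fix f assume "f \<in> Arr D"
  then obtain u v where f: "legs u v" "f = tmor u v" unfolding D_Arr_iff by blast
  have "tmor (Ident E (Dom E v)) (Ident E (Dom E v)) \<diamondop> tmor u v
      = tmor (Ident E (Cod E v) \<cdot> u) (v \<cdot> Ident E (Dom E v))"
    by (rule compD_tmor) (use f in auto)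
  then show "Ident D (Cod D f) \<diamondop> f = f" using f by (auto simp: D_Ident)
  have "tmor u v \<diamondop> tmor (Ident E (Dom E u)) (Ident E (Dom E u))
      = tmor (u \<cdot> Ident E (Dom E u)) (Ident E (Cod E u) \<cdot> v)"
    by (rule compD_tmor) (use f vertical_Cod[of u] in auto)
  then show "f \<diamondop> Ident D (Dom D f) = f" using f by (auto simp: D_Ident)
next
  fix f g h assume "f \<in> Arr D" "g \<in> Arr D" "h \<in> Arr D" and "Cod D f = Dom D g" "Cod D g = Dom D h"
  then obtain u1 v1 u2 v2 u3 v3 where
    l: "legs u1 v1" "legs u2 v2" "legs u3 v3" and
    fgh: "f = tmor u1 v1" "g = tmor u2 v2" "h = tmor u3 v3"
    and c: "Dom E v1 = Dom E u2" "Dom E v2 = Dom E u3"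
    unfolding D_Arr_iff by (metis tmor_simps(2,3))
  obtain e t where et: "opcart e" "Dom E e = Cod E u2" "arm p e = arm p v1"
    "vertical t" "Dom E t = Cod E v1" "Cod E t = Cod E e" "t \<cdot> v1 = e \<cdot> u2"
    by (rule complete_square[of v1 u2]) (use l c in auto)
  obtain f1 s where fs: "opcart f1" "Dom E f1 = Cod E u3" "arm p f1 = arm p v2"
    "vertical s" "Dom E s = Cod E v2" "Cod E s = Cod E f1" "s \<cdot> v2 = f1 \<cdot> u3"
    by (rule complete_square[of v2 u3]) (use l c in auto)
  \<comment> \<open>Pushing \<open>s\<close> along \<open>e\<close> completes both bracketings of the composite at once.\<close>
  obtain f' t' where ft: "opcart f'" "Dom E f' = Cod E s" "arm p f' = arm p e"
    "vertical t'" "Dom E t' = Cod E e" "Cod E t' = Cod E f'" "t' \<cdot> e = f' \<cdot> s"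
    by (rule complete_square[of e s]) (use l et fs in auto)
  have gf: "g \<diamondop> f = tmor (t \<cdot> u1) (e \<cdot> v2)" "legs (t \<cdot> u1) (e \<cdot> v2)"
    unfolding fgh by (rule compD_tmor[OF l(1,2) c(1) et])+
  have hg: "h \<diamondop> g = tmor (s \<cdot> u2) (f1 \<cdot> v3)" "legs (s \<cdot> u2) (f1 \<cdot> v3)"
    unfolding fgh by (rule compD_tmor[OF l(2,3) c(2) fs])+
  have "h \<diamondop> (g \<diamondop> f) = tmor (t' \<cdot> t \<cdot> u1) ((f' \<cdot> f1) \<cdot> v3)"
    unfolding gf(1) fgh(3)
  proof (rule compD_tmor)
    show "opcart (f' \<cdot> f1)" by (rule opcart_comp) (use ft fs in auto)
    show "t' \<cdot> e \<cdot> v2 = (f' \<cdot> f1) \<cdot> u3"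
      using ft et fs l c by (simp add: E.assoc flip: E.assoc[of v2 e t'])
  qed (use gf l et ft fs c in auto)
  moreover have "(h \<diamondop> g) \<diamondop> f = tmor ((t' \<cdot> t) \<cdot> u1) (f' \<cdot> f1 \<cdot> v3)"
    unfolding hg(1) fgh(1)
  proof (rule compD_tmor)
    show "(t' \<cdot> t) \<cdot> v1 = f' \<cdot> s \<cdot> u2"
      using ft et fs l c by (simp add: E.assoc) (simp flip: E.assoc)
    show "vertical (t' \<cdot> t)" using ft et l vertical_Cod[of t] by auto
  qed (use hg l et ft fs c in auto)
  ultimately show "h \<diamondop> (g \<diamondop> f) = (h \<diamondop> g) \<diamondop> f"
    using ft et fs l c by (auto simp: E.assoc)
qed

sublocale D: category D by (rule category_D)

lemma D_Dom_Cod_Ob [simp]: "f \<in> Arr D \<Longrightarrow> Dom D f \<in> Ob E" "f \<in> Arr D \<Longrightarrow> Cod D f \<in> Ob E"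
  using D.Ob_simps by auto

lemma q_functor: "is_functor D (op_cat C) q"
proof (rule is_functorI)
  fix f g assume "f \<in> Arr D" "g \<in> Arr D" and fg: "Cod D f = Dom D g"
  then obtain u v u' v' where *: "legs u v" "f = tmor u v" "legs u' v'" "g = tmor u' v'"
    unfolding D_Arr_iff by blast
  then have vu: "Dom E v = Dom E u'" using fg by auto
  obtain e t where et: "opcart e" "Dom E e = Cod E u'" "arm p e = arm p v"
    "vertical t" "Dom E t = Cod E v" "Cod E t = Cod E e" "t \<cdot> v = e \<cdot> u'"
    by (rule complete_square[of v u']) (use * vu in auto)
  have "arm q (g \<diamondop> f) = arm p (e \<cdot> v')"
    unfolding * using compD_tmor[OF *(1,3) vu et] tmor_simps by metis
  then show "arm q (g \<diamondop> f) = Comp (op_cat C) (arm q g) (arm q f)"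
    using * et by (auto simp: op_cat_def)
next
  fix f assume "f \<in> Arr D"
  then obtain u v where *: "legs u v" "f = tmor u v" unfolding D_Arr_iff by blast
  then show "arm q f \<in> Arr (op_cat C) \<and> Dom (op_cat C) (arm q f) = obm q (Dom D f) \<and>
      Cod (op_cat C) (arm q f) = obm q (Cod D f)"
    using vertical_Cod[of u] by (auto simp: op_cat_def)
qed (auto simp: op_cat_def D_Ident)

lemma q_simps [simp]:
  shows "f \<in> Arr D \<Longrightarrow> arm q f \<in> Arr C"
    and "f \<in> Arr D \<Longrightarrow> Dom C (arm q f) = obm p (Cod D f)"
    and "f \<in> Arr D \<Longrightarrow> Cod C (arm q f) = obm p (Dom D f)"
    and "x \<in> Ob E \<Longrightarrow> arm q (Ident D x) = Ident C (obm p x)"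
    and "f \<in> Arr D \<Longrightarrow> g \<in> Arr D \<Longrightarrow> Cod D f = Dom D g \<Longrightarrow>
      arm q (g \<diamondop> f) = Comp C (arm q f) (arm q g)"
  using is_functorD[OF q_functor] by (auto simp: op_cat_def)

definition vert :: "'b \<Rightarrow> 'p \<times> 'p \<times> ('b \<times> 'b) set" where
  "vert u = tmor u (Ident E (Cod E u))"

definition cart :: "'b \<Rightarrow> 'p \<times> 'p \<times> ('b \<times> 'b) set" where
  "cart v = tmor (Ident E (Cod E v)) v"

lemma vert_simps [simp]:
  assumes "vertical u"
  shows "vert u \<in> Arr D" "Dom D (vert u) = Dom E u" "Cod D (vert u) = Cod E u"
    "arm q (vert u) = Ident C (obm p (Dom E u))"
  using assms vertical_Cod[OF assms] by (auto simp: vert_def)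

lemma cart_simps [simp]:
  assumes "opcart v"
  shows "cart v \<in> Arr D" "Dom D (cart v) = Cod E v" "Cod D (cart v) = Dom E v"
    "arm q (cart v) = arm p v"
  using assms by (auto simp: cart_def)

lemma vert_Ident: "x \<in> Ob E \<Longrightarrow> vert (Ident E x) = Ident D x"
  by (simp add: vert_def D_Ident)

lemma cart_Ident: "x \<in> Ob E \<Longrightarrow> cart (Ident E x) = Ident D x"
  by (simp add: cart_def D_Ident)

lemma cart_comp_tmor:
  assumes "legs u v" "opcart e" "Cod E e = Dom E v"
  shows "cart e \<diamondop> tmor u v = tmor u (v \<cdot> e)"
proof -
  have "tmor (Ident E (Cod E e)) e \<diamondop> tmor u v = tmor (Ident E (Cod E v) \<cdot> u) (v \<cdot> e)"
    by (rule compD_tmor) (use assms in auto)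
  then show ?thesis using assms by (simp add: cart_def)
qed

lemma tmor_comp_vert:
  assumes "legs u v" "vertical u'" "Cod E u' = Dom E u"
  shows "tmor u v \<diamondop> vert u' = tmor (u \<cdot> u') v"
proof -
  have "tmor u v \<diamondop> tmor u' (Ident E (Dom E u)) = tmor (u \<cdot> u') (Ident E (Cod E v) \<cdot> v)"
    by (rule compD_tmor) (use assms vertical_Cod[of u] in auto)
  then show ?thesis using assms by (simp add: vert_def)
qed

lemma cart_comp_vert:
  assumes "opcart v" "vertical u" "Cod E u = Cod E v"
  shows "cart v \<diamondop> vert u = tmor u v"
  using tmor_comp_vert[of "Ident E (Cod E v)" v u] assms by (auto simp: cart_def)

lemma cart_comp:
  assumes "opcart v" "opcart e" "Cod E e = Dom E v"
  shows "cart e \<diamondop> cart v = cart (v \<cdot> e)"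
  using cart_comp_tmor[of "Ident E (Cod E v)" v e] assms by (auto simp: cart_def)

lemma vert_comp:
  assumes "vertical u" "vertical u'" "Cod E u = Dom E u'"
  shows "vert u' \<diamondop> vert u = vert (u' \<cdot> u)"
  using tmor_comp_vert[of u' "Ident E (Cod E u')" u] assms by (auto simp: vert_def)

lemma vert_inj:
  assumes "vert u = vert u'" "vertical u" "vertical u'" shows "u = u'"
proof -
  have "Cod E u = Cod E u'" using arg_cong[OF assms(1), of "Cod D"] assms(2,3) by simp
  then have "tmor u (Ident E (Cod E u)) = tmor u' (Ident E (Cod E u))"
    using assms(1) by (simp add: vert_def)
  moreover have "legs u (Ident E (Cod E u))" "legs u' (Ident E (Cod E u))"
    using assms(2,3) \<open>Cod E u = _\<close> by simp_all
  ultimately show ?thesis by (rule tmor_eq_same_right)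
qed

text \<open>The first legs are identities, so the comparison isomorphism is an identity too.\<close>

lemma cart_inj:
  assumes "cart v = cart v'" "opcart v" "opcart v'" shows "v = v'"
proof -
  have c: "Cod E v = Cod E v'" using arg_cong[OF assms(1), of "Dom D"] assms(2,3) by simp
  have l: "legs (Ident E (Cod E v')) v'" using assms(3) by simp
  from tmor_eqE[OF assms(1)[unfolded cart_def] l]
  obtain w where w: "w \<in> Arr E" "Dom E w = Cod E v" "Cod E w = Cod E v'" "is_iso E w"
    "w \<cdot> Ident E (Cod E v) = Ident E (Cod E v')" "w \<cdot> v = v'" by metis
  then have "w = Ident E (Cod E v)" using c by auto
  then show ?thesis using w assms by auto
qed

text \<open>If \<open>v\<close> and \<open>e\<close> have the same image, completing the square turns the left composite, like the right one,
  into a cospan with opcartesian leg \<open>e\<close>, and such a cospan is determined by its other leg. Equations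
  between mixed composites of the transpose thus become commutative squares of \<open>E\<close>.\<close>

lemma interchange:
  assumes "opcart v" "opcart e" "vertical u" "vertical t" "Dom E u = Dom E v" "Cod E u = Dom E e"
    "Dom E t = Cod E v" "Cod E t = Cod E e"
  shows "vert u \<diamondop> cart v = cart e \<diamondop> vert t \<longleftrightarrow> t \<cdot> v = e \<cdot> u \<and> arm p v = arm p e"
proof
  assume *: "t \<cdot> v = e \<cdot> u \<and> arm p v = arm p e"
  have "tmor u (Ident E (Cod E u)) \<diamondop> tmor (Ident E (Cod E v)) v
      = tmor (t \<cdot> Ident E (Cod E v)) (e \<cdot> Ident E (Cod E u))"
    by (rule compD_tmor) (use assms vertical_Cod[of u] * in auto)
  then show "vert u \<diamondop> cart v = cart e \<diamondop> vert t"
    using assms cart_comp_vert[of e t] by (auto simp: vert_def cart_def)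
next
  assume *: "vert u \<diamondop> cart v = cart e \<diamondop> vert t"
  have "arm q (vert u \<diamondop> cart v) = arm p v" "arm q (cart e \<diamondop> vert t) = arm p e"
    using assms vertical_Cod[of u] vertical_Cod[of t] by auto
  then have ve: "arm p v = arm p e" using * by metis
  obtain t' where t': "t' \<in> Arr E" "Dom E t' = Cod E v" "Cod E t' = Cod E (e \<cdot> u)"
    "arm p t' = Ident C (obm p (Cod E v))" "t' \<cdot> v = e \<cdot> u"
  proof (rule opcart_lift[OF assms(1), of "e \<cdot> u" "Ident C (obm p (Cod E v))"])
    show "Cod C (Ident C (obm p (Cod E v))) = obm p (Cod E (e \<cdot> u))"
      using assms vertical_Cod[of t] by auto
    have "obm p (Dom E e) = obm p (Dom E v)" using assms vertical_Cod[of u] by auto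
    then show "arm p (e \<cdot> u) = Comp C (Ident C (obm p (Cod E v))) (arm p v)"
      using assms ve vertical_Cod[of u] by (auto simp flip: ve)
  qed (use assms in auto)
  have "tmor u (Ident E (Cod E u)) \<diamondop> tmor (Ident E (Cod E v)) v
      = tmor (t' \<cdot> Ident E (Cod E v)) (e \<cdot> Ident E (Cod E u))"
    by (rule compD_tmor) (use assms vertical_Cod[of u] t' ve in auto)
  then have "tmor t e = tmor t' e"
    using * assms t' cart_comp_vert[of e t] by (auto simp: vert_def cart_def)
  then have "t = t'" by (rule tmor_eq_same_right) (use assms t' in auto)
  then show "t \<cdot> v = e \<cdot> u \<and> arm p v = arm p e" using t' ve by simp
qed

text \<open>If the image is an identity, then the opcartesian leg is vertical, hence invertible, and can be absorbed
  into the other leg.\<close>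

lemma D_over_identity:
  assumes "f \<in> Arr D" "arm q f = Ident C (obm p (Dom D f))"
  obtains u where "vertical u" "f = vert u" "Dom E u = Dom D f" "Cod E u = Cod D f"
proof -
  obtain u v where f: "legs u v" "f = tmor u v" using assms(1) D_Arr_iff by auto
  have pv: "arm p v = Ident C (obm p (Dom E v))"
    using f assms D.Ob_simps q_simps(2)[of f] by auto
  then have "is_iso E v" using f by (intro vertical_opcart_iso) auto
  then obtain w where w: "w \<in> Arr E" "Dom E w = Cod E v" "Cod E w = Dom E v"
    "w \<cdot> v = Ident E (Dom E v)" "v \<cdot> w = Ident E (Cod E v)" by (rule E.is_isoE) (use f in auto)
  have iw: "is_iso E w" by (rule E.is_isoI[of _ v]) (use w f in auto)
  have "vertical w" using w pv f by (intro vertical_left[of v w]) auto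
  moreover have c: "obm p (Cod E v) = obm p (Dom E u)"
    using vertical_Cod[of u] f(1) by simp
  ultimately have wu: "vertical (w \<cdot> u)"
    using f(1) w(1,2) by simp
  have ends: "Dom E (w \<cdot> u) = Dom D f" "Cod E (w \<cdot> u) = Dom E v" "Cod D f = Dom E v"
    using f w(1-3) by simp_all
  have "tmor u v = tmor (w \<cdot> u) (Ident E (Dom E v))"
    by (rule tmor_eqI[of _ _ _ _ w]) (use w iw f(1) wu in simp_all)
  then have "f = vert (w \<cdot> u)" unfolding vert_def ends(2) f(2) .
  then show ?thesis
    using that[OF wu] ends by simp
qed

text \<open>The cartesian arrows of the transpose fibration; \<open>is_cart_lift\<close> and \<open>is_cart_cancel\<close> are the existence and
  uniqueness parts of their universal property.\<close>

definition is_cart :: "'p \<times> 'p \<times> ('b \<times> 'b) set \<Rightarrow> bool" where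
  "is_cart f \<longleftrightarrow> (\<exists>v. opcart v \<and> f = cart v)"

lemma is_cart_cart [simp]: "opcart v \<Longrightarrow> is_cart (cart v)"
  by (auto simp: is_cart_def)

text \<open>Only the opcartesian leg has to be factored through the opcartesian arrow that represents \<open>f\<close>; the
  factor is again opcartesian.\<close>

lemma is_cart_lift:
  assumes "is_cart f" "g \<in> Arr D" "Cod D g = Cod D f" "h \<in> Arr C" "Dom C h = obm p (Dom D f)"
    "Cod C h = obm p (Dom D g)" "arm q g = Comp C h (arm q f)"
  obtains k where "k \<in> Arr D" "Dom D k = Dom D g" "Cod D k = Dom D f" "arm q k = h" "f \<diamondop> k = g"
proof -
  obtain e where e: "opcart e" "f = cart e" using assms(1) by (auto simp: is_cart_def)
  obtain u v where g: "legs u v" "g = tmor u v" using assms(2) D_Arr_iff by auto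
  have c: "Dom E e = Dom E v" using assms e g by auto
  obtain v' where v': "v' \<in> Arr E" "Dom E v' = Cod E e" "Cod E v' = Cod E v" "arm p v' = h" "v' \<cdot> e = v"
    by (rule opcart_lift[OF e(1), of v h]) (use assms e g c vertical_Cod[of u] in auto)
  moreover have "opcart v'" by (rule opcart_cancel_right[OF e(1)]) (use v' e g in auto)
  ultimately show ?thesis
    using that[of "tmor u v'"] e g cart_comp_tmor[of u v' e] by auto
qed

lemma is_cart_cancel:
  assumes "is_cart f" "k \<in> Arr D" "k' \<in> Arr D" "Cod D k = Dom D f" "Cod D k' = Dom D f"
    "arm q k = arm q k'" "f \<diamondop> k = f \<diamondop> k'"
  shows "k = k'"
proof -
  obtain e where e: "opcart e" "f = cart e" using assms(1) by (auto simp: is_cart_def)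
  obtain u v where k: "legs u v" "k = tmor u v" using assms(2) D_Arr_iff by auto
  obtain u' v' where k': "legs u' v'" "k' = tmor u' v'" using assms(3) D_Arr_iff by auto
  have d: "Dom E v = Cod E e" "Dom E v' = Cod E e" using assms e k k' by auto
  have l: "legs u' (v' \<cdot> e)" using k' e d by (auto simp: opcart_comp)
  have "tmor u (v \<cdot> e) = tmor u' (v' \<cdot> e)"
    using assms e k k' d cart_comp_tmor[of u v e] cart_comp_tmor[of u' v' e] by auto
  from tmor_eqE[OF this l] obtain w where w: "w \<in> Arr E" "Dom E w = Cod E (v \<cdot> e)"
    "Cod E w = Cod E (v' \<cdot> e)" "is_iso E w" "w \<cdot> u = u'" "w \<cdot> v \<cdot> e = v' \<cdot> e" by metis
  have vw: "vertical w" by (rule vertical_left[of u w]) (use w k k' e d in auto)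
  have "w \<cdot> v = v'"
    by (rule opcart_cancel[OF e(1)])
      (use w vw k k' e d assms vertical_Cod[OF vw] in \<open>auto simp: E.assoc\<close>)
  then show ?thesis unfolding k k' by (intro tmor_eqI[of _ _ _ _ w]) (use k k' w e d in auto)
qed

lemma is_cart_comp:
  "is_cart f \<Longrightarrow> is_cart g \<Longrightarrow> Cod D f = Dom D g \<Longrightarrow> is_cart (g \<diamondop> f)"
  by (auto simp: is_cart_def) (metis cart_comp opcart_comp)

text \<open>Comparing representatives of \<open>g \<diamondop> f\<close> shows that the vertical leg of \<open>f\<close> is invertible, so it can be
  moved to the other leg.\<close>

lemma is_cart_right:
  assumes "is_cart g" "is_cart (g \<diamondop> f)" "f \<in> Arr D" "Cod D f = Dom D g"
  shows "is_cart f"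
proof -
  obtain e where e: "opcart e" "g = cart e" using assms(1) by (auto simp: is_cart_def)
  obtain e' where e': "opcart e'" "g \<diamondop> f = cart e'" using assms(2) by (auto simp: is_cart_def)
  obtain u v where f: "legs u v" "f = tmor u v" using assms(3) D_Arr_iff by auto
  have d: "Dom E v = Cod E e" using assms e f by auto
  have l: "legs u (v \<cdot> e)" using f e d by (auto simp: opcart_comp)
  have "tmor (Ident E (Cod E e')) e' = tmor u (v \<cdot> e)"
    using e e' f d cart_comp_tmor[of u v e] by (auto simp: cart_def)
  from tmor_eqE[OF this l] obtain w where w: "w \<in> Arr E" "Dom E w = Cod E e'" "Cod E w = Cod E (v \<cdot> e)"
    "is_iso E w" "w \<cdot> Ident E (Cod E e') = u" by metis
  then have "is_iso E u" by simp
  then obtain u' where u': "u' \<in> Arr E" "Dom E u' = Cod E u" "Cod E u' = Dom E u"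
    "u' \<cdot> u = Ident E (Dom E u)" "u \<cdot> u' = Ident E (Cod E u)" by (rule E.is_isoE)
  have iu: "is_iso E u'" by (rule E.is_isoI[of _ u]) (use u' f in auto)
  have oc: "opcart (u' \<cdot> v)" by (rule opcart_comp) (use u' iu f opcart_iso in auto)
  have "tmor u v = tmor (Ident E (Dom E u)) (u' \<cdot> v)"
    by (rule tmor_eqI[of _ _ _ _ u']) (use u' iu f oc in auto)
  then show ?thesis using f oc u' by (auto simp: is_cart_def cart_def intro!: exI[of _ "u' \<cdot> v"])
qed

lemma is_cart_iso:
  assumes "is_iso D f" and f: "arm q f = Ident C (obm p (Dom D f))" shows "is_cart f"
proof -
  obtain g where g: "f \<in> Arr D" "g \<in> Arr D" "Dom D g = Cod D f" "Cod D g = Dom D f"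
    "g \<diamondop> f = Ident D (Dom D f)" "f \<diamondop> g = Ident D (Cod D f)" using assms(1) by (rule D.is_isoE)
  obtain u where u: "vertical u" "f = vert u" "Dom E u = Dom D f" "Cod E u = Cod D f"
    using D_over_identity[OF g(1) f] by metis
  have "obm p (Cod D f) = obm p (Dom D f)"
    using vertical_Cod[OF u(1)] u(3,4) by simp
  then have "arm q (g \<diamondop> f) = arm q g" using g(1-4) f by simp
  moreover have "obm p (Cod D f) = obm p (Dom D f)"
    using vertical_Cod[OF u(1)] u(3,4) by simp
  ultimately have "arm q g = Ident C (obm p (Dom D g))"
    using g by simp
  then obtain w where w: "vertical w" "g = vert w" "Dom E w = Dom D g" "Cod E w = Cod D g"
    using D_over_identity[OF g(2)] by metis
  have uw: "Dom E w = Cod E u" "Cod E w = Dom E u" using g(3,4) u(3,4) w(3,4) by simp_all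
  have ob: "Dom E u \<in> Ob E" "Cod E u \<in> Ob E" using u(1) by simp_all
  have "vert (w \<cdot> u) = vert (Ident E (Dom E u))"
    using g(5) vert_comp[OF u(1) w(1)] uw ob by (simp add: vert_Ident flip: u(2,3) w(2))
  then have wu: "w \<cdot> u = Ident E (Dom E u)"
    by (rule vert_inj) (use u(1) w(1) uw ob vertical_Cod[OF u(1)] in simp_all)
  have "vert (u \<cdot> w) = vert (Ident E (Cod E u))"
    using g(6) vert_comp[OF w(1) u(1)] uw ob by (simp add: vert_Ident flip: u(2,4) w(2))
  then have uw': "u \<cdot> w = Ident E (Cod E u)"
    by (rule vert_inj) (use u(1) w(1) uw ob vertical_Cod[OF u(1)] in simp_all)
  have iso: "is_iso E w" by (rule E.is_isoI[of _ u]) (use u(1) w(1) uw wu uw' in simp_all)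
  then have oc: "opcart w" by (rule opcart_iso)
  have "vert u = cart w"
    unfolding vert_def cart_def
    by (rule tmor_eqI[of _ _ _ _ w]) (use u(1) w(1) uw ob wu oc iso in simp_all)
  then show ?thesis using oc u(2) by simp
qed

end


section \<open>Ordinals and simplices\<close>

abbreviation opord where "opord n \<equiv> op_cat (ord_cat n)"

lemma op_ord_simps [simp]:
  "Ob (opord n) = {0..n}" "Arr (opord n) = {(i, j). i \<le> j \<and> j \<le> n}"
  "Dom (opord n) f = snd f" "Cod (opord n) f = fst f"
  "Ident (opord n) i = (i, i)" "Comp (opord n) (i, j) (j', k) = (i, k)"
  by (simp_all add: op_cat_def ord_cat_def)

lemma ord_simps [simp]:
  "Ob (ord_cat n) = {0..n}" "Arr (ord_cat n) = {(i, j). i \<le> j \<and> j \<le> n}"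
  "Dom (ord_cat n) f = fst f" "Cod (ord_cat n) f = snd f"
  "Ident (ord_cat n) i = (i, i)" "Comp (ord_cat n) (j', k) (i, j) = (i, k)"
  by (simp_all add: ord_cat_def)

lemma category_ord_cat: "category (ord_cat n)"
  by (rule categoryI) auto

lemma fctr_eqI: "obm F = obm G \<Longrightarrow> arm F = arm G \<Longrightarrow> F = (G :: ('o, 'a, 'p, 'b) fctr)"
  by simp

lemma simplexD:
  assumes "is_simplex C (n, c)"
  shows "i \<le> n \<Longrightarrow> obm c i \<in> Ob C"
    and "i \<le> j \<Longrightarrow> j \<le> n \<Longrightarrow> arm c (i, j) \<in> Arr C"
    and "i \<le> j \<Longrightarrow> j \<le> n \<Longrightarrow> Dom C (arm c (i, j)) = obm c i"
    and "i \<le> j \<Longrightarrow> j \<le> n \<Longrightarrow> Cod C (arm c (i, j)) = obm c j"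
    and "i \<le> n \<Longrightarrow> arm c (i, i) = Ident C (obm c i)"
    and "i \<le> j \<Longrightarrow> j \<le> k \<Longrightarrow> k \<le> n \<Longrightarrow> Comp C (arm c (j, k)) (arm c (i, j)) = arm c (i, k)"
proof -
  have "is_functor (ord_cat n) C c" using assms by (simp add: is_simplex_def)
  note F = is_functorD[OF this]
  show "i \<le> n \<Longrightarrow> obm c i \<in> Ob C" using F(1)[of i] by simp
  show "i \<le> j \<Longrightarrow> j \<le> n \<Longrightarrow> arm c (i, j) \<in> Arr C" using F(2)[of "(i, j)"] by simp
  show "i \<le> j \<Longrightarrow> j \<le> n \<Longrightarrow> Dom C (arm c (i, j)) = obm c i" using F(3)[of "(i, j)"] by simp
  show "i \<le> j \<Longrightarrow> j \<le> n \<Longrightarrow> Cod C (arm c (i, j)) = obm c j" using F(4)[of "(i, j)"] by simp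
  show "i \<le> n \<Longrightarrow> arm c (i, i) = Ident C (obm c i)" using F(5)[of i] by simp
  show "i \<le> j \<Longrightarrow> j \<le> k \<Longrightarrow> k \<le> n \<Longrightarrow> Comp C (arm c (j, k)) (arm c (i, j)) = arm c (i, k)"
    using F(6)[of "(i, j)" "(j, k)"] by simp
qed

lemma simplexI:
  assumes "\<And>i. i \<le> n \<Longrightarrow> obm c i \<in> Ob C"
    and "\<And>i j. i \<le> j \<Longrightarrow> j \<le> n \<Longrightarrow> arm c (i, j) \<in> Arr C \<and> Dom C (arm c (i, j)) = obm c i \<and>
      Cod C (arm c (i, j)) = obm c j"
    and "\<And>i. i \<le> n \<Longrightarrow> arm c (i, i) = Ident C (obm c i)"
    and "\<And>i j k. i \<le> j \<Longrightarrow> j \<le> k \<Longrightarrow> k \<le> n \<Longrightarrow> Comp C (arm c (j, k)) (arm c (i, j)) = arm c (i, k)"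
    and "obm c \<in> extensional {0..n}" "arm c \<in> extensional {(i, j). i \<le> j \<and> j \<le> n}"
  shows "is_simplex C (n, c)"
proof -
  have "is_functor (ord_cat n) C c"
    by (rule is_functorI) (use assms(1-4) in auto)
  then show ?thesis using assms(5,6) by (simp add: is_simplex_def ext_functor_def)
qed

lemma simplex_eqI:
  assumes "is_simplex C (n, c)" "is_simplex C (n, c')"
    and "\<And>i. i \<le> n \<Longrightarrow> obm c i = obm c' i" "\<And>i j. i \<le> j \<Longrightarrow> j \<le> n \<Longrightarrow> arm c (i, j) = arm c' (i, j)"
  shows "c = c'"
proof (rule fctr_eqI)
  show "obm c = obm c'"
    by (rule extensionalityI[of _ "{0..n}"]) (use assms in \<open>auto simp: is_simplex_def ext_functor_def\<close>)
  show "arm c = arm c'"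
    by (rule extensionalityI[of _ "{(i, j). i \<le> j \<and> j \<le> n}"])
      (use assms in \<open>auto simp: is_simplex_def ext_functor_def\<close>)
qed

text \<open>The target of the map of the simplicial replacement that is given by \<open>a\<close> and starts at \<open>s\<close>.\<close>

definition face :: "('o, 'a) simplex \<Rightarrow> nat \<Rightarrow> (nat \<Rightarrow> nat) \<Rightarrow> ('o, 'a) simplex" where
  "face s m a = (m, restrict_functor (ord_cat m) (comp_functor (snd s) (ord_map a)))"

abbreviation ver where "ver s i \<equiv> obm (snd s) i"
abbreviation edg where "edg s i j \<equiv> arm (snd s) (i, j)"

lemma face_simps:
  "fst (face s m a) = m"
  "i \<le> m \<Longrightarrow> ver (face s m a) i = ver s (a i)"
  "i \<le> j \<Longrightarrow> j \<le> m \<Longrightarrow> edg (face s m a) i j = edg s (a i) (a j)"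
  by (simp_all add: face_def restrict_functor_def comp_functor_def ord_map_def)

abbreviation ord_mono :: "nat \<Rightarrow> nat \<Rightarrow> (nat \<Rightarrow> nat) \<Rightarrow> bool" where
  "ord_mono m n a \<equiv> a \<in> {0..m} \<rightarrow>\<^sub>E {0..n} \<and> mono_on {0..m} a"

lemma ord_monoD:
  assumes "ord_mono m n a"
  shows "i \<le> m \<Longrightarrow> a i \<le> n" "i \<le> j \<Longrightarrow> j \<le> m \<Longrightarrow> a i \<le> a j"
  using assms by (auto simp: mono_on_def PiE_def Pi_def)

lemma simplex_face:
  assumes "is_simplex C (n, c)" "ord_mono m n a"
  shows "is_simplex C (face (n, c) m a)"
proof -
  have "is_simplex C (m, snd (face (n, c) m a))"
    by (rule simplexI)
      (use simplexD[OF assms(1)] ord_monoD[OF assms(2)] in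
        \<open>simp_all add: face_simps\<close>, simp_all add: face_def restrict_functor_def)
  then show ?thesis by (simp add: face_def)
qed

lemma simp_repl_Arr_iff:
  "(s, t, a) \<in> Arr (simp_repl C) \<longleftrightarrow>
    is_simplex C s \<and> ord_mono (fst t) (fst s) a \<and> t = face s (fst t) a"
  by (cases s; cases t)
    (use simplex_face in \<open>force simp: simp_repl_def face_def\<close>)

lemma simp_repl_Arr_cases:
  assumes "\<alpha> \<in> Arr (simp_repl C)"
  obtains n c m a where "\<alpha> = ((n, c), face (n, c) m a, a)" "is_simplex C (n, c)" "ord_mono m n a"
proof -
  obtain s t a where \<alpha>: "\<alpha> = (s, t, a)" by (cases \<alpha>) auto
  then have *: "is_simplex C s" "ord_mono (fst t) (fst s) a" "t = face s (fst t) a"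
    using assms simp_repl_Arr_iff[of s t a C] by auto
  show ?thesis by (rule that[of "fst s" "snd s" "fst t" a]) (use * \<alpha> in auto)
qed

lemma simp_repl_simps [simp]:
  "Ob (simp_repl C) = {s. is_simplex C s}"
  "Dom (simp_repl C) (s, t, a) = s" "Cod (simp_repl C) (s, t, a) = t"
  "Ident (simp_repl C) s = (s, s, \<lambda>i \<in> {0..fst s}. i)"
  "Comp (simp_repl C) (t', u, b) (s, t, a) = (s, u, \<lambda>i \<in> {0..fst u}. a (b i))"
  by (auto simp: simp_repl_def split_beta)

lemma face_id: "is_simplex C s \<Longrightarrow> face s (fst s) (\<lambda>i \<in> {0..fst s}. i) = s"
proof -
  assume s: "is_simplex C s"
  have "is_simplex C (face s (fst s) (\<lambda>i \<in> {0..fst s}. i))"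
    using simplex_face[of C "fst s" "snd s" "\<lambda>i \<in> {0..fst s}. i" "fst s"] s
    by (auto simp: mono_on_def)
  then have "is_simplex C (fst s, snd (face s (fst s) (\<lambda>i \<in> {0..fst s}. i)))"
    by (simp add: face_def)
  then have "snd (face s (fst s) (\<lambda>i \<in> {0..fst s}. i)) = snd s"
    by (rule simplex_eqI) (use s in \<open>auto simp: face_simps\<close>)
  then show ?thesis by (simp add: face_def prod_eq_iff)
qed

lemma ord_mono_id [simp]: "ord_mono n n (\<lambda>i \<in> {0..n}. i)"
  by (auto simp: mono_on_def)

lemma ord_mono_comp:
  assumes "ord_mono m n a" "ord_mono k m b" shows "ord_mono k n (\<lambda>i \<in> {0..k}. a (b i))"
  using ord_monoD[OF assms(1)] ord_monoD[OF assms(2)] by (auto simp: mono_on_def)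

lemma face_comp:
  assumes "ord_mono k m b"
  shows "face (face s m a) k b = face s k (\<lambda>i \<in> {0..k}. a (b i))"
proof -
  have "snd (face (face s m a) k b) = snd (face s k (\<lambda>i \<in> {0..k}. a (b i)))"
    using ord_monoD[OF assms]
    by (auto simp: face_def restrict_functor_def comp_functor_def ord_map_def fun_eq_iff)
  then show ?thesis by (simp add: prod_eq_iff face_simps)
qed

lemma category_simp_repl: "category (simp_repl C)"
proof (rule categoryI)
  fix f assume "f \<in> Arr (simp_repl C)"
  then obtain n c m a where f: "f = ((n, c), face (n, c) m a, a)" "is_simplex C (n, c)" "ord_mono m n a"
    by (rule simp_repl_Arr_cases)
  then show "Dom (simp_repl C) f \<in> Ob (simp_repl C)" "Cod (simp_repl C) f \<in> Ob (simp_repl C)"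
    using simplex_face[OF f(2,3)] by simp_all
  have "fst (face (n, c) m a) = m" by (simp add: face_simps)
  moreover have "(\<lambda>i\<in>{0..m}. a (restrict (\<lambda>i. i) {0..m} i)) = a"
    "(\<lambda>i\<in>{0..m}. restrict (\<lambda>i. i) {0..n} (a i)) = a"
    using f(3) ord_monoD[OF f(3)] by (auto simp: fun_eq_iff PiE_def extensional_def)
  ultimately show "Comp (simp_repl C) (Ident (simp_repl C) (Cod (simp_repl C) f)) f = f"
    "Comp (simp_repl C) f (Ident (simp_repl C) (Dom (simp_repl C) f)) = f"
    unfolding f(1) by (simp_all add: face_simps)
next
  fix s assume "s \<in> Ob (simp_repl C)"
  then show "Ident (simp_repl C) s \<in> Arr (simp_repl C) \<and>
    Dom (simp_repl C) (Ident (simp_repl C) s) = s \<and> Cod (simp_repl C) (Ident (simp_repl C) s) = s"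
    using face_id[of C s] ord_mono_id[of "fst s"] by (simp add: simp_repl_Arr_iff)
next
  fix f g assume f: "f \<in> Arr (simp_repl C)" and g: "g \<in> Arr (simp_repl C)"
    and "Cod (simp_repl C) f = Dom (simp_repl C) g"
  then obtain s t u a b where fg: "f = (s, t, a)" "g = (t, u, b)" by (cases f; cases g) auto
  then have *: "is_simplex C s" "ord_mono (fst t) (fst s) a" "t = face s (fst t) a"
    "ord_mono (fst u) (fst t) b" "u = face t (fst u) b"
    using f g simp_repl_Arr_iff by blast+
  have "u = face (face s (fst t) a) (fst u) b" using *(3,5) by metis
  also have "\<dots> = face s (fst u) (\<lambda>i \<in> {0..fst u}. a (b i))" by (rule face_comp[OF *(4)])
  finally have "(s, u, \<lambda>i \<in> {0..fst u}. a (b i)) \<in> Arr (simp_repl C)"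
    unfolding simp_repl_Arr_iff using *(1) ord_mono_comp[OF *(2,4)] by blast
  then show "Comp (simp_repl C) g f \<in> Arr (simp_repl C) \<and>
    Dom (simp_repl C) (Comp (simp_repl C) g f) = Dom (simp_repl C) f \<and>
    Cod (simp_repl C) (Comp (simp_repl C) g f) = Cod (simp_repl C) g"
    by (simp add: fg)
next
  fix f g h assume a: "f \<in> Arr (simp_repl C)" "g \<in> Arr (simp_repl C)" "h \<in> Arr (simp_repl C)"
    "Cod (simp_repl C) f = Dom (simp_repl C) g" "Cod (simp_repl C) g = Dom (simp_repl C) h"
  then obtain s t u v a b d where fg: "f = (s, t, a)" "g = (t, u, b)" "h = (u, v, d)"
    by (cases f; cases g; cases h) auto
  then have "ord_mono (fst v) (fst u) d" using a simp_repl_Arr_iff by blast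
  then show "Comp (simp_repl C) h (Comp (simp_repl C) g f) = Comp (simp_repl C) (Comp (simp_repl C) h g) f"
    using ord_monoD(1)[OF \<open>ord_mono (fst v) (fst u) d\<close>] by (auto simp: fg fun_eq_iff)
qed

section \<open>The fibres of the simplicial extension\<close>

abbreviation sob where "sob S i \<equiv> snd (obm S i)"
abbreviation sar where "sar S i j \<equiv> snd (arm S (i, j))"

definition mk_lift :: "nat \<Rightarrow> (nat \<Rightarrow> 'p) \<Rightarrow> (nat \<Rightarrow> nat \<Rightarrow> 'p \<times> 'p \<times> ('b \<times> 'b) set) \<Rightarrow>
    ('p, 'b) lifted_simplex" where
  "mk_lift n x \<xi> = \<lparr>obm = (\<lambda>i \<in> {0..n}. (i, x i)),
    arm = (\<lambda>f \<in> {(i, j). i \<le> j \<and> j \<le> n}. (f, \<xi> (fst f) (snd f)))\<rparr>"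

definition mk_nat :: "nat \<Rightarrow> (nat \<Rightarrow> 'd) \<Rightarrow> nat \<Rightarrow> (nat \<times> nat) \<times> 'd" where
  "mk_nat n s = (\<lambda>i \<in> {0..n}. ((i, i), s i))"

lemma mk_lift_simps [simp]:
  "i \<le> n \<Longrightarrow> obm (mk_lift n x \<xi>) i = (i, x i)"
  "i \<le> j \<Longrightarrow> j \<le> n \<Longrightarrow> arm (mk_lift n x \<xi>) (i, j) = ((i, j), \<xi> i j)"
  by (simp_all add: mk_lift_def)

lemma mk_nat_simps [simp]: "i \<le> n \<Longrightarrow> mk_nat n s i = ((i, i), s i)"
  by (simp add: mk_nat_def)

lemma mk_lift_cong:
  assumes "\<And>i. i \<le> n \<Longrightarrow> x i = y i" "\<And>i j. i \<le> j \<Longrightarrow> j \<le> n \<Longrightarrow> \<xi> i j = \<zeta> i j"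
  shows "mk_lift n x \<xi> = mk_lift n y \<zeta>"
  using assms by (auto simp: mk_lift_def fun_eq_iff)

lemma mk_nat_cong:
  assumes "\<And>i. i \<le> n \<Longrightarrow> s i = s' i" shows "mk_nat n s = mk_nat n s'"
  using assms by (auto simp: mk_nat_def fun_eq_iff)

lemma restrict_section_eq:
  "restrict_section m a S = mk_lift m (\<lambda>i. sob S (a i)) (\<lambda>i j. sar S (a i) (a j))"
  by (auto simp: restrict_section_def mk_lift_def fun_eq_iff ord_map_def)

context opfib begin

abbreviation CC where "CC \<equiv> simp_repl C"
abbreviation Pull where "Pull n c \<equiv> pullback (opord n) (transpose E C p) c (transpose_proj p)"

text \<open>The data of a section over the simplex \<open>(n, c)\<close>. The ordinal is reversed, so \<open>\<xi> i j\<close> goes from \<open>x j\<close> to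
  \<open>x i\<close>.\<close>

definition lifted :: "nat \<Rightarrow> (nat, nat \<times> nat, 'o, 'a) fctr \<Rightarrow> (nat \<Rightarrow> 'p) \<Rightarrow>
    (nat \<Rightarrow> nat \<Rightarrow> 'p \<times> 'p \<times> ('b \<times> 'b) set) \<Rightarrow> bool" where
  "lifted n c x \<xi> \<longleftrightarrow>
    (\<forall>i\<le>n. x i \<in> Ob E \<and> obm p (x i) = obm c i \<and> \<xi> i i = Ident D (x i)) \<and>
    (\<forall>j\<le>n. \<forall>i\<le>j. \<xi> i j \<in> Arr D \<and> Dom D (\<xi> i j) = x j \<and> Cod D (\<xi> i j) = x i \<and>
      arm q (\<xi> i j) = arm c (i, j)) \<and>
    (\<forall>k\<le>n. \<forall>j\<le>k. \<forall>i\<le>j. \<xi> i j \<diamondop> \<xi> j k = \<xi> i k)"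

lemma liftedD:
  assumes "lifted n c x \<xi>"
  shows "i \<le> n \<Longrightarrow> x i \<in> Ob E" "i \<le> n \<Longrightarrow> obm p (x i) = obm c i" "i \<le> n \<Longrightarrow> \<xi> i i = Ident D (x i)"
    and "i \<le> j \<Longrightarrow> j \<le> n \<Longrightarrow> \<xi> i j \<in> Arr D" "i \<le> j \<Longrightarrow> j \<le> n \<Longrightarrow> Dom D (\<xi> i j) = x j"
    and "i \<le> j \<Longrightarrow> j \<le> n \<Longrightarrow> Cod D (\<xi> i j) = x i" "i \<le> j \<Longrightarrow> j \<le> n \<Longrightarrow> arm q (\<xi> i j) = arm c (i, j)"
    and "i \<le> j \<Longrightarrow> j \<le> k \<Longrightarrow> k \<le> n \<Longrightarrow> \<xi> i j \<diamondop> \<xi> j k = \<xi> i k"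
  using assms unfolding lifted_def by auto

abbreviation Fib where "Fib \<equiv> ext_fibre E C p"

text \<open>The first coordinates of a section of a pullback are forced, so a section amounts to its second
  coordinates.\<close>

lemma Fib_Ob_iff:
  "S \<in> Ob (Fib (n, c)) \<longleftrightarrow> S = mk_lift n (sob S) (sar S) \<and> lifted n c (sob S) (sar S)"
proof
  assume "S \<in> Ob (Fib (n, c))"
  then have S: "is_functor (opord n) (Pull n c) S"
    "ext_functor (opord n) S"
    "\<And>i. i \<le> n \<Longrightarrow> fst (obm S i) = i" "\<And>i j. i \<le> j \<Longrightarrow> j \<le> n \<Longrightarrow> fst (arm S (i, j)) = (i, j)"
    by (auto simp: ext_fibre_def Sect_def is_section_def pullback_proj_def)
  note F = is_functorD[OF S(1)]
  have ob: "obm S i = (i, sob S i)" if "i \<le> n" for i using S(3)[OF that] by (simp add: prod_eq_iff)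
  have ar: "arm S (i, j) = ((i, j), sar S i j)" if "i \<le> j" "j \<le> n" for i j
    using S(4)[OF that] by (simp add: prod_eq_iff)
  have "S = mk_lift n (sob S) (sar S)"
    using S(2) ob ar
    by (intro fctr_eqI) (auto simp: mk_lift_def ext_functor_def fun_eq_iff extensional_def)
  moreover have "lifted n c (sob S) (sar S)"
    unfolding lifted_def
  proof (intro conjI allI impI)
    fix i assume i: "i \<le> n"
    show "sob S i \<in> Ob E" "obm p (sob S i) = obm c i" "sar S i i = Ident D (sob S i)"
      using F(1)[of i] F(5)[of i] i ob[of i] by (auto simp: pullback_def)
  next
    fix i j assume ij: "j \<le> n" "i \<le> j"
    show "sar S i j \<in> Arr D" "arm q (sar S i j) = arm c (i, j)"
      using F(2)[of "(i, j)"] ij ar[of i j] by (auto simp: pullback_def)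
    show "Dom D (sar S i j) = sob S j"
      using arg_cong[OF F(3)[of "(i, j)"], of snd] ij ar[of i j]
      by (simp add: pullback_def split_beta)
    show "Cod D (sar S i j) = sob S i"
      using arg_cong[OF F(4)[of "(i, j)"], of snd] ij ar[of i j]
      by (simp add: pullback_def split_beta)
  next
    fix i j k assume ijk: "k \<le> n" "j \<le> k" "i \<le> j"
    show "sar S i j \<diamondop> sar S j k = sar S i k"
      using arg_cong[OF F(6)[of "(j, k)" "(i, j)"], of snd] ijk
      by (simp add: pullback_def split_beta)
  qed
  ultimately show "S = mk_lift n (sob S) (sar S) \<and> lifted n c (sob S) (sar S)" by blast
next
  assume *: "S = mk_lift n (sob S) (sar S) \<and> lifted n c (sob S) (sar S)"
  then have eq: "S = mk_lift n (sob S) (sar S)" and l: "lifted n c (sob S) (sar S)" by blast+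
  have ob: "fst (obm S i) = i" if "i \<le> n" for i
    by (subst eq) (simp add: that)
  have ar: "fst (arm S (i, j)) = (i, j)" if "i \<le> j" "j \<le> n" for i j
    by (subst eq) (simp add: that)
  note L = liftedD[OF l]
  have "is_functor (opord n) (Pull n c) S"
  proof (rule is_functorI)
    fix i assume "i \<in> Ob (opord n)"
    then have i: "i \<le> n" by simp
    show "obm S i \<in> Ob (Pull n c)"
      "arm S (Ident (opord n) i) = Ident (Pull n c) (obm S i)"
      using i L(1-3)[of i] ob[of i] ar[of i i] by (simp_all add: pullback_def split_beta prod_eq_iff)
  next
    fix f assume "f \<in> Arr (opord n)"
    then obtain i j where f: "f = (i, j)" "i \<le> j" "j \<le> n" by auto
    show "arm S f \<in> Arr (Pull n c) \<and>
       Dom (Pull n c) (arm S f) = obm S (Dom (opord n) f) \<and>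
       Cod (Pull n c) (arm S f) = obm S (Cod (opord n) f)"
      unfolding f(1) using f(2,3) L(4-7)[of i j] ob[of i] ob[of j]
      by (simp add: pullback_def split_beta prod_eq_iff[of "(_, _)" "obm _ _"] prod_eq_iff[of _ "obm _ _"] ar)
  next
    fix f g assume "f \<in> Arr (opord n)" "g \<in> Arr (opord n)"
      "Cod (opord n) f = Dom (opord n) g"
    then obtain i j k where f: "f = (j, k)" "g = (i, j)" "i \<le> j" "j \<le> k" "k \<le> n" by auto
    show "arm S (Comp (opord n) g f) =
        Comp (Pull n c) (arm S g) (arm S f)"
      unfolding f(1,2) using f(3-5) L(8)[of i j k]
      by (intro prod_eqI) (simp_all add: pullback_def split_beta ar)
  qed
  moreover have "ext_functor (opord n) S"
    by (subst eq) (simp add: ext_functor_def mk_lift_def)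
  ultimately show "S \<in> Ob (Fib (n, c))"
    using ob ar by (auto simp: ext_fibre_def Sect_def is_section_def pullback_proj_def)
qed

lemma Fib_ObD:
  assumes "S \<in> Ob (Fib (n, c))"
  shows "S = mk_lift n (sob S) (sar S)" "lifted n c (sob S) (sar S)"
    "i \<le> n \<Longrightarrow> fst (obm S i) = i" "i \<le> j \<Longrightarrow> j \<le> n \<Longrightarrow> fst (arm S (i, j)) = (i, j)"
proof -
  show eq: "S = mk_lift n (sob S) (sar S)" and "lifted n c (sob S) (sar S)"
    using assms Fib_Ob_iff by blast+
  show "i \<le> n \<Longrightarrow> fst (obm S i) = i" "i \<le> j \<Longrightarrow> j \<le> n \<Longrightarrow> fst (arm S (i, j)) = (i, j)"
    by (subst eq, simp)+
qed

lemma lifted_cong: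
  assumes "lifted n c x \<xi>" "\<And>i. i \<le> n \<Longrightarrow> x i = y i" "\<And>i j. i \<le> j \<Longrightarrow> j \<le> n \<Longrightarrow> \<xi> i j = \<zeta> i j"
  shows "lifted n c y \<zeta>"
proof -
  note L = liftedD[OF assms(1)]
  show ?thesis unfolding lifted_def
    using L by (simp flip: assms(2,3))
qed

lemma mk_lift_in_Fib:
  assumes "lifted n c x \<xi>" shows "mk_lift n x \<xi> \<in> Ob (Fib (n, c))"
proof -
  let ?S = "mk_lift n x \<xi>"
  have "mk_lift n x \<xi> = mk_lift n (sob ?S) (sar ?S)" by (rule mk_lift_cong) simp_all
  moreover have "lifted n c (sob ?S) (sar ?S)" by (rule lifted_cong[OF assms]) simp_all
  ultimately show ?thesis unfolding Fib_Ob_iff by blast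
qed

definition lifted_map :: "nat \<Rightarrow> (nat, nat \<times> nat, 'o, 'a) fctr \<Rightarrow>
    (nat \<Rightarrow> 'p) \<Rightarrow> (nat \<Rightarrow> nat \<Rightarrow> 'p \<times> 'p \<times> ('b \<times> 'b) set) \<Rightarrow>
    (nat \<Rightarrow> 'p) \<Rightarrow> (nat \<Rightarrow> nat \<Rightarrow> 'p \<times> 'p \<times> ('b \<times> 'b) set) \<Rightarrow>
    (nat \<Rightarrow> 'p \<times> 'p \<times> ('b \<times> 'b) set) \<Rightarrow> bool" where
  "lifted_map n c x \<xi> y \<zeta> s \<longleftrightarrow>
    (\<forall>i\<le>n. s i \<in> Arr D \<and> Dom D (s i) = x i \<and> Cod D (s i) = y i \<and> arm q (s i) = Ident C (obm c i)) \<and>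
    (\<forall>j\<le>n. \<forall>i\<le>j. s i \<diamondop> \<xi> i j = \<zeta> i j \<diamondop> s j)"

lemma lifted_mapD:
  assumes "lifted_map n c x \<xi> y \<zeta> s"
  shows "i \<le> n \<Longrightarrow> s i \<in> Arr D" "i \<le> n \<Longrightarrow> Dom D (s i) = x i" "i \<le> n \<Longrightarrow> Cod D (s i) = y i"
    "i \<le> n \<Longrightarrow> arm q (s i) = Ident C (obm c i)" "i \<le> j \<Longrightarrow> j \<le> n \<Longrightarrow> s i \<diamondop> \<xi> i j = \<zeta> i j \<diamondop> s j"
  using assms unfolding lifted_map_def by auto

lemma Fib_simps [simp]:
  "Dom (Fib s) (S, T, \<tau>) = S" "Cod (Fib s) (S, T, \<tau>) = T"
  by (cases s; simp add: ext_fibre_def Sect_def)+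

lemma Fib_Arr_iff:
  assumes "is_simplex C (n, c)"
  shows "(S, T, \<tau>) \<in> Arr (Fib (n, c)) \<longleftrightarrow> S \<in> Ob (Fib (n, c)) \<and> T \<in> Ob (Fib (n, c)) \<and>
    \<tau> = mk_nat n (\<lambda>i. snd (\<tau> i)) \<and>
    lifted_map n c (sob S) (sar S) (sob T) (sar T) (\<lambda>i. snd (\<tau> i))"
proof -
  have *: "(S, T, \<tau>) \<in> Arr (Fib (n, c)) \<longleftrightarrow> S \<in> Ob (Fib (n, c)) \<and> T \<in> Ob (Fib (n, c)) \<and>
    nat_trans (opord n) (Pull n c) S T \<tau> \<and>
    \<tau> \<in> extensional {0..n} \<and> (\<forall>i\<le>n. fst (\<tau> i) = (i, i))"
    by (auto simp: ext_fibre_def Sect_def pullback_proj_def)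
  have "nat_trans (opord n) (Pull n c) S T \<tau> \<and>
    \<tau> \<in> extensional {0..n} \<and> (\<forall>i\<le>n. fst (\<tau> i) = (i, i)) \<longleftrightarrow>
    \<tau> = mk_nat n (\<lambda>i. snd (\<tau> i)) \<and> lifted_map n c (sob S) (sar S) (sob T) (sar T) (\<lambda>i. snd (\<tau> i))"
    if ST: "S \<in> Ob (Fib (n, c))" "T \<in> Ob (Fib (n, c))"
  proof -
    have norm: "\<tau> = mk_nat n (\<lambda>i. snd (\<tau> i)) \<longleftrightarrow> \<tau> \<in> extensional {0..n} \<and> (\<forall>i\<le>n. fst (\<tau> i) = (i, i))"
      unfolding mk_nat_def fun_eq_iff extensional_def restrict_def
      by (auto simp: prod_eq_iff)
    have "nat_trans (opord n) (Pull n c) S T \<tau> \<longleftrightarrow>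
      lifted_map n c (sob S) (sar S) (sob T) (sar T) (\<lambda>i. snd (\<tau> i))"
      if t: "\<forall>i\<le>n. fst (\<tau> i) = (i, i)"
    proof -
      have "\<tau> i \<in> hom (Pull n c) (obm S i) (obm T i) \<longleftrightarrow>
        snd (\<tau> i) \<in> Arr D \<and> Dom D (snd (\<tau> i)) = sob S i \<and> Cod D (snd (\<tau> i)) = sob T i \<and>
        arm q (snd (\<tau> i)) = Ident C (obm c i)" if "i \<le> n" for i
      proof -
        have 1: "(i, y) = obm S i \<longleftrightarrow> y = sob S i" "(i, y) = obm T i \<longleftrightarrow> y = sob T i" for y
          using Fib_ObD(3)[OF ST(1) that] Fib_ObD(3)[OF ST(2) that] by (auto simp: prod_eq_iff)
        have 2: "fst (\<tau> i) = (i, i)" "arm c (i, i) = Ident C (obm c i)"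
          using t that simplexD(5)[OF assms that] by auto
        have "\<tau> i \<in> hom (Pull n c) (obm S i) (obm T i) \<longleftrightarrow>
          (snd (\<tau> i) \<in> Arr D \<and> Ident C (obm c i) = arm q (snd (\<tau> i))) \<and>
          (i, Dom D (snd (\<tau> i))) = obm S i \<and> (i, Cod D (snd (\<tau> i))) = obm T i"
          using that by (simp add: pullback_def hom_def split_beta 2 del: prod.collapse)
        also have "\<dots> \<longleftrightarrow> (snd (\<tau> i) \<in> Arr D \<and> Ident C (obm c i) = arm q (snd (\<tau> i))) \<and>
          Dom D (snd (\<tau> i)) = sob S i \<and> Cod D (snd (\<tau> i)) = sob T i"
          unfolding 1 ..
        finally show ?thesis by (auto simp: eq_commute[of "Ident C (obm c i)"])
      qed
      moreover have "Comp (Pull n c) (\<tau> i) (arm S (i, j)) =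
          Comp (Pull n c) (arm T (i, j)) (\<tau> j) \<longleftrightarrow>
          snd (\<tau> i) \<diamondop> sar S i j = sar T i j \<diamondop> snd (\<tau> j)" if "i \<le> j" "j \<le> n" for i j
        using t that Fib_ObD(4)[OF ST(1) that] Fib_ObD(4)[OF ST(2) that]
        by (simp add: pullback_def split_beta)
      ultimately show ?thesis
        unfolding nat_trans_def lifted_map_def by auto
    qed
    then show ?thesis using norm by blast
  qed
  then show ?thesis using * by blast
qed

lemma mk_nat_in_Fib:
  assumes "is_simplex C (n, c)" "S \<in> Ob (Fib (n, c))" "T \<in> Ob (Fib (n, c))"
    "lifted_map n c (sob S) (sar S) (sob T) (sar T) s"
  shows "(S, T, mk_nat n s) \<in> Arr (Fib (n, c))"
proof -
  have "mk_nat n s = mk_nat n (\<lambda>i. snd (mk_nat n s i))" by (rule mk_nat_cong) simp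
  moreover have "lifted_map n c (sob S) (sar S) (sob T) (sar T) (\<lambda>i. snd (mk_nat n s i))"
    using assms(4) by (auto simp: lifted_map_def)
  ultimately show ?thesis using Fib_Arr_iff[OF assms(1)] assms(2,3) by blast
qed

lemma Fib_ArrD:
  assumes "is_simplex C (n, c)" "(S, T, \<tau>) \<in> Arr (Fib (n, c))"
  shows "S \<in> Ob (Fib (n, c))" "T \<in> Ob (Fib (n, c))" "\<tau> = mk_nat n (\<lambda>i. snd (\<tau> i))"
    "lifted_map n c (sob S) (sar S) (sob T) (sar T) (\<lambda>i. snd (\<tau> i))"
    "i \<le> n \<Longrightarrow> fst (\<tau> i) = (i, i)"
proof -
  show "S \<in> Ob (Fib (n, c))" "T \<in> Ob (Fib (n, c))" and \<tau>: "\<tau> = mk_nat n (\<lambda>i. snd (\<tau> i))" and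
    "lifted_map n c (sob S) (sar S) (sob T) (sar T) (\<lambda>i. snd (\<tau> i))"
    using assms(2) unfolding Fib_Arr_iff[OF assms(1)] by blast+
  show "i \<le> n \<Longrightarrow> fst (\<tau> i) = (i, i)" by (subst \<tau>) simp
qed

lemma Fib_Ident:
  assumes "S \<in> Ob (Fib (n, c))"
  shows "Ident (Fib (n, c)) S = (S, S, mk_nat n (\<lambda>i. Ident D (sob S i)))"
  using Fib_ObD(3)[OF assms]
  by (auto simp: ext_fibre_def Sect_def mk_nat_def fun_eq_iff pullback_def split_beta)

lemma Fib_Comp:
  assumes "is_simplex C (n, c)" "(S, T, \<tau>) \<in> Arr (Fib (n, c))" "(T', U, \<upsilon>) \<in> Arr (Fib (n, c))"
  shows "Comp (Fib (n, c)) (T', U, \<upsilon>) (S, T, \<tau>) = (S, U, mk_nat n (\<lambda>i. snd (\<upsilon> i) \<diamondop> snd (\<tau> i)))"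
  using Fib_ArrD(5)[OF assms(1,2)] Fib_ArrD(5)[OF assms(1,3)]
  by (auto simp: ext_fibre_def Sect_def mk_nat_def fun_eq_iff pullback_def split_beta)

lemma category_Fib:
  assumes "is_simplex C s" shows "category (Fib s)"
proof -
  obtain n c where s: "s = (n, c)" by (cases s)
  have "is_functor (opord n) (op_cat C) c"
    by (rule is_functorI) (use simplexD[OF assms[unfolded s]] in \<open>auto simp: op_cat_def ord_cat_def\<close>)
  then have "category (Pull n c)"
    using category_op_cat[OF category_ord_cat] category_op_cat[OF C] category_D q_functor
    by (intro category_pullback) auto
  then show ?thesis unfolding s ext_fibre_def prod.case
    by (rule category_Sect[OF category_op_cat[OF category_ord_cat] _ is_functor_pullback_proj])
qed

lemma Fib_iso:
  assumes "is_simplex C (n, c)" "is_iso (Fib (n, c)) (S, T, \<tau>)" "i \<le> n"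
  shows "is_iso D (snd (\<tau> i))"
proof -
  have "is_iso (Pull n c) (\<tau> i)"
    using assms(2) unfolding ext_fibre_def prod.case by (rule is_isoE_Sect) (use assms in auto)
  then show ?thesis
    by (cases "\<tau> i") (auto simp: is_iso_def hom_def pullback_def)
qed

lemma lifted_face:
  assumes "lifted n c x \<xi>" "ord_mono m n a"
  shows "lifted m (snd (face (n, c) m a)) (\<lambda>i. x (a i)) (\<lambda>i j. \<xi> (a i) (a j))"
  unfolding lifted_def
  using liftedD[OF assms(1)] ord_monoD[OF assms(2)] by (simp add: face_simps)

lemma restrict_in_Fib:
  assumes "S \<in> Ob (Fib (n, c))" "ord_mono m n a"
  shows "restrict_section m a S \<in> Ob (Fib (face (n, c) m a))"
proof -
  have "face (n, c) m a = (m, snd (face (n, c) m a))" by (simp add: face_def)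
  then show ?thesis
    using mk_lift_in_Fib[OF lifted_face[OF Fib_ObD(2)[OF assms(1)] assms(2)]]
    by (simp add: restrict_section_eq)
qed

lemma ext_trans_simps [simp]:
  "obm (ext_trans (s, t, a)) S = restrict_section (fst t) a S"
  "arm (ext_trans (s, t, a)) (S, T, \<tau>) = (restrict_section (fst t) a S, restrict_section (fst t) a T,
    mk_nat (fst t) (\<lambda>i. snd (\<tau> (a i))))"
  by (cases s; cases t; simp add: ext_trans_def mk_nat_def)+

lemma restrict_section_sob [simp]:
  "i \<le> m \<Longrightarrow> obm (restrict_section m a S) i = (i, sob S (a i))"
  "i \<le> j \<Longrightarrow> j \<le> m \<Longrightarrow> arm (restrict_section m a S) (i, j) = ((i, j), sar S (a i) (a j))"
  by (simp_all add: restrict_section_eq)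

lemma ext_trans_functor:
  assumes "\<alpha> \<in> Arr CC"
  shows "is_functor (Fib (Dom CC \<alpha>)) (Fib (Cod CC \<alpha>)) (ext_trans \<alpha>)"
proof -
  obtain n c m a where \<alpha>: "\<alpha> = ((n, c), face (n, c) m a, a)" and s: "is_simplex C (n, c)"
    and a: "ord_mono m n a" using assms by (rule simp_repl_Arr_cases)
  define c' where "c' = snd (face (n, c) m a)"
  have f: "face (n, c) m a = (m, c')" by (simp add: face_def c'_def)
  have s': "is_simplex C (m, c')" using simplex_face[OF s a] f by simp
  have ob: "S \<in> Ob (Fib (n, c)) \<Longrightarrow> restrict_section m a S \<in> Ob (Fib (m, c'))" for S
    using restrict_in_Fib[OF _ a, of S c] f by simp
  note A = ord_monoD[OF a]
  interpret N: category "Fib (n, c)" by (rule category_Fib[OF s])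
  have ar: "(restrict_section m a S, restrict_section m a T, mk_nat m (\<lambda>i. snd (\<tau> (a i)))) \<in> Arr (Fib (m, c'))"
    if st: "(S, T, \<tau>) \<in> Arr (Fib (n, c))" for S T \<tau>
  proof (rule mk_nat_in_Fib[OF s'])
    note L = lifted_mapD[OF Fib_ArrD(4)[OF s st]]
    show "lifted_map m c' (sob (restrict_section m a S)) (sar (restrict_section m a S))
      (sob (restrict_section m a T)) (sar (restrict_section m a T)) (\<lambda>i. snd (\<tau> (a i)))"
      unfolding lifted_map_def using L A by (auto simp: c'_def face_simps)
  qed (use ob Fib_ArrD(1,2)[OF s st] in auto)
  have "is_functor (Fib (n, c)) (Fib (m, c')) (ext_trans ((n, c), (m, c'), a))"
  proof (rule is_functorI)
    fix f assume f: "f \<in> Arr (Fib (n, c))"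
    obtain S T \<tau> where "f = (S, T, \<tau>)" by (cases f)
    then show "arm (ext_trans ((n, c), (m, c'), a)) f \<in> Arr (Fib (m, c')) \<and>
      Dom (Fib (m, c')) (arm (ext_trans ((n, c), (m, c'), a)) f) =
        obm (ext_trans ((n, c), (m, c'), a)) (Dom (Fib (n, c)) f) \<and>
      Cod (Fib (m, c')) (arm (ext_trans ((n, c), (m, c'), a)) f) =
        obm (ext_trans ((n, c), (m, c'), a)) (Cod (Fib (n, c)) f)"
      using f ar by simp
  next
    fix S assume S: "S \<in> Ob (Fib (n, c))"
    show "arm (ext_trans ((n, c), (m, c'), a)) (Ident (Fib (n, c)) S) =
      Ident (Fib (m, c')) (obm (ext_trans ((n, c), (m, c'), a)) S)"
      using S ob A by (auto simp: Fib_Ident intro!: mk_nat_cong)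
  next
    fix f g assume f: "f \<in> Arr (Fib (n, c))" and g: "g \<in> Arr (Fib (n, c))"
      and fg: "Cod (Fib (n, c)) f = Dom (Fib (n, c)) g"
    obtain S T \<tau> T' U \<upsilon> where e: "f = (S, T, \<tau>)" "g = (T', U, \<upsilon>)" by (cases f; cases g)
    show "arm (ext_trans ((n, c), (m, c'), a)) (Comp (Fib (n, c)) g f) =
      Comp (Fib (m, c')) (arm (ext_trans ((n, c), (m, c'), a)) g) (arm (ext_trans ((n, c), (m, c'), a)) f)"
      using f g unfolding e
      by (auto simp: Fib_Comp[OF s] Fib_Comp[OF s'] ar A intro!: mk_nat_cong)
  qed (use ob in simp)
  then show ?thesis unfolding \<alpha> f by simp
qed

lemma restrict_section_id:
  assumes "S \<in> Ob (Fib s)" shows "restrict_section (fst s) (\<lambda>i \<in> {0..fst s}. i) S = S"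
proof -
  obtain n c where s: "s = (n, c)" by (cases s)
  have "restrict_section n (\<lambda>i \<in> {0..n}. i) S = mk_lift n (sob S) (sar S)"
    unfolding restrict_section_eq by (rule mk_lift_cong) auto
  then show ?thesis using Fib_ObD(1)[OF assms[unfolded s]] s by simp
qed

lemma restrict_section_comp:
  assumes "ord_mono k m b"
  shows "restrict_section k (\<lambda>i \<in> {0..k}. a (b i)) S = restrict_section k b (restrict_section m a S)"
  unfolding restrict_section_eq[of k]
  by (rule mk_lift_cong) (use ord_monoD[OF assms] in auto)

lemma category_simp_ext: "category (simp_ext E C p)"
  unfolding simp_ext_def
proof (rule category_grothendieck)
  fix s f assume s: "s \<in> Ob CC" and f: "f \<in> Arr (Fib s)"
  obtain n c where nc: "s = (n, c)" by (cases s)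
  obtain S T \<tau> where e: "f = (S, T, \<tau>)" by (cases f)
  have s': "is_simplex C (n, c)" using s nc by simp
  note F = Fib_ArrD[OF s' f[unfolded e nc]]
  have "mk_nat n (\<lambda>i. snd (\<tau> ((\<lambda>i \<in> {0..n}. i) i))) = mk_nat n (\<lambda>i. snd (\<tau> i))"
    by (rule mk_nat_cong) simp
  also have "\<dots> = \<tau>" using F(3) by simp
  finally show "arm (ext_trans (Ident CC s)) f = f"
    using restrict_section_id[OF F(1)] restrict_section_id[OF F(2)] by (simp add: e nc)
next
  fix \<alpha> \<beta> assume ab: "\<alpha> \<in> Arr CC" "\<beta> \<in> Arr CC"
    "Cod CC \<alpha> = Dom CC \<beta>"
  obtain s t a where \<alpha>: "\<alpha> = (s, t, a)" by (cases \<alpha>)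
  with ab obtain u b where \<beta>: "\<beta> = (t, u, b)" by (cases \<beta>) auto
  have b: "ord_mono (fst u) (fst t) b" using ab(2) simp_repl_Arr_iff unfolding \<beta> by blast
  show "obm (ext_trans (Comp CC \<beta> \<alpha>)) S = obm (ext_trans \<beta>) (obm (ext_trans \<alpha>) S)" for S
    using restrict_section_comp[OF b] by (simp add: \<alpha> \<beta>)
  have "mk_nat (fst u) (\<lambda>i. snd (\<tau> ((\<lambda>i \<in> {0..fst u}. a (b i)) i))) =
      mk_nat (fst u) (\<lambda>i. snd (mk_nat (fst t) (\<lambda>i. snd (\<tau> (a i))) (b i)))"
    for \<tau>
    by (rule mk_nat_cong) (use ord_monoD[OF b] in auto)
  note mk_nat_eq = this
  show "arm (ext_trans (Comp CC \<beta> \<alpha>)) f = arm (ext_trans \<beta>) (arm (ext_trans \<alpha>) f)" for f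
  proof -
    obtain S T \<tau> where f: "f = (S, T, \<tau>)" by (cases f)
    show ?thesis
      using restrict_section_comp[OF b, of a S] restrict_section_comp[OF b, of a T] mk_nat_eq[of \<tau>]
      by (simp add: f \<alpha> \<beta> del: restrict_apply)
  qed
qed (use category_simp_repl category_Fib ext_trans_functor restrict_section_id in auto)

end


section \<open>Right adjoints along Segal maps\<close>

context opfib begin

text \<open>The arrows \<open>x i \<rightarrow> y (min i m)\<close> that compare a section over \<open>(n, c)\<close> with one over its initial segment
  up to \<open>m\<close> are natural in \<open>i\<close>.\<close>

lemma lifted_map_min:
  assumes x: "lifted n c x \<xi>" and y: "lifted m c y \<zeta>" and mn: "m \<le> n"
    and s: "lifted_map m c x \<xi> y \<zeta> s" and ij: "i \<le> j" "j \<le> n"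
  shows "(s (min i m) \<diamondop> \<xi> (min i m) i) \<diamondop> \<xi> i j = \<zeta> (min i m) (min j m) \<diamondop> (s (min j m) \<diamondop> \<xi> (min j m) j)"
proof -
  note X = liftedD[OF x] and Y = liftedD[OF y] and S = lifted_mapD[OF s]
  let ?i = "min i m" and ?j = "min j m"
  have o: "?i \<le> ?j" "?j \<le> m" "?i \<le> i" "?j \<le> j" "?i \<le> m" "?i \<le> n" "?j \<le> n" "i \<le> n" using ij mn by auto
  have "(s ?i \<diamondop> \<xi> ?i i) \<diamondop> \<xi> i j = s ?i \<diamondop> \<xi> ?i j"
    using o ij X S by (simp add: D.assoc)
  also have "\<dots> = s ?i \<diamondop> (\<xi> ?i ?j \<diamondop> \<xi> ?j j)"
    using o ij X by simp
  also have "\<dots> = (s ?i \<diamondop> \<xi> ?i ?j) \<diamondop> \<xi> ?j j"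
    using o ij X S(1-4) by (simp add: D.assoc)
  also have "\<dots> = (\<zeta> ?i ?j \<diamondop> s ?j) \<diamondop> \<xi> ?j j"
    using o S(5)[of ?i ?j] by simp
  also have "\<dots> = \<zeta> ?i ?j \<diamondop> (s ?j \<diamondop> \<xi> ?j j)"
    using o ij X Y S(1-4) by (simp add: D.assoc)
  finally show ?thesis .
qed

text \<open>Lift the comparison arrows \<open>x' i \<rightarrow> y (min i m)\<close> through the cartesian comparison arrows of \<open>x\<close>; equations
  may be tested after composition with a cartesian arrow. This is the universal property that the value at
  \<open>y\<close> of the right adjoint of restriction to an initial segment should have.\<close>

lemma segal_lift:
  assumes c: "is_simplex C (n, c)" and mn: "m \<le> n"
    and x: "lifted n c x \<xi>" and y: "lifted m c y \<zeta>" and s: "lifted_map m c x \<xi> y \<zeta> s"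
    and cart: "\<And>i. i \<le> n \<Longrightarrow> is_cart (s (min i m) \<diamondop> \<xi> (min i m) i)"
    and x': "lifted n c x' \<xi>'" and s': "lifted_map m c x' \<xi>' y \<zeta> s'"
  shows "\<exists>h. lifted_map n c x' \<xi>' x \<xi> h \<and> (\<forall>i\<le>m. s i \<diamondop> h i = s' i)"
    and "lifted_map n c x' \<xi>' x \<xi> h \<Longrightarrow> lifted_map n c x' \<xi>' x \<xi> h' \<Longrightarrow>
      (\<And>i. i \<le> m \<Longrightarrow> s i \<diamondop> h i = s i \<diamondop> h' i) \<Longrightarrow> i \<le> n \<Longrightarrow> h i = h' i"
proof -
  note cD = simplexD[OF c] and X = liftedD[OF x] and Y = liftedD[OF y] and S = lifted_mapD[OF s]
    and X' = liftedD[OF x'] and S' = lifted_mapD[OF s']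
  define r where "r i = s (min i m) \<diamondop> \<xi> (min i m) i" for i
  define r' where "r' i = s' (min i m) \<diamondop> \<xi>' (min i m) i" for i
  have r: "r i \<in> Arr D" "Dom D (r i) = x i" "Cod D (r i) = y (min i m)" "arm q (r i) = arm c (min i m, i)"
    "is_cart (r i)" if "i \<le> n" for i
    using that cart X S cD mn by (simp_all add: r_def)
  have r': "r' i \<in> Arr D" "Dom D (r' i) = x' i" "Cod D (r' i) = y (min i m)"
    "arm q (r' i) = arm c (min i m, i)" if "i \<le> n" for i
    using that X' S' cD mn by (simp_all add: r'_def)
  have r_nat: "r i \<diamondop> \<xi> i j = \<zeta> (min i m) (min j m) \<diamondop> r j"
    "r' i \<diamondop> \<xi>' i j = \<zeta> (min i m) (min j m) \<diamondop> r' j" if "i \<le> j" "j \<le> n" for i j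
    using lifted_map_min[OF x y mn s that] lifted_map_min[OF x' y mn s' that] by (simp_all add: r_def r'_def)
  have "\<exists>h. h \<in> Arr D \<and> Dom D h = x' i \<and> Cod D h = x i \<and> arm q h = Ident C (obm c i) \<and> r i \<diamondop> h = r' i"
    if i: "i \<le> n" for i
  proof -
    obtain k where "k \<in> Arr D" "Dom D k = Dom D (r' i)" "Cod D k = Dom D (r i)"
      "arm q k = Ident C (obm c i)" "r i \<diamondop> k = r' i"
      by (rule is_cart_lift[of "r i" "r' i" "Ident C (obm c i)"]) (use i r r' cD X X' mn in simp_all)
    then show ?thesis using r r' i by (intro exI[of _ k]) simp
  qed
  then obtain g where h: "\<And>i. i \<le> n \<Longrightarrow> g i \<in> Arr D" "\<And>i. i \<le> n \<Longrightarrow> Dom D (g i) = x' i"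
    "\<And>i. i \<le> n \<Longrightarrow> Cod D (g i) = x i" "\<And>i. i \<le> n \<Longrightarrow> arm q (g i) = Ident C (obm c i)"
    "\<And>i. i \<le> n \<Longrightarrow> r i \<diamondop> g i = r' i" by metis
  have "g i \<diamondop> \<xi>' i j = \<xi> i j \<diamondop> g j" if ij: "i \<le> j" "j \<le> n" for i j
  proof (rule is_cart_cancel[of "r i"])
    have i: "i \<le> n" "min i m \<le> min j m" using ij by auto
    have "r i \<diamondop> (g i \<diamondop> \<xi>' i j) = r' i \<diamondop> \<xi>' i j"
      using ij i r X' h by (simp flip: D.assoc)
    also have "\<dots> = \<zeta> (min i m) (min j m) \<diamondop> (r j \<diamondop> g j)"
      using r_nat(2)[OF ij] h(5)[OF ij(2)] by simp
    also have "\<dots> = (\<zeta> (min i m) (min j m) \<diamondop> r j) \<diamondop> g j"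
      using ij i r h(1-4) Y by (simp add: D.assoc)
    also have "\<dots> = (r i \<diamondop> \<xi> i j) \<diamondop> g j" using r_nat(1)[OF ij] by simp
    also have "\<dots> = r i \<diamondop> (\<xi> i j \<diamondop> g j)" using ij i r X h by (simp add: D.assoc)
    finally show "r i \<diamondop> (g i \<diamondop> \<xi>' i j) = r i \<diamondop> (\<xi> i j \<diamondop> g j)" .
  qed (use ij r X X' h cD in simp_all)
  then have "lifted_map n c x' \<xi>' x \<xi> g"
    unfolding lifted_map_def using h by simp
  moreover have "s i \<diamondop> g i = s' i" if "i \<le> m" for i
    using h(5)[of i] that mn X X' S S' by (simp add: r_def r'_def)
  ultimately show "\<exists>h. lifted_map n c x' \<xi>' x \<xi> h \<and> (\<forall>i\<le>m. s i \<diamondop> h i = s' i)" by blast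
  assume h: "lifted_map n c x' \<xi>' x \<xi> h" and h': "lifted_map n c x' \<xi>' x \<xi> h'"
    and eq: "\<And>i. i \<le> m \<Longrightarrow> s i \<diamondop> h i = s i \<diamondop> h' i" and i: "i \<le> n"
  note H = lifted_mapD[OF h] and H' = lifted_mapD[OF h']
  have o: "min i m \<le> i" "min i m \<le> n" "min i m \<le> m" using i by auto
  have *: "r i \<diamondop> k i = (s (min i m) \<diamondop> k (min i m)) \<diamondop> \<xi>' (min i m) i"
    if "lifted_map n c x' \<xi>' x \<xi> k" for k
  proof -
    note K = lifted_mapD[OF that]
    have "r i \<diamondop> k i = s (min i m) \<diamondop> (\<xi> (min i m) i \<diamondop> k i)"
      unfolding r_def using o i X S K(1-4) by (simp add: D.assoc)
    also have "\<dots> = s (min i m) \<diamondop> (k (min i m) \<diamondop> \<xi>' (min i m) i)"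
      using K(5)[of "min i m" i] i by simp
    also have "\<dots> = (s (min i m) \<diamondop> k (min i m)) \<diamondop> \<xi>' (min i m) i"
      using o i X' S K(1-4) by (simp add: D.assoc)
    finally show ?thesis .
  qed
  show "h i = h' i"
    by (rule is_cart_cancel[of "r i"]) (use i r H H' *[OF h] *[OF h'] eq[of "min i m"] in simp_all)
qed

text \<open>Prolong \<open>y\<close> beyond \<open>m\<close> by cartesian arrows to \<open>y m\<close>. The structure arrows, and the equations between
  them, come from the universal property of these cartesian arrows.\<close>

lemma segal_extension:
  assumes c: "is_simplex C (n, c)" and mn: "m \<le> n" and y: "lifted m c y \<zeta>"
  obtains x \<xi> s where "lifted n c x \<xi>" "lifted_map m c x \<xi> y \<zeta> s"
    "\<And>i. i \<le> n \<Longrightarrow> is_cart (s (min i m) \<diamondop> \<xi> (min i m) i)"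
proof -
  note cD = simplexD[OF c] and Y = liftedD[OF y]
  \<comment> \<open>Up to \<open>m\<close> the prolongation must not change \<open>y\<close>, whence the identities.\<close>
  have "\<exists>w. opcart w \<and> Dom E w = y (min i m) \<and> arm p w = arm c (min i m, i) \<and>
      (i \<le> m \<longrightarrow> w = Ident E (y i))" if i: "i \<le> n" for i
  proof (cases "i \<le> m")
    case True
    then show ?thesis using i Y cD by (intro exI[of _ "Ident E (y i)"]) simp
  next
    case False
    have "y (min i m) \<in> Ob E" "arm c (min i m, i) \<in> Arr C" "Dom C (arm c (min i m, i)) = obm p (y (min i m))"
      using i mn Y cD by simp_all
    then show ?thesis using opcart_exists False by metis
  qed
  then have "\<exists>w. \<forall>i\<in>{..n}. opcart (w i) \<and> Dom E (w i) = y (min i m) \<and>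
      arm p (w i) = arm c (min i m, i) \<and> (i \<le> m \<longrightarrow> w i = Ident E (y i))"
    by (intro bchoice) auto
  then obtain w where "\<forall>i\<in>{..n}. opcart (w i) \<and> Dom E (w i) = y (min i m) \<and>
      arm p (w i) = arm c (min i m, i) \<and> (i \<le> m \<longrightarrow> w i = Ident E (y i))" ..
  then have w: "\<And>i. i \<le> n \<Longrightarrow> opcart (w i)" "\<And>i. i \<le> n \<Longrightarrow> Dom E (w i) = y (min i m)"
    "\<And>i. i \<le> n \<Longrightarrow> arm p (w i) = arm c (min i m, i)" "\<And>i. i \<le> m \<Longrightarrow> w i = Ident E (y i)"
    using mn by auto
  define x where "x i = Cod E (w i)" for i
  define r where "r i = cart (w i)" for i
  have r: "r i \<in> Arr D" "Dom D (r i) = x i" "Cod D (r i) = y (min i m)" "arm q (r i) = arm c (min i m, i)"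
    "is_cart (r i)" if "i \<le> n" for i
    using that w by (simp_all add: r_def x_def)
  have x: "x i \<in> Ob E" "obm p (x i) = obm c i" if "i \<le> n" for i
  proof -
    show "x i \<in> Ob E" using w(1) that by (simp add: x_def)
    have "Cod C (arm p (w i)) = obm p (x i)" using w(1) that by (simp add: x_def)
    then show "obm p (x i) = obm c i" using w(3) that cD by simp
  qed
  have r_id: "r i = Ident D (y i)" "x i = y i" if "i \<le> m" for i
    using w(4)[OF that] Y(1)[OF that] by (simp_all add: r_def x_def cart_Ident)
  have ex: "\<exists>k. k \<in> Arr D \<and> Dom D k = x j \<and> Cod D k = x i \<and> arm q k = arm c (i, j) \<and>
      r i \<diamondop> k = \<zeta> (min i m) (min j m) \<diamondop> r j" if ij: "i \<le> j" "j \<le> n" for i j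
  proof -
    have o: "min i m \<le> min j m" "min j m \<le> m" "min j m \<le> j" "i \<le> n" "min i m \<le> i" using ij by auto
    obtain k where "k \<in> Arr D" "Dom D k = Dom D (\<zeta> (min i m) (min j m) \<diamondop> r j)" "Cod D k = Dom D (r i)"
      "arm q k = arm c (i, j)" "r i \<diamondop> k = \<zeta> (min i m) (min j m) \<diamondop> r j"
      by (rule is_cart_lift[of "r i" "\<zeta> (min i m) (min j m) \<diamondop> r j" "arm c (i, j)"])
        (use ij o r x Y cD in simp_all)
    then show ?thesis using r Y o ij by (intro exI[of _ k]) simp
  qed
  define \<xi> where "\<xi> i j = (SOME k. k \<in> Arr D \<and> Dom D k = x j \<and> Cod D k = x i \<and>
    arm q k = arm c (i, j) \<and> r i \<diamondop> k = \<zeta> (min i m) (min j m) \<diamondop> r j)" for i j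
  have \<xi>: "\<xi> i j \<in> Arr D" "Dom D (\<xi> i j) = x j" "Cod D (\<xi> i j) = x i" "arm q (\<xi> i j) = arm c (i, j)"
    "r i \<diamondop> \<xi> i j = \<zeta> (min i m) (min j m) \<diamondop> r j" if "i \<le> j" "j \<le> n" for i j
    using someI_ex[OF ex[OF that]] unfolding \<xi>_def by blast+
  have id: "\<xi> i i = Ident D (x i)" if i: "i \<le> n" for i
    by (rule is_cart_cancel[of "r i"]) (use i r x \<xi> cD Y in simp_all)
  have comp: "\<xi> i j \<diamondop> \<xi> j k = \<xi> i k" if ijk: "i \<le> j" "j \<le> k" "k \<le> n" for i j k
  proof (rule is_cart_cancel[of "r i"])
    have o: "i \<le> n" "j \<le> n" "i \<le> k" "min i m \<le> min j m" "min j m \<le> min k m" "min j m \<le> m" "min k m \<le> m"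
      using ijk by auto
    have "r i \<diamondop> (\<xi> i j \<diamondop> \<xi> j k) = (r i \<diamondop> \<xi> i j) \<diamondop> \<xi> j k"
      using ijk o r \<xi>(1-4) by (simp add: D.assoc)
    also have "\<dots> = (\<zeta> (min i m) (min j m) \<diamondop> r j) \<diamondop> \<xi> j k"
      using \<xi>(5)[of i j] ijk o by simp
    also have "\<dots> = \<zeta> (min i m) (min j m) \<diamondop> (\<zeta> (min j m) (min k m) \<diamondop> r k)"
      using ijk o r \<xi>(1-4) \<xi>(5)[of j k] Y by (simp add: D.assoc)
    also have "\<dots> = (\<zeta> (min i m) (min j m) \<diamondop> \<zeta> (min j m) (min k m)) \<diamondop> r k"
      using ijk o r Y(1-7) by (simp add: D.assoc)
    also have "\<dots> = r i \<diamondop> \<xi> i k"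
      using ijk o Y(8)[of "min i m" "min j m" "min k m"] \<xi>(5)[of i k] by simp
    finally show "r i \<diamondop> (\<xi> i j \<diamondop> \<xi> j k) = r i \<diamondop> \<xi> i k" .
  qed (use ijk r \<xi> cD in simp_all)
  have xl: "lifted n c x \<xi>"
    unfolding lifted_def using x \<xi> id comp by simp
  have "lifted_map m c x \<xi> y \<zeta> (\<lambda>i. Ident D (y i))"
    unfolding lifted_map_def
  proof (intro conjI allI impI)
    fix i j assume "j \<le> m" "i \<le> j"
    then have ij: "i \<le> m" "i \<le> j" "j \<le> m" "j \<le> n" using mn by auto
    have "r i \<diamondop> \<xi> i j = \<zeta> i j \<diamondop> r j" using \<xi>(5)[of i j] ij by simp
    then show "Ident D (y i) \<diamondop> \<xi> i j = \<zeta> i j \<diamondop> Ident D (y j)" using r_id ij by simp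
  qed (use Y r_id in simp_all)
  moreover have "is_cart (Ident D (y (min i m)) \<diamondop> \<xi> (min i m) i)" if i: "i \<le> n" for i
  proof -
    have "r (min i m) \<diamondop> \<xi> (min i m) i = \<zeta> (min i m) (min i m) \<diamondop> r i"
      using \<xi>(5)[of "min i m" i] i by simp
    also have "\<dots> = r i" using r[OF i] Y(1-3)[of "min i m"] by simp
    finally show ?thesis using r_id(1)[of "min i m"] r(5)[OF i] by simp
  qed
  ultimately show ?thesis using that xl by blast
qed

lemma lifted_base_cong:
  assumes "\<And>i. i \<le> m \<Longrightarrow> obm c i = obm c' i" "\<And>i j. i \<le> j \<Longrightarrow> j \<le> m \<Longrightarrow> arm c (i, j) = arm c' (i, j)"
  shows "lifted m c x \<xi> = lifted m c' x \<xi>"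
  unfolding lifted_def using assms by auto

lemma lifted_map_cong:
  assumes "\<And>i. i \<le> m \<Longrightarrow> obm c i = obm c' i" "\<And>i. i \<le> m \<Longrightarrow> x i = x' i" "\<And>i. i \<le> m \<Longrightarrow> y i = y' i"
    "\<And>i. i \<le> m \<Longrightarrow> s i = s' i" "\<And>i j. i \<le> j \<Longrightarrow> j \<le> m \<Longrightarrow> \<xi> i j = \<xi>' i j"
    "\<And>i j. i \<le> j \<Longrightarrow> j \<le> m \<Longrightarrow> \<zeta> i j = \<zeta>' i j"
  shows "lifted_map m c x \<xi> y \<zeta> s = lifted_map m c' x' \<xi>' y' \<zeta>' s'"
proof -
  have 1: "(\<forall>j\<le>m. \<forall>i\<le>j. s i \<diamondop> \<xi> i j = \<zeta> i j \<diamondop> s j) \<longleftrightarrow> (\<forall>j\<le>m. \<forall>i\<le>j. s' i \<diamondop> \<xi>' i j = \<zeta>' i j \<diamondop> s' j)"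
  proof -
    have "s i \<diamondop> \<xi> i j = s' i \<diamondop> \<xi>' i j" "\<zeta> i j \<diamondop> s j = \<zeta>' i j \<diamondop> s' j" if "j \<le> m" "i \<le> j" for i j
    proof -
      have i: "i \<le> m" using that by simp
      show "s i \<diamondop> \<xi> i j = s' i \<diamondop> \<xi>' i j" "\<zeta> i j \<diamondop> s j = \<zeta>' i j \<diamondop> s' j"
        using assms(4)[of i] assms(4)[of j] assms(5)[of i j] assms(6)[of i j] that i by simp_all
    qed
    then show ?thesis by auto
  qed
  show ?thesis unfolding lifted_map_def 1 using assms(1-4) by auto
qed

text \<open>This is \<open>segal_lift\<close>, stated for the restriction functor between the fibres.\<close>

lemma segal_couniversal:
  assumes c: "is_simplex C (n, c)" and a: "ord_mono m n a" and mn: "m \<le> n"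
    and seg: "\<And>i. i \<le> m \<Longrightarrow> a i = i" and f: "face (n, c) m a = (m, c')"
    and S: "S \<in> Ob (Fib (n, c))" and \<phi>: "(restrict_section m a S, T, \<tau>) \<in> Arr (Fib (m, c'))"
    and cart: "\<And>i. i \<le> n \<Longrightarrow> is_cart (snd (\<tau> (min i m)) \<diamondop> sar S (min i m) i)"
  shows "couniversal (Fib (n, c)) (Fib (m, c')) (ext_trans ((n, c), (m, c'), a)) T S
    (restrict_section m a S, T, \<tau>)"
proof -
  have c': "is_simplex C (m, c')" using simplex_face[OF c a] f by simp
  have cc: "obm c' i = obm c i" if "i \<le> m" for i
    using face_simps(2)[of i m "(n, c)" a] that f seg by simp
  have cc': "arm c' (i, j) = arm c (i, j)" if "i \<le> j" "j \<le> m" for i j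
    using face_simps(3)[of i j m "(n, c)" a] that f seg by simp
  have lc: "lifted m c' x \<xi> = lifted m c x \<xi>" for x \<xi>
    by (rule lifted_base_cong) (use cc cc' in auto)
  have map_eq: "lifted_map m c' (sob (restrict_section m a S')) (sar (restrict_section m a S')) y \<zeta> s =
    lifted_map m c (sob S') (sar S') y \<zeta> s" for S' y \<zeta> s
    by (rule lifted_map_cong) (use cc seg in auto)
  note T = Fib_ArrD[OF c' \<phi>]
  have t: "lifted m c (sob T) (sar T)" using Fib_ObD(2)[OF T(2)] lc by simp
  have s: "lifted_map m c (sob S) (sar S) (sob T) (sar T) (\<lambda>i. snd (\<tau> i))" using T(4) map_eq by simp
  note L = segal_lift[OF c mn Fib_ObD(2)[OF S] t s cart]
  have "\<exists>!h. h \<in> hom (Fib (n, c)) S' S \<and>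
      Comp (Fib (m, c')) (restrict_section m a S, T, \<tau>) (arm (ext_trans ((n, c), (m, c'), a)) h) = g"
    if S': "S' \<in> Ob (Fib (n, c))" and g: "g \<in> hom (Fib (m, c')) (restrict_section m a S') T" for S' g
  proof -
    obtain \<upsilon> where gu: "g = (restrict_section m a S', T, \<upsilon>)" using g by (cases g) (auto simp: in_hom_iff)
    have ga: "(restrict_section m a S', T, \<upsilon>) \<in> Arr (Fib (m, c'))" using g gu by (simp add: in_hom_iff)
    note U = Fib_ArrD[OF c' ga]
    have s': "lifted_map m c (sob S') (sar S') (sob T) (sar T) (\<lambda>i. snd (\<upsilon> i))" using U(4) map_eq by simp
    have arm_h: "arm (ext_trans ((n, c), (m, c'), a)) (S', S, \<sigma>) \<in> Arr (Fib (m, c'))"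
      if "(S', S, \<sigma>) \<in> Arr (Fib (n, c))" for \<sigma>
    proof -
      have "((n, c), (m, c'), a) \<in> Arr CC" using c a f by (simp add: simp_repl_Arr_iff)
      from is_functorD(2)[OF ext_trans_functor[OF this], of "(S', S, \<sigma>)"] that show ?thesis by simp
    qed
    have comp_h: "Comp (Fib (m, c')) (restrict_section m a S, T, \<tau>)
        (arm (ext_trans ((n, c), (m, c'), a)) (S', S, \<sigma>)) =
        (restrict_section m a S', T, mk_nat m (\<lambda>i. snd (\<tau> i) \<diamondop> snd (\<sigma> i)))"
      if \<sigma>: "(S', S, \<sigma>) \<in> Arr (Fib (n, c))" for \<sigma>
      using Fib_Comp[OF c' _ \<phi>] arm_h[OF \<sigma>] seg by (auto intro!: mk_nat_cong)
    obtain h where h: "lifted_map n c (sob S') (sar S') (sob S) (sar S) h"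
      "\<And>i. i \<le> m \<Longrightarrow> snd (\<tau> i) \<diamondop> h i = snd (\<upsilon> i)"
      using L(1)[OF _ Fib_ObD(2)[OF S'] s'] by auto
    have ha: "(S', S, mk_nat n h) \<in> Arr (Fib (n, c))" by (rule mk_nat_in_Fib[OF c S' S h(1)])
    show ?thesis
    proof (rule ex1I)
      have "mk_nat m (\<lambda>i. snd (\<tau> i) \<diamondop> snd (mk_nat n h i)) = mk_nat m (\<lambda>i. snd (\<upsilon> i))"
        by (rule mk_nat_cong) (use h(2) mn in simp)
      also have "\<dots> = \<upsilon>" using U(3) by simp
      finally show "(S', S, mk_nat n h) \<in> hom (Fib (n, c)) S' S \<and>
          Comp (Fib (m, c')) (restrict_section m a S, T, \<tau>)
            (arm (ext_trans ((n, c), (m, c'), a)) (S', S, mk_nat n h)) = g"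
        using ha comp_h[OF ha] gu by (simp add: in_hom_iff)
    next
      fix k assume k: "k \<in> hom (Fib (n, c)) S' S \<and>
        Comp (Fib (m, c')) (restrict_section m a S, T, \<tau>) (arm (ext_trans ((n, c), (m, c'), a)) k) = g"
      then obtain \<kappa> where kk: "k = (S', S, \<kappa>)" by (cases k) (auto simp: in_hom_iff)
      have ka: "(S', S, \<kappa>) \<in> Arr (Fib (n, c))" using k kk by (simp add: in_hom_iff)
      note K = Fib_ArrD[OF c ka]
      have "mk_nat m (\<lambda>i. snd (\<tau> i) \<diamondop> snd (\<kappa> i)) = \<upsilon>" using k comp_h[OF ka] gu kk by simp
      then have "snd (\<tau> i) \<diamondop> snd (\<kappa> i) = snd (\<upsilon> i)" if "i \<le> m" for i
        using that by (auto dest: arg_cong[where f = "\<lambda>f. snd (f i)"])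
      then have "snd (\<kappa> i) = h i" if "i \<le> n" for i
        using L(2)[OF _ Fib_ObD(2)[OF S'] s' K(4) h(1), of i] that h(2) by simp
      then have "mk_nat n (\<lambda>i. snd (\<kappa> i)) = mk_nat n h" by (rule mk_nat_cong)
      then show "k = (S', S, mk_nat n h)" using K(3) kk by simp
    qed
  qed
  then show ?thesis
    unfolding couniversal_def using S \<phi> by (auto simp: in_hom_iff)
qed

text \<open>By \<open>segal_extension\<close> couniversal arrows exist, so \<open>\<alpha>\<^sub>!\<close> has a right adjoint and the cartesian condition says
  that the structure map of \<open>X\<close> at \<open>\<alpha>\<close> is couniversal. It then differs by an isomorphism of sections from the
  couniversal arrow of \<open>segal_extension\<close>, whose comparison arrows are cartesian, and vertical
  isomorphisms are cartesian.\<close>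

lemma cartesian_at_iff:
  assumes c: "is_simplex C (n, c)" and a: "ord_mono m n a" and mn: "m \<le> n"
    and seg: "\<And>i. i \<le> m \<Longrightarrow> a i = i" and f: "face (n, c) m a = (m, c')"
    and S: "S \<in> Ob (Fib (n, c))" and \<phi>: "(restrict_section m a S, T, \<tau>) \<in> Arr (Fib (m, c'))"
    and X: "snd (obm X (n, c)) = S"
      "snd (snd (snd (arm X ((n, c), (m, c'), a)))) = (restrict_section m a S, T, \<tau>)"
  shows "cartesian_at E C p X ((n, c), (m, c'), a) \<longleftrightarrow>
    (\<forall>i\<le>n. is_cart (snd (\<tau> (min i m)) \<diamondop> sar S (min i m) i))"
proof -
  let ?\<alpha> = "((n, c), (m, c'), a)"
  have c': "is_simplex C (m, c')" using simplex_face[OF c a] f by simp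
  have cc: "obm c' i = obm c i" if "i \<le> m" for i
    using face_simps(2)[of i m "(n, c)" a] that f seg by simp
  have cc': "arm c' (i, j) = arm c (i, j)" if "i \<le> j" "j \<le> m" for i j
    using face_simps(3)[of i j m "(n, c)" a] that f seg by simp
  have lc: "lifted m c' x \<xi> = lifted m c x \<xi>" for x \<xi>
    by (rule lifted_base_cong) (use cc cc' in auto)
  have "?\<alpha> \<in> Arr CC" using c a f by (simp add: simp_repl_Arr_iff)
  note L = ext_trans_functor[OF this, simplified]
  note cats = category_Fib[OF c] category_Fib[OF c']
  have ex: "\<exists>S0 \<tau>0. S0 \<in> Ob (Fib (n, c)) \<and> (restrict_section m a S0, T0, \<tau>0) \<in> Arr (Fib (m, c')) \<and>
      (\<forall>i\<le>n. is_cart (snd (\<tau>0 (min i m)) \<diamondop> sar S0 (min i m) i))" if T0: "T0 \<in> Ob (Fib (m, c'))" for T0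
  proof -
    have "lifted m c (sob T0) (sar T0)" using Fib_ObD(2)[OF T0] lc by simp
    then obtain x \<xi> s where e: "lifted n c x \<xi>" "lifted_map m c x \<xi> (sob T0) (sar T0) s"
      "\<And>i. i \<le> n \<Longrightarrow> is_cart (s (min i m) \<diamondop> \<xi> (min i m) i)" by (rule segal_extension[OF c mn]) blast
    let ?S = "mk_lift n x \<xi>"
    have S0: "?S \<in> Ob (Fib (n, c))" by (rule mk_lift_in_Fib[OF e(1)])
    have r: "restrict_section m a ?S \<in> Ob (Fib (m, c'))" using restrict_in_Fib[OF S0 a] f by simp
    have "lifted_map m c' (sob (restrict_section m a ?S)) (sar (restrict_section m a ?S)) (sob T0) (sar T0) s
      = lifted_map m c x \<xi> (sob T0) (sar T0) s"
      by (rule lifted_map_cong) (use cc seg mn in auto)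
    then have "(restrict_section m a ?S, T0, mk_nat m s) \<in> Arr (Fib (m, c'))"
      using mk_nat_in_Fib[OF c' r T0] e(2) by simp
    moreover have "is_cart (snd (mk_nat m s (min i m)) \<diamondop> sar ?S (min i m) i)" if "i \<le> n" for i
      using e(3)[OF that] that by simp
    ultimately show ?thesis using S0 by blast
  qed
  have couni_ex: "\<exists>S0 f. couniversal (Fib (n, c)) (Fib (m, c')) (ext_trans ?\<alpha>) T0 S0 f"
    if "T0 \<in> Ob (Fib (m, c'))" for T0
    using ex[OF that] segal_couniversal[OF c a mn seg f] by blast
  let ?f = "(restrict_section m a S, T, \<tau>)"
  have "cartesian_at E C p X ?\<alpha> \<longleftrightarrow> (\<exists>R \<eta> \<epsilon>. adjunction (Fib (n, c)) (Fib (m, c')) (ext_trans ?\<alpha>) R \<eta> \<epsilon> \<and>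
      is_iso (Fib (n, c)) (Comp (Fib (n, c)) (arm R ?f) (\<eta> S)))"
    unfolding cartesian_at_def Let_def using X by simp
  also have "\<dots> \<longleftrightarrow> couniversal (Fib (n, c)) (Fib (m, c')) (ext_trans ?\<alpha>) T S ?f"
  proof -
    have f_hom: "?f \<in> hom (Fib (m, c')) (obm (ext_trans ?\<alpha>) S) T" using \<phi> by (simp add: in_hom_iff)
    have T: "T \<in> Ob (Fib (m, c'))" by (rule Fib_ArrD(2)[OF c' \<phi>])
    have "is_iso (Fib (n, c)) (Comp (Fib (n, c)) (arm R ?f) (\<eta> S)) \<longleftrightarrow>
        couniversal (Fib (n, c)) (Fib (m, c')) (ext_trans ?\<alpha>) T S ?f"
      if adj: "adjunction (Fib (n, c)) (Fib (m, c')) (ext_trans ?\<alpha>) R \<eta> \<epsilon>" for R \<eta> \<epsilon>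
    proof -
      note u = couniversal_counit[OF cats adj T]
      show ?thesis
        using couniversal_iff_iso[OF cats L u(1), of "Comp (Fib (n, c)) (arm R ?f) (\<eta> S)" S ?f]
          u(2)[OF S f_hom] by (simp add: in_hom_iff)
    qed
    then show ?thesis
      using adjunction_if_couniversal[OF cats L couni_ex] by blast
  qed
  also have "\<dots> \<longleftrightarrow> (\<forall>i\<le>n. is_cart (snd (\<tau> (min i m)) \<diamondop> sar S (min i m) i))"
  proof
    assume u: "couniversal (Fib (n, c)) (Fib (m, c')) (ext_trans ?\<alpha>) T S ?f"
    obtain S0 \<tau>0 where S0: "S0 \<in> Ob (Fib (n, c))" "(restrict_section m a S0, T, \<tau>0) \<in> Arr (Fib (m, c'))"
      and cart0: "\<And>i. i \<le> n \<Longrightarrow> is_cart (snd (\<tau>0 (min i m)) \<diamondop> sar S0 (min i m) i)"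
      using ex[OF Fib_ArrD(2)[OF c' \<phi>]] by blast
    have u0: "couniversal (Fib (n, c)) (Fib (m, c')) (ext_trans ?\<alpha>) T S0 (restrict_section m a S0, T, \<tau>0)"
      by (rule segal_couniversal[OF c a mn seg f S0 cart0])
    obtain k where k: "k \<in> Arr (Fib (n, c))" "Dom (Fib (n, c)) k = S" "Cod (Fib (n, c)) k = S0"
      "Comp (Fib (m, c')) (restrict_section m a S0, T, \<tau>0) (arm (ext_trans ?\<alpha>) k) = ?f"
      by (rule couniversal_lift[OF u0 S, of ?f]) (use \<phi> in simp_all)
    have iso: "is_iso (Fib (n, c)) k"
      using couniversal_iff_iso[OF cats L u0 k] u by simp
    obtain \<kappa> where kk: "k = (S, S0, \<kappa>)" using k by (cases k) auto
    note K = lifted_mapD[OF Fib_ArrD(4)[OF c k(1)[unfolded kk]]]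
    have La: "arm (ext_trans ?\<alpha>) k \<in> Arr (Fib (m, c'))" using is_functorD(2)[OF L k(1)] .
    have "mk_nat m (\<lambda>i. snd (\<tau>0 i) \<diamondop> snd (mk_nat m (\<lambda>i. snd (\<kappa> (a i))) i)) = \<tau>"
      using k(4) Fib_Comp[OF c' La[unfolded kk, simplified] S0(2)] unfolding kk
      by simp
    then have tau: "snd (\<tau> i) = snd (\<tau>0 i) \<diamondop> snd (\<kappa> i)" if "i \<le> m" for i
      using that seg by (auto dest: arg_cong[where f = "\<lambda>f. snd (f i)"])
    note T0 = lifted_mapD[OF Fib_ArrD(4)[OF c' S0(2)]]
    note S0' = liftedD[OF Fib_ObD(2)[OF S0(1)]] and S' = liftedD[OF Fib_ObD(2)[OF S]]
    show "\<forall>i\<le>n. is_cart (snd (\<tau> (min i m)) \<diamondop> sar S (min i m) i)"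
    proof (intro allI impI)
      fix i assume i: "i \<le> n"
      let ?i = "min i m"
      have o: "?i \<le> m" "?i \<le> i" "?i \<le> n" using i by auto
      have d: "Dom D (snd (\<tau>0 ?i)) = sob S0 ?i" using T0(2)[of ?i] seg o by simp
      have "snd (\<tau> ?i) \<diamondop> sar S ?i i = snd (\<tau>0 ?i) \<diamondop> (snd (\<kappa> ?i) \<diamondop> sar S ?i i)"
        using tau[OF o(1)] o i K(1-4) T0(1) d S' by (simp add: D.assoc)
      also have "\<dots> = snd (\<tau>0 ?i) \<diamondop> (sar S0 ?i i \<diamondop> snd (\<kappa> i))"
        using K(5)[of ?i i] o i by simp
      also have "\<dots> = (snd (\<tau>0 ?i) \<diamondop> sar S0 ?i i) \<diamondop> snd (\<kappa> i)"
        using o i K(1-4) T0(1) d S0' by (simp add: D.assoc)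
      also have "is_cart \<dots>"
      proof (rule is_cart_comp)
        show "is_cart (snd (\<kappa> i))"
          by (rule is_cart_iso) (use Fib_iso[OF c iso[unfolded kk] i] K(2,4)[OF i] S'(2)[OF i] in simp_all)
        show "Cod D (snd (\<kappa> i)) = Dom D (snd (\<tau>0 ?i) \<diamondop> sar S0 ?i i)"
          using o i K(1-4) T0(1) d S0' by simp
      qed (rule cart0[OF i])
      finally show "is_cart (snd (\<tau> ?i) \<diamondop> sar S ?i i)" .
    qed
  next
    assume "\<forall>i\<le>n. is_cart (snd (\<tau> (min i m)) \<diamondop> sar S (min i m) i)"
    then show "couniversal (Fib (n, c)) (Fib (m, c')) (ext_trans ?\<alpha>) T S ?f"
      using segal_couniversal[OF c a mn seg f S \<phi>] by blast
  qed
  finally show ?thesis .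
qed

end


section \<open>Sections of the simplicial extension\<close>

text \<open>The components of a section of the simplicial extension: the section over a simplex, its objects and
  arrows, the vertical arrows that a map of simplices induces, and the components of a map of sections.\<close>

definition xsec where "xsec X s = snd (obm X s)"
definition xob where "xob X s i = sob (xsec X s) i"
definition xar where "xar X s i j = sar (xsec X s) i j"
definition xtr where "xtr X \<alpha> i = snd ((snd (snd (snd (snd (snd (arm X \<alpha>)))))) i)"
definition xcomp where "xcomp \<sigma> s i = snd ((snd (snd (snd (snd (snd (\<sigma> s)))))) i)"

context opfib begin

abbreviation EE where "EE \<equiv> simp_ext E C p"
abbreviation SS where "SS \<equiv> Sect (simp_repl C) (simp_ext E C p) grothendieck_proj"

lemma EE_simps [simp]:
  "Dom EE (s, t, u) = s" "Cod EE (s, t, u) = t"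
  by (simp_all add: simp_ext_def grothendieck_def)

lemma EE_Ob_iff: "(s, S) \<in> Ob EE \<longleftrightarrow> is_simplex C s \<and> S \<in> Ob (Fib s)"
  by (simp add: simp_ext_def grothendieck_def)

lemma EE_Arr_iff:
  "((s, S), (t, T), (\<beta>, \<phi>)) \<in> Arr EE \<longleftrightarrow> \<beta> \<in> hom CC s t \<and> S \<in> Ob (Fib s) \<and> T \<in> Ob (Fib t) \<and>
    \<phi> \<in> hom (Fib t) (obm (ext_trans \<beta>) S) T"
  by (simp add: simp_ext_def grothendieck_def)

lemma EE_Ident: "Ident EE (s, S) = ((s, S), (s, S), (Ident CC s, Ident (Fib s) S))"
  by (simp add: simp_ext_def grothendieck_def)

lemma EE_Comp: "Comp EE (t', (u, U), (\<gamma>, \<psi>)) (s, t, (\<beta>, \<phi>)) =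
    (s, (u, U), (Comp CC \<gamma> \<beta>, Comp (Fib u) \<psi> (arm (ext_trans \<gamma>) \<phi>)))"
  by (simp add: simp_ext_def grothendieck_def)

lemma proj_simps [simp]:
  "obm grothendieck_proj (s, S) = s" "arm grothendieck_proj (x, y, (\<beta>, \<phi>)) = \<beta>"
  by (simp_all add: grothendieck_proj_def)

lemma category_SS: "category SS"
  unfolding simp_ext_def
  by (rule category_Sect[OF category_simp_repl category_simp_ext[unfolded simp_ext_def]
        is_functor_grothendieck_proj])

lemma Fib_Ob_s: "S \<in> Ob (Fib s) \<Longrightarrow> S = mk_lift (fst s) (sob S) (sar S) \<and> lifted (fst s) (snd s) (sob S) (sar S)"
  using Fib_ObD(1,2)[of S "fst s" "snd s"] by simp

text \<open>What the components of a section of the simplicial extension satisfy: \<open>t\<close> is a strictly functorial family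
  of maps of lifted simplices.\<close>

definition system ::
    "(('o, 'a) simplex \<Rightarrow> nat \<Rightarrow> 'p) \<Rightarrow> (('o, 'a) simplex \<Rightarrow> nat \<Rightarrow> nat \<Rightarrow> 'p \<times> 'p \<times> ('b \<times> 'b) set) \<Rightarrow>
     (('o, 'a) simplex_arr \<Rightarrow> nat \<Rightarrow> 'p \<times> 'p \<times> ('b \<times> 'b) set) \<Rightarrow> bool" where
  "system x \<xi> t \<longleftrightarrow>
    (\<forall>s. is_simplex C s \<longrightarrow> lifted (fst s) (snd s) (x s) (\<xi> s)) \<and>
    (\<forall>s u a. (s, u, a) \<in> Arr CC \<longrightarrow> lifted_map (fst u) (snd u) (\<lambda>i. x s (a i)) (\<lambda>i j. \<xi> s (a i) (a j))
      (x u) (\<xi> u) (t (s, u, a))) \<and>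
    (\<forall>s. is_simplex C s \<longrightarrow> (\<forall>i\<le>fst s. t (Ident CC s) i = Ident D (x s i))) \<and>
    (\<forall>s u v a b. (s, u, a) \<in> Arr CC \<longrightarrow> (u, v, b) \<in> Arr CC \<longrightarrow> (\<forall>i\<le>fst v.
      t (s, v, \<lambda>i \<in> {0..fst v}. a (b i)) i = t (u, v, b) i \<diamondop> t (s, u, a) (b i)))"

lemma systemD:
  assumes "system x \<xi> t"
  shows "is_simplex C s \<Longrightarrow> lifted (fst s) (snd s) (x s) (\<xi> s)"
    and "(s, u, a) \<in> Arr CC \<Longrightarrow> lifted_map (fst u) (snd u) (\<lambda>i. x s (a i)) (\<lambda>i j. \<xi> s (a i) (a j))
      (x u) (\<xi> u) (t (s, u, a))"
    and "is_simplex C s \<Longrightarrow> i \<le> fst s \<Longrightarrow> t (Ident CC s) i = Ident D (x s i)"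
    and "(s, u, a) \<in> Arr CC \<Longrightarrow> (u, v, b) \<in> Arr CC \<Longrightarrow> i \<le> fst v \<Longrightarrow>
      t (s, v, \<lambda>i \<in> {0..fst v}. a (b i)) i = t (u, v, b) i \<diamondop> t (s, u, a) (b i)"
  using assms unfolding system_def by blast+

lemma lifted_map_cong':
  assumes "lifted_map m c x \<xi> y \<zeta> s" "\<And>i. i \<le> m \<Longrightarrow> x i = x' i" "\<And>i. i \<le> m \<Longrightarrow> y i = y' i"
    "\<And>i. i \<le> m \<Longrightarrow> s i = s' i" "\<And>i j. i \<le> j \<Longrightarrow> j \<le> m \<Longrightarrow> \<xi> i j = \<xi>' i j"
    "\<And>i j. i \<le> j \<Longrightarrow> j \<le> m \<Longrightarrow> \<zeta> i j = \<zeta>' i j"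
  shows "lifted_map m c x' \<xi>' y' \<zeta>' s'"
  using lifted_map_cong[of m c c x x' y y' s s' \<xi> \<xi>' \<zeta> \<zeta>'] assms by simp

lemma Arr_CC:
  assumes "(s, u, a) \<in> Arr CC"
  shows "is_simplex C s" "is_simplex C u" "ord_mono (fst u) (fst s) a" "u = face s (fst u) a"
proof -
  show 1: "is_simplex C s" "ord_mono (fst u) (fst s) a" "u = face s (fst u) a"
    using assms simp_repl_Arr_iff by blast+
  show "is_simplex C u" using category.Ob_simps(2)[OF category_simp_repl assms] by simp
qed

lemma section_normal:
  assumes X: "X \<in> Ob SS"
  shows "is_simplex C s \<Longrightarrow> obm X s = (s, xsec X s)"
    and "is_simplex C s \<Longrightarrow> xsec X s \<in> Ob (Fib s)"
    and "(s, u, a) \<in> Arr CC \<Longrightarrow> arm X (s, u, a) = ((s, xsec X s), (u, xsec X u), ((s, u, a),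
      (restrict_section (fst u) a (xsec X s), xsec X u, mk_nat (fst u) (xtr X (s, u, a)))))"
    and "(s, u, a) \<in> Arr CC \<Longrightarrow>
      (restrict_section (fst u) a (xsec X s), xsec X u, mk_nat (fst u) (xtr X (s, u, a))) \<in> Arr (Fib u)"
proof -
  have F: "is_functor CC EE X" "\<And>s. is_simplex C s \<Longrightarrow> fst (obm X s) = s"
    "\<And>\<alpha>. \<alpha> \<in> Arr CC \<Longrightarrow> arm grothendieck_proj (arm X \<alpha>) = \<alpha>"
  proof -
    have sec: "is_section CC EE grothendieck_proj X" using X by (simp add: Sect_def)
    then show "is_functor CC EE X" unfolding is_section_def by blast
    from sec have ob: "\<And>x. x \<in> Ob CC \<Longrightarrow> fst (obm X x) = x"
      unfolding is_section_def grothendieck_proj_def by force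
    show "fst (obm X s) = s" if "is_simplex C s" for s using ob[of s] that by simp
    show "arm grothendieck_proj (arm X \<alpha>) = \<alpha>" if "\<alpha> \<in> Arr CC" for \<alpha>
      using sec that unfolding is_section_def by blast
  qed
  note F' = is_functorD[OF F(1)]
  have ob: "obm X s = (s, xsec X s)" if s: "is_simplex C s" for s
    using F(2)[OF s] by (cases "obm X s") (simp add: xsec_def)
  then show "is_simplex C s \<Longrightarrow> obm X s = (s, xsec X s)" .
  show "is_simplex C s \<Longrightarrow> xsec X s \<in> Ob (Fib s)"
    using F'(1)[of s] ob[of s] by (simp add: EE_Ob_iff)
  have *: "arm X (s, u, a) = ((s, xsec X s), (u, xsec X u), ((s, u, a),
      (restrict_section (fst u) a (xsec X s), xsec X u, mk_nat (fst u) (xtr X (s, u, a))))) \<and>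
      (restrict_section (fst u) a (xsec X s), xsec X u, mk_nat (fst u) (xtr X (s, u, a))) \<in> Arr (Fib u)"
    if \<alpha>: "(s, u, a) \<in> Arr CC"
  proof -
    note A = Arr_CC[OF \<alpha>]
    obtain x y \<beta> S T \<tau> where e: "arm X (s, u, a) = (x, y, (\<beta>, (S, T, \<tau>)))" by (metis prod_cases3 surj_pair)
    have xy: "x = (s, xsec X s)" "y = (u, xsec X u)" "\<beta> = (s, u, a)"
      using F'(3,4)[OF \<alpha>] F(3)[OF \<alpha>] e ob A by simp_all
    have "((s, xsec X s), (u, xsec X u), ((s, u, a), (S, T, \<tau>))) \<in> Arr EE"
      using F'(2)[OF \<alpha>] e xy by simp
    then have h: "(S, T, \<tau>) \<in> hom (Fib u) (restrict_section (fst u) a (xsec X s)) (xsec X u)"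
      by (simp add: EE_Arr_iff)
    then have ST: "S = restrict_section (fst u) a (xsec X s)" "T = xsec X u" "(S, T, \<tau>) \<in> Arr (Fib u)"
      unfolding in_hom_iff by auto
    have "xtr X (s, u, a) = (\<lambda>i. snd (\<tau> i))" using e by (simp add: xtr_def fun_eq_iff)
    then have "\<tau> = mk_nat (fst u) (xtr X (s, u, a))"
      using Fib_ArrD(3)[of "fst u" "snd u" S T \<tau>] A(2) ST(3) by simp
    then show ?thesis using e xy ST by simp
  qed
  show "(s, u, a) \<in> Arr CC \<Longrightarrow> arm X (s, u, a) = ((s, xsec X s), (u, xsec X u), ((s, u, a),
      (restrict_section (fst u) a (xsec X s), xsec X u, mk_nat (fst u) (xtr X (s, u, a)))))"
    "(s, u, a) \<in> Arr CC \<Longrightarrow>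
      (restrict_section (fst u) a (xsec X s), xsec X u, mk_nat (fst u) (xtr X (s, u, a))) \<in> Arr (Fib u)"
    using * by blast+
qed

lemma mk_nat_eqD: "mk_nat n f = mk_nat n g \<Longrightarrow> i \<le> n \<Longrightarrow> f i = g i"
  by (auto dest: arg_cong[where f = "\<lambda>h. h i"])

lemma Fib_Comp_s:
  assumes "is_simplex C u" "(S, T, \<tau>) \<in> Arr (Fib u)" "(T, U, \<upsilon>) \<in> Arr (Fib u)"
  shows "Comp (Fib u) (T, U, \<upsilon>) (S, T, \<tau>) = (S, U, mk_nat (fst u) (\<lambda>i. snd (\<upsilon> i) \<diamondop> snd (\<tau> i)))"
  using Fib_Comp[of "fst u" "snd u"] assms by simp

lemma ext_trans_Arr:
  assumes "(s, u, a) \<in> Arr CC" "(S, T, \<tau>) \<in> Arr (Fib s)"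
  shows "(restrict_section (fst u) a S, restrict_section (fst u) a T, mk_nat (fst u) (\<lambda>i. snd (\<tau> (a i))))
    \<in> Arr (Fib u)"
  using is_functorD(2)[OF ext_trans_functor[OF assms(1)], of "(S, T, \<tau>)"] assms(2) by simp

lemma system_of_section:
  assumes X: "X \<in> Ob SS" shows "system (xob X) (xar X) (xtr X)"
proof -
  note N = section_normal[OF X]
  have F: "is_functor CC EE X" using X by (auto simp: Sect_def is_section_def)
  note F' = is_functorD[OF F]
  show ?thesis unfolding system_def
  proof (intro conjI allI impI)
    fix s assume s: "is_simplex C s"
    show "lifted (fst s) (snd s) (xob X s) (xar X s)"
      using Fib_Ob_s[OF N(2)[OF s]] unfolding xob_def xar_def by blast
    fix i assume i: "i \<le> fst s"
    have id: "(s, s, \<lambda>i\<in>{0..fst s}. i) \<in> Arr CC"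
      using category.Ident_simps(1)[OF category_simp_repl, of s] s by simp
    have "Ident (Fib s) (xsec X s) = (xsec X s, xsec X s, mk_nat (fst s) (\<lambda>i. Ident D (xob X s i)))"
      using Fib_Ident[of "xsec X s" "fst s" "snd s"] N(2)[OF s] by (simp add: xob_def)
    then have "mk_nat (fst s) (xtr X (Ident CC s)) = mk_nat (fst s) (\<lambda>i. Ident D (xob X s i))"
      using F'(5)[of s] N(3)[OF id] N(1)[OF s] s by (simp add: EE_Ident)
    then show "xtr X (Ident CC s) i = Ident D (xob X s i)" using i by (rule mk_nat_eqD)
  next
    fix s u a assume \<alpha>: "(s, u, a) \<in> Arr CC"
    note A = Arr_CC[OF \<alpha>]
    have "lifted_map (fst u) (snd u) (sob (restrict_section (fst u) a (xsec X s)))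
      (sar (restrict_section (fst u) a (xsec X s))) (sob (xsec X u)) (sar (xsec X u))
      (\<lambda>i. snd (mk_nat (fst u) (xtr X (s, u, a)) i))"
      using Fib_ArrD(4)[of "fst u" "snd u"] N(4)[OF \<alpha>] A(2) by simp
    then show "lifted_map (fst u) (snd u) (\<lambda>i. xob X s (a i)) (\<lambda>i j. xar X s (a i) (a j))
      (xob X u) (xar X u) (xtr X (s, u, a))"
      by (rule lifted_map_cong') (simp_all add: xob_def xar_def)
  next
    fix s u v a b i assume \<alpha>: "(s, u, a) \<in> Arr CC" and \<beta>: "(u, v, b) \<in> Arr CC" and i: "i \<le> fst v"
    note A = Arr_CC[OF \<alpha>] and B = Arr_CC[OF \<beta>]
    have c: "(s, v, \<lambda>i \<in> {0..fst v}. a (b i)) \<in> Arr CC"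
      using category.Comp_simps(1)[OF category_simp_repl \<alpha> \<beta>] by simp
    have "arm X (s, v, \<lambda>i \<in> {0..fst v}. a (b i)) = Comp EE (arm X (u, v, b)) (arm X (s, u, a))"
      using F'(6)[OF \<alpha> \<beta>] by simp
    also have "\<dots> = ((s, xsec X s), (v, xsec X v), (Comp CC (u, v, b) (s, u, a), 
       Comp (Fib v) (restrict_section (fst v) b (xsec X u), xsec X v, mk_nat (fst v) (xtr X (u, v, b)))
         (restrict_section (fst v) b (restrict_section (fst u) a (xsec X s)), restrict_section (fst v) b (xsec X u),
           mk_nat (fst v) (\<lambda>i. snd (mk_nat (fst u) (xtr X (s, u, a)) (b i))))))"
      unfolding N(3)[OF \<alpha>] N(3)[OF \<beta>] EE_Comp by simp
    also have "\<dots> = ((s, xsec X s), (v, xsec X v), (Comp CC (u, v, b) (s, u, a), 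
       (restrict_section (fst v) b (restrict_section (fst u) a (xsec X s)), xsec X v,
        mk_nat (fst v) (\<lambda>i. snd (mk_nat (fst v) (xtr X (u, v, b)) i) \<diamondop>
         snd (mk_nat (fst v) (\<lambda>i. snd (mk_nat (fst u) (xtr X (s, u, a)) (b i))) i)))))"
      using Fib_Comp_s[OF B(2) ext_trans_Arr[OF \<beta> N(4)[OF \<alpha>]] N(4)[OF \<beta>]] by simp
    finally have "mk_nat (fst v) (xtr X (s, v, \<lambda>i \<in> {0..fst v}. a (b i))) =
       mk_nat (fst v) (\<lambda>i. snd (mk_nat (fst v) (xtr X (u, v, b)) i) \<diamondop>
         snd (mk_nat (fst v) (\<lambda>i. snd (mk_nat (fst u) (xtr X (s, u, a)) (b i))) i))"
      unfolding N(3)[OF c] by simp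
    from mk_nat_eqD[OF this i]
    show "xtr X (s, v, \<lambda>i \<in> {0..fst v}. a (b i)) i = xtr X (u, v, b) i \<diamondop> xtr X (s, u, a) (b i)"
      using i ord_monoD(1)[OF B(3) i] by simp
  qed
qed

definition mk_section where
  "mk_section x \<xi> t = \<lparr>
    obm = (\<lambda>s \<in> Ob CC. (s, mk_lift (fst s) (x s) (\<xi> s))),
    arm = (\<lambda>(s, u, a) \<in> Arr CC. ((s, mk_lift (fst s) (x s) (\<xi> s)), (u, mk_lift (fst u) (x u) (\<xi> u)),
      ((s, u, a), (restrict_section (fst u) a (mk_lift (fst s) (x s) (\<xi> s)),
        mk_lift (fst u) (x u) (\<xi> u), mk_nat (fst u) (t (s, u, a))))))\<rparr>"

lemma mk_section_obm: "is_simplex C s \<Longrightarrow> obm (mk_section x \<xi> t) s = (s, mk_lift (fst s) (x s) (\<xi> s))"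
  by (simp add: mk_section_def)

lemma mk_section_arm:
  "(s, u, a) \<in> Arr CC \<Longrightarrow> arm (mk_section x \<xi> t) (s, u, a) =
    ((s, mk_lift (fst s) (x s) (\<xi> s)), (u, mk_lift (fst u) (x u) (\<xi> u)),
      ((s, u, a), (restrict_section (fst u) a (mk_lift (fst s) (x s) (\<xi> s)),
        mk_lift (fst u) (x u) (\<xi> u), mk_nat (fst u) (t (s, u, a)))))"
  by (simp add: mk_section_def)

lemma mk_section_simps:
  "is_simplex C s \<Longrightarrow> i \<le> fst s \<Longrightarrow> xob (mk_section x \<xi> t) s i = x s i"
  "is_simplex C s \<Longrightarrow> i \<le> j \<Longrightarrow> j \<le> fst s \<Longrightarrow> xar (mk_section x \<xi> t) s i j = \<xi> s i j"
  "(s, u, a) \<in> Arr CC \<Longrightarrow> i \<le> fst u \<Longrightarrow> xtr (mk_section x \<xi> t) (s, u, a) i = t (s, u, a) i"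
  by (simp_all add: xob_def xar_def xtr_def xsec_def mk_section_obm mk_section_arm)

text \<open>Together with \<open>system_of_section\<close> this reduces sections of the simplicial extension to families of arrows
  of the transpose.\<close>

lemma section_of_system:
  assumes sys: "system x \<xi> t" shows "mk_section x \<xi> t \<in> Ob SS"
proof -
  note Y = systemD[OF sys]
  let ?X = "mk_section x \<xi> t" and ?S = "\<lambda>s. mk_lift (fst s) (x s) (\<xi> s)"
  have S: "?S s \<in> Ob (Fib s)" if "is_simplex C s" for s
    using mk_lift_in_Fib[OF Y(1)[OF that]] by simp
  have \<phi>: "(restrict_section (fst u) a (?S s), ?S u, mk_nat (fst u) (t (s, u, a))) \<in> Arr (Fib u)"
    if \<alpha>: "(s, u, a) \<in> Arr CC" for s u a
  proof -
    note A = Arr_CC[OF \<alpha>]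
    have r: "restrict_section (fst u) a (?S s) \<in> Ob (Fib u)"
      using restrict_in_Fib[of "?S s" "fst s" "snd s" a "fst u"] S[OF A(1)] A(3,4) by simp
    have "lifted_map (fst u) (snd u) (sob (restrict_section (fst u) a (?S s)))
      (sar (restrict_section (fst u) a (?S s))) (sob (?S u)) (sar (?S u)) (t (s, u, a))"
      by (rule lifted_map_cong'[OF Y(2)[OF \<alpha>]]) (use ord_monoD[OF A(3)] in auto)
    then show ?thesis
      using mk_nat_in_Fib[of "fst u" "snd u"] A(2) r S[OF A(2)] by simp
  qed
  have "is_functor CC EE ?X"
  proof (rule is_functorI)
    fix s assume "s \<in> Ob CC"
    then have s: "is_simplex C s" by simp
    then show "obm ?X s \<in> Ob EE" using S by (simp add: mk_section_obm EE_Ob_iff)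
    have id: "(s, s, \<lambda>i\<in>{0..fst s}. i) \<in> Arr CC"
      using category.Ident_simps(1)[OF category_simp_repl, of s] s by simp
    have "mk_nat (fst s) (t (Ident CC s)) = mk_nat (fst s) (\<lambda>i. Ident D (sob (?S s) i))"
      by (rule mk_nat_cong) (use Y(3)[OF s] in simp)
    then have "(?S s, ?S s, mk_nat (fst s) (t (Ident CC s))) = Ident (Fib s) (?S s)"
      using Fib_Ident[of "?S s" "fst s" "snd s"] S[OF s] by simp
    then show "arm ?X (Ident CC s) = Ident EE (obm ?X s)"
      using mk_section_arm[OF id, of x \<xi> t] restrict_section_id[OF S[OF s]]
      by (simp add: mk_section_obm[OF s] EE_Ident)
  next
    fix f assume f: "f \<in> Arr CC"
    obtain s u a where fe: "f = (s, u, a)" by (cases f) auto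
    note A = Arr_CC[OF f[unfolded fe]]
    show "arm ?X f \<in> Arr EE \<and> Dom EE (arm ?X f) = obm ?X (Dom CC f) \<and>
      Cod EE (arm ?X f) = obm ?X (Cod CC f)"
      using f A S[OF A(1)] S[OF A(2)] \<phi>[OF f[unfolded fe]] unfolding fe
      by (simp add: mk_section_obm mk_section_arm EE_Arr_iff in_hom_iff)
  next
    fix f g assume f: "f \<in> Arr CC" and g: "g \<in> Arr CC" and fg: "Cod CC f = Dom CC g"
    obtain s u a where fe: "f = (s, u, a)" by (cases f) auto
    obtain v b where ge: "g = (u, v, b)" using fg fe by (cases g) auto
    note \<alpha> = f[unfolded fe] and \<beta> = g[unfolded ge]
    note A = Arr_CC[OF \<alpha>] and B = Arr_CC[OF \<beta>]
    have c: "(s, v, \<lambda>i \<in> {0..fst v}. a (b i)) \<in> Arr CC"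
      using category.Comp_simps(1)[OF category_simp_repl \<alpha> \<beta>] by simp
    have m: "mk_nat (fst v) (t (s, v, \<lambda>i \<in> {0..fst v}. a (b i))) =
        mk_nat (fst v) (\<lambda>i. snd (mk_nat (fst v) (t (u, v, b)) i) \<diamondop>
         snd (mk_nat (fst v) (\<lambda>i. snd (mk_nat (fst u) (t (s, u, a)) (b i))) i))"
      by (rule mk_nat_cong) (use Y(4)[OF \<alpha> \<beta>] ord_monoD(1)[OF B(3)] in simp)
    have "Comp EE (arm ?X g) (arm ?X f) = ((s, ?S s), (v, ?S v), (Comp CC (u, v, b) (s, u, a), 
       Comp (Fib v) (restrict_section (fst v) b (?S u), ?S v, mk_nat (fst v) (t (u, v, b)))
         (restrict_section (fst v) b (restrict_section (fst u) a (?S s)), restrict_section (fst v) b (?S u),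
           mk_nat (fst v) (\<lambda>i. snd (mk_nat (fst u) (t (s, u, a)) (b i))))))"
      unfolding fe ge mk_section_arm[OF \<alpha>] mk_section_arm[OF \<beta>] EE_Comp by simp
    also have "\<dots> = ((s, ?S s), (v, ?S v), (Comp CC (u, v, b) (s, u, a), 
       (restrict_section (fst v) b (restrict_section (fst u) a (?S s)), ?S v,
        mk_nat (fst v) (\<lambda>i. snd (mk_nat (fst v) (t (u, v, b)) i) \<diamondop>
         snd (mk_nat (fst v) (\<lambda>i. snd (mk_nat (fst u) (t (s, u, a)) (b i))) i)))))"
      using Fib_Comp_s[OF B(2) ext_trans_Arr[OF \<beta> \<phi>[OF \<alpha>]] \<phi>[OF \<beta>]] by simp
    also have "\<dots> = arm ?X (s, v, \<lambda>i \<in> {0..fst v}. a (b i))"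
      unfolding mk_section_arm[OF c] m restrict_section_comp[OF B(3)] by simp
    finally show "arm ?X (Comp CC g f) = Comp EE (arm ?X g) (arm ?X f)" by (simp add: fe ge)
  qed
  moreover have "ext_functor CC ?X"
    by (simp add: ext_functor_def mk_section_def del: simp_repl_simps)
  moreover have "arm grothendieck_proj (arm ?X f) = f" if f: "f \<in> Arr CC" for f
  proof -
    obtain s u a where fe: "f = (s, u, a)" by (cases f) auto
    show ?thesis using mk_section_arm[OF f[unfolded fe], of x \<xi> t] by (simp add: fe)
  qed
  ultimately show ?thesis
    by (simp add: Sect_def is_section_def mk_section_obm)
qed

lemma SS_simps [simp]: "Dom SS (X, Y, \<sigma>) = X" "Cod SS (X, Y, \<sigma>) = Y"
  by (simp_all add: Sect_def)

definition mk_mor where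
  "mk_mor X Y h = (\<lambda>s \<in> Ob CC. ((s, xsec X s), (s, xsec Y s), (Ident CC s,
    (xsec X s, xsec Y s, mk_nat (fst s) (h s)))))"

definition system_map where
  "system_map X Y h \<longleftrightarrow>
    (\<forall>s. is_simplex C s \<longrightarrow> lifted_map (fst s) (snd s) (xob X s) (xar X s) (xob Y s) (xar Y s) (h s)) \<and>
    (\<forall>s u a. (s, u, a) \<in> Arr CC \<longrightarrow>
      (\<forall>i\<le>fst u. h u i \<diamondop> xtr X (s, u, a) i = xtr Y (s, u, a) i \<diamondop> h s (a i)))"

lemma mk_mor_simps:
  "is_simplex C s \<Longrightarrow> i \<le> fst s \<Longrightarrow> xcomp (mk_mor X Y h) s i = h s i"
  by (simp add: mk_mor_def xcomp_def)

lemma mk_mor_cong: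
  assumes "\<And>s i. is_simplex C s \<Longrightarrow> i \<le> fst s \<Longrightarrow> h s i = h' s i"
  shows "mk_mor X Y h = mk_mor X Y h'"
  unfolding mk_mor_def
  by (rule restrict_ext) (use mk_nat_cong[of _ "h _" "h' _"] assms in simp)

text \<open>Composing in the Grothendieck construction with an arrow over an identity involves the action of that
  identity, which is trivial; so naturality may be tested on components.\<close>

lemma mor_square:
  assumes X: "X \<in> Ob SS" and Y: "Y \<in> Ob SS" and \<alpha>: "(s, u, a) \<in> Arr CC"
    and h: "\<And>s. is_simplex C s \<Longrightarrow> (xsec X s, xsec Y s, mk_nat (fst s) (h s)) \<in> Arr (Fib s)"
  shows "Comp EE (mk_mor X Y h u) (arm X (s, u, a)) = Comp EE (arm Y (s, u, a)) (mk_mor X Y h s) \<longleftrightarrow>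
    (\<forall>i\<le>fst u. h u i \<diamondop> xtr X (s, u, a) i = xtr Y (s, u, a) i \<diamondop> h s (a i))"
proof -
  note A = Arr_CC[OF \<alpha>] and NX = section_normal[OF X] and NY = section_normal[OF Y]
  interpret CC: category CC by (rule category_simp_repl)
  let ?r = "restrict_section (fst u) a"
  have id: "(u, u, \<lambda>i\<in>{0..fst u}. i) \<in> Arr CC"
    using CC.Ident_simps(1)[of u] A(2) by simp
  have rX: "?r (xsec X s) \<in> Ob (Fib u)"
    using restrict_in_Fib[of "xsec X s" "fst s" "snd s" a "fst u"] NX(2)[OF A(1)] A(3,4) by simp
  have "mk_nat (fst u) (\<lambda>i. snd (mk_nat (fst u) (xtr X (s, u, a)) ((\<lambda>i\<in>{0..fst u}. i) i))) =
      mk_nat (fst u) (xtr X (s, u, a))"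
    by (rule mk_nat_cong) simp
  then have idt: "arm (ext_trans (Ident CC u)) (?r (xsec X s), xsec X u, mk_nat (fst u) (xtr X (s, u, a))) =
    (?r (xsec X s), xsec X u, mk_nat (fst u) (xtr X (s, u, a)))"
    using restrict_section_id[OF rX] restrict_section_id[OF NX(2)[OF A(2)]] by simp
  have "Comp EE (mk_mor X Y h u) (arm X (s, u, a)) = ((s, xsec X s), (u, xsec Y u),
      (Comp CC (Ident CC u) (s, u, a), Comp (Fib u) (xsec X u, xsec Y u, mk_nat (fst u) (h u))
        (?r (xsec X s), xsec X u, mk_nat (fst u) (xtr X (s, u, a)))))"
    unfolding NX(3)[OF \<alpha>] using A(2) idt by (simp add: mk_mor_def EE_Comp del: simp_repl_simps(4,5) ext_trans_simps)
  also have "\<dots> = ((s, xsec X s), (u, xsec Y u), ((s, u, a),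
      (?r (xsec X s), xsec Y u, mk_nat (fst u) (\<lambda>i. snd (mk_nat (fst u) (h u) i) \<diamondop>
        snd (mk_nat (fst u) (xtr X (s, u, a)) i)))))"
    using Fib_Comp_s[OF A(2) NX(4)[OF \<alpha>] h[OF A(2)]] CC.Ident_left[OF \<alpha>, of u] by simp
  finally have 1: "Comp EE (mk_mor X Y h u) (arm X (s, u, a)) = \<dots>" .
  have "Comp EE (arm Y (s, u, a)) (mk_mor X Y h s) = ((s, xsec X s), (u, xsec Y u),
      (Comp CC (s, u, a) (Ident CC s), Comp (Fib u) (?r (xsec Y s), xsec Y u, mk_nat (fst u) (xtr Y (s, u, a)))
        (?r (xsec X s), ?r (xsec Y s), mk_nat (fst u) (\<lambda>i. snd (mk_nat (fst s) (h s) (a i))))))"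
    unfolding NY(3)[OF \<alpha>] using A(1) by (simp add: mk_mor_def EE_Comp del: simp_repl_simps(4,5))
  also have "\<dots> = ((s, xsec X s), (u, xsec Y u), ((s, u, a),
      (?r (xsec X s), xsec Y u, mk_nat (fst u) (\<lambda>i. snd (mk_nat (fst u) (xtr Y (s, u, a)) i) \<diamondop>
        snd (mk_nat (fst u) (\<lambda>i. snd (mk_nat (fst s) (h s) (a i))) i)))))"
    using Fib_Comp_s[OF A(2) ext_trans_Arr[OF \<alpha> h[OF A(1)]] NY(4)[OF \<alpha>]] CC.Ident_right[OF \<alpha>, of s] by simp
  finally have 2: "Comp EE (arm Y (s, u, a)) (mk_mor X Y h s) = \<dots>" .
  have "mk_nat (fst u) (\<lambda>i. snd (mk_nat (fst u) (h u) i) \<diamondop> snd (mk_nat (fst u) (xtr X (s, u, a)) i)) =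
      mk_nat (fst u) (\<lambda>i. snd (mk_nat (fst u) (xtr Y (s, u, a)) i) \<diamondop>
        snd (mk_nat (fst u) (\<lambda>i. snd (mk_nat (fst s) (h s) (a i))) i)) \<longleftrightarrow>
    (\<forall>i\<le>fst u. h u i \<diamondop> xtr X (s, u, a) i = xtr Y (s, u, a) i \<diamondop> h s (a i))"
    (is "mk_nat _ ?f = mk_nat _ ?g \<longleftrightarrow> _")
  proof -
    have "?f i = h u i \<diamondop> xtr X (s, u, a) i" "?g i = xtr Y (s, u, a) i \<diamondop> h s (a i)" if "i \<le> fst u" for i
      using that ord_monoD(1)[OF A(3) that] by simp_all
    then show ?thesis using mk_nat_eqD[of "fst u" ?f ?g] mk_nat_cong[of "fst u" ?f ?g] by auto
  qed
  then show ?thesis unfolding 1 2 by simp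
qed

lemma map_in_Fib_iff:
  assumes X: "X \<in> Ob SS" and Y: "Y \<in> Ob SS" and s: "is_simplex C s"
  shows "(xsec X s, xsec Y s, mk_nat (fst s) h) \<in> Arr (Fib s) \<longleftrightarrow>
    lifted_map (fst s) (snd s) (xob X s) (xar X s) (xob Y s) (xar Y s) h"
proof
  assume "(xsec X s, xsec Y s, mk_nat (fst s) h) \<in> Arr (Fib s)"
  then have "lifted_map (fst s) (snd s) (sob (xsec X s)) (sar (xsec X s)) (sob (xsec Y s)) (sar (xsec Y s))
    (\<lambda>i. snd (mk_nat (fst s) h i))"
    using Fib_ArrD(4)[of "fst s" "snd s"] s by simp
  then show "lifted_map (fst s) (snd s) (xob X s) (xar X s) (xob Y s) (xar Y s) h"
    by (rule lifted_map_cong') (simp_all add: xob_def xar_def)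
next
  assume "lifted_map (fst s) (snd s) (xob X s) (xar X s) (xob Y s) (xar Y s) h"
  then have "lifted_map (fst s) (snd s) (sob (xsec X s)) (sar (xsec X s)) (sob (xsec Y s)) (sar (xsec Y s)) h"
    by (rule lifted_map_cong') (simp_all add: xob_def xar_def)
  then show "(xsec X s, xsec Y s, mk_nat (fst s) h) \<in> Arr (Fib s)"
    using mk_nat_in_Fib[of "fst s" "snd s"] s section_normal(2)[OF X s] section_normal(2)[OF Y s] by simp
qed

lemma SS_ArrI:
  assumes X: "X \<in> Ob SS" and Y: "Y \<in> Ob SS" and h: "system_map X Y h"
  shows "(X, Y, mk_mor X Y h) \<in> Arr SS"
proof -
  have *: "(xsec X s, xsec Y s, mk_nat (fst s) (h s)) \<in> Arr (Fib s)" if "is_simplex C s" for s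
    unfolding map_in_Fib_iff[OF X Y that] using h that unfolding system_map_def by blast
  note sq = mor_square[OF X Y _ *]
  note NX = section_normal[OF X] and NY = section_normal[OF Y]
  have hom: "mk_mor X Y h s \<in> hom EE (obm X s) (obm Y s)" if s: "is_simplex C s" for s
    using category.Ident_simps[OF category_simp_repl, of s] s * NX(1,2)[OF s] NY(1,2)[OF s]
      restrict_section_id[OF NX(2)[OF s]]
    by (simp add: mk_mor_def in_hom_iff EE_Arr_iff)
  have "Comp EE (mk_mor X Y h (Cod CC f)) (arm X f) = Comp EE (arm Y f) (mk_mor X Y h (Dom CC f))"
    if f: "f \<in> Arr CC" for f
  proof -
    obtain s u a where fe: "f = (s, u, a)" by (cases f) auto
    show ?thesis using sq f h unfolding fe system_map_def by simp
  qed
  then have "nat_trans CC EE X Y (mk_mor X Y h)"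
    unfolding nat_trans_def using hom by simp
  moreover have "mk_mor X Y h \<in> extensional (Ob CC)" by (simp add: mk_mor_def)
  moreover have "arm grothendieck_proj (mk_mor X Y h s) = Ident CC s" if "is_simplex C s" for s
    using that by (simp add: mk_mor_def del: simp_repl_simps(4))
  ultimately show ?thesis
    using X Y by (simp add: Sect_def)
qed

lemma SS_ArrD:
  assumes "(X, Y, \<sigma>) \<in> Arr SS"
  shows "X \<in> Ob SS" "Y \<in> Ob SS" "\<sigma> = mk_mor X Y (xcomp \<sigma>)" "system_map X Y (xcomp \<sigma>)"
proof -
  show X: "X \<in> Ob SS" and Y: "Y \<in> Ob SS" using assms by (auto simp: Sect_def)
  note NX = section_normal[OF X] and NY = section_normal[OF Y]
  have s: "nat_trans CC EE X Y \<sigma>" "\<sigma> \<in> extensional (Ob CC)"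
    "\<And>s. is_simplex C s \<Longrightarrow> arm grothendieck_proj (\<sigma> s) = Ident CC s"
    using assms by (auto simp: Sect_def)
  have *: "\<sigma> s = mk_mor X Y (xcomp \<sigma>) s \<and> (xsec X s, xsec Y s, mk_nat (fst s) (xcomp \<sigma> s)) \<in> Arr (Fib s)"
    if ss: "is_simplex C s" for s
  proof -
    obtain x y \<beta> S T \<tau> where e: "\<sigma> s = (x, y, (\<beta>, (S, T, \<tau>)))" by (metis prod_cases3 surj_pair)
    have "\<sigma> s \<in> hom EE (obm X s) (obm Y s)"
      using s(1)[unfolded nat_trans_def, THEN conjunct1, rule_format, of s] ss by simp
    then have h: "(x, y, (\<beta>, (S, T, \<tau>))) \<in> Arr EE" "x = (s, xsec X s)" "y = (s, xsec Y s)" "\<beta> = Ident CC s"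
      using e s(3)[OF ss] NX(1)[OF ss] NY(1)[OF ss] unfolding in_hom_iff by auto
    then have "(S, T, \<tau>) \<in> hom (Fib s) (restrict_section (fst s) (\<lambda>i\<in>{0..fst s}. i) (xsec X s)) (xsec Y s)"
      by (simp add: EE_Arr_iff)
    then have ST: "(S, T, \<tau>) \<in> Arr (Fib s)" "S = xsec X s" "T = xsec Y s"
      unfolding restrict_section_id[OF NX(2)[OF ss]] in_hom_iff by auto
    have "xcomp \<sigma> s = (\<lambda>i. snd (\<tau> i))" using e by (simp add: xcomp_def fun_eq_iff)
    then have "\<tau> = mk_nat (fst s) (xcomp \<sigma> s)"
      using Fib_ArrD(3)[of "fst s" "snd s" S T \<tau>] ss ST(1) by simp
    then show ?thesis using e h ST ss by (simp add: mk_mor_def)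
  qed
  show eq: "\<sigma> = mk_mor X Y (xcomp \<sigma>)"
    by (rule extensionalityI[of _ "Ob CC"]) (use s(2) * in \<open>simp_all add: mk_mor_def\<close>)
  show "system_map X Y (xcomp \<sigma>)"
    unfolding system_map_def
  proof (intro conjI allI impI)
    fix s assume "is_simplex C s"
    then show "lifted_map (fst s) (snd s) (xob X s) (xar X s) (xob Y s) (xar Y s) (xcomp \<sigma> s)"
      using * map_in_Fib_iff[OF X Y] by blast
  next
    fix s u a i assume \<alpha>: "(s, u, a) \<in> Arr CC" and i: "i \<le> fst u"
    have "Comp EE (\<sigma> u) (arm X (s, u, a)) = Comp EE (arm Y (s, u, a)) (\<sigma> s)"
      using s(1) \<alpha> unfolding nat_trans_def by force
    then have "Comp EE (mk_mor X Y (xcomp \<sigma>) u) (arm X (s, u, a)) =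
        Comp EE (arm Y (s, u, a)) (mk_mor X Y (xcomp \<sigma>) s)"
      using * Arr_CC(1,2)[OF \<alpha>] by simp
    then show "xcomp \<sigma> u i \<diamondop> xtr X (s, u, a) i = xtr Y (s, u, a) i \<diamondop> xcomp \<sigma> s (a i)"
      using mor_square[OF X Y \<alpha>, of "xcomp \<sigma>"] * i by blast
  qed
qed

lemma SS_Ident_comp:
  assumes X: "X \<in> Ob SS"
  shows "Ident SS X = (X, X, mk_mor X X (\<lambda>s i. Ident D (xob X s i)))"
proof -
  have "Ident EE (obm X s) = ((s, xsec X s), (s, xsec X s), (Ident CC s,
    (xsec X s, xsec X s, mk_nat (fst s) (\<lambda>i. Ident D (xob X s i)))))" if s: "is_simplex C s" for s
    using section_normal(1,2)[OF X s] Fib_Ident[of "xsec X s" "fst s" "snd s"]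
    by (simp add: EE_Ident xob_def)
  then show ?thesis by (simp add: Sect_def mk_mor_def cong: restrict_cong)
qed

lemma SS_Comp_comp:
  assumes "(X, Y, \<sigma>) \<in> Arr SS" "(Y, Z, \<tau>) \<in> Arr SS" and s: "is_simplex C s" "i \<le> fst s"
  shows "xcomp (snd (snd (Comp SS (Y, Z, \<tau>) (X, Y, \<sigma>)))) s i = xcomp \<tau> s i \<diamondop> xcomp \<sigma> s i"
proof -
  note A = SS_ArrD[OF assms(1)] and B = SS_ArrD[OF assms(2)]
  have *: "(xsec X s, xsec Y s, mk_nat (fst s) (xcomp \<sigma> s)) \<in> Arr (Fib s)"
    "(xsec Y s, xsec Z s, mk_nat (fst s) (xcomp \<tau> s)) \<in> Arr (Fib s)"
    using map_in_Fib_iff[OF A(1,2) s(1)] map_in_Fib_iff[OF B(1,2) s(1)] A(4) B(4) s(1)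
    unfolding system_map_def by blast+
  have "mk_nat (fst s) (\<lambda>i. snd (mk_nat (fst s) (xcomp \<sigma> s) ((\<lambda>i\<in>{0..fst s}. i) i))) =
      mk_nat (fst s) (xcomp \<sigma> s)"
    by (rule mk_nat_cong) simp
  then have idt: "arm (ext_trans (Ident CC s)) (xsec X s, xsec Y s, mk_nat (fst s) (xcomp \<sigma> s)) =
    (xsec X s, xsec Y s, mk_nat (fst s) (xcomp \<sigma> s))"
    using restrict_section_id[OF section_normal(2)[OF A(1) s(1)]]
      restrict_section_id[OF section_normal(2)[OF A(2) s(1)]] by simp
  have "Comp EE (\<tau> s) (\<sigma> s) = Comp EE (mk_mor Y Z (xcomp \<tau>) s) (mk_mor X Y (xcomp \<sigma>) s)"
    using A(3) B(3) by simp
  also have "\<dots> = ((s, xsec X s), (s, xsec Z s), (Comp CC (Ident CC s) (Ident CC s),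
    Comp (Fib s) (xsec Y s, xsec Z s, mk_nat (fst s) (xcomp \<tau> s))
      (xsec X s, xsec Y s, mk_nat (fst s) (xcomp \<sigma> s))))"
    using s(1) idt by (simp add: mk_mor_def EE_Comp del: simp_repl_simps(4,5) ext_trans_simps)
  also have "\<dots> = ((s, xsec X s), (s, xsec Z s), (Comp CC (Ident CC s) (Ident CC s),
    (xsec X s, xsec Z s, mk_nat (fst s) (\<lambda>i. snd (mk_nat (fst s) (xcomp \<tau> s) i) \<diamondop>
      snd (mk_nat (fst s) (xcomp \<sigma> s) i)))))"
    using Fib_Comp_s[OF s(1) *] by simp
  finally show ?thesis
    using s by (simp add: Sect_def xcomp_def[of "\<lambda>x\<in>_. _ x"])
qed

end


section \<open>Vertices, edges and triangles\<close>

text \<open>The maps of ordinals that select a vertex and an edge.\<close>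

definition pt :: "nat \<Rightarrow> nat \<Rightarrow> nat" where "pt k = (\<lambda>i \<in> {0..0}. k)"
definition pr :: "nat \<Rightarrow> nat \<Rightarrow> nat \<Rightarrow> nat" where "pr k l = (\<lambda>i \<in> {0..1}. if i = 0 then k else l)"

lemma pt_0 [simp]: "pt k 0 = k" by (simp add: pt_def)
lemma pr_simps [simp]: "pr k l 0 = k" "pr k l (Suc 0) = l" by (simp_all add: pr_def)

lemma ord_mono_pt: "k \<le> n \<Longrightarrow> ord_mono 0 n (pt k)"
  by (auto simp: pt_def mono_on_def)

lemma ord_mono_pr: "k \<le> l \<Longrightarrow> l \<le> n \<Longrightarrow> ord_mono 1 n (pr k l)"
  by (auto simp: pr_def mono_on_def)

definition mk_simplex :: "('o, 'a) cat \<Rightarrow> nat \<Rightarrow> (nat \<Rightarrow> 'o) \<Rightarrow> (nat \<Rightarrow> nat \<Rightarrow> 'a) \<Rightarrow> ('o, 'a) simplex" where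
  "mk_simplex C n x a = (n, \<lparr>obm = restrict x {0..n},
    arm = (\<lambda>z \<in> {(i, j). i \<le> j \<and> j \<le> n}.
      if fst z = snd z then Ident C (x (fst z)) else a (fst z) (snd z))\<rparr>)"

definition vtx :: "('o, 'a) cat \<Rightarrow> 'o \<Rightarrow> ('o, 'a) simplex" where
  "vtx C x = mk_simplex C 0 (\<lambda>_. x) (\<lambda>_ _. Ident C x)"

definition edge :: "('o, 'a) cat \<Rightarrow> 'a \<Rightarrow> ('o, 'a) simplex" where
  "edge C f = mk_simplex C 1 (\<lambda>i. if i = 0 then Dom C f else Cod C f) (\<lambda>_ _. f)"

definition tri :: "('o, 'a) cat \<Rightarrow> 'a \<Rightarrow> 'a \<Rightarrow> ('o, 'a) simplex" where
  "tri C f g = mk_simplex C 2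
    (\<lambda>i. if i = 0 then Dom C f else if i = 1 then Cod C f else Cod C g)
    (\<lambda>i j. if i = 0 then (if j = 1 then f else Comp C g f) else g)"

lemma mk_simplex_simps:
  "i \<le> n \<Longrightarrow> ver (mk_simplex C n x a) i = x i"
  "i \<le> n \<Longrightarrow> edg (mk_simplex C n x a) i i = Ident C (x i)"
  "i < j \<Longrightarrow> j \<le> n \<Longrightarrow> edg (mk_simplex C n x a) i j = a i j"
  by (simp_all add: mk_simplex_def)

lemma simplex_mk_simplex:
  assumes "category C" "\<And>i. i \<le> n \<Longrightarrow> x i \<in> Ob C"
    and a: "\<And>i j. i < j \<Longrightarrow> j \<le> n \<Longrightarrow> a i j \<in> Arr C \<and> Dom C (a i j) = x i \<and> Cod C (a i j) = x j"
    and "\<And>i j k. i < j \<Longrightarrow> j < k \<Longrightarrow> k \<le> n \<Longrightarrow> Comp C (a j k) (a i j) = a i k"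
  shows "is_simplex C (mk_simplex C n x a)"
proof -
  interpret category C by fact
  let ?s = "mk_simplex C n x a"
  have "is_simplex C (n, snd ?s)"
  proof (rule simplexI)
    fix i j assume ij: "i \<le> j" "j \<le> n"
    then consider "i = j" | "i < j" by linarith
    then show "edg ?s i j \<in> Arr C \<and> Dom C (edg ?s i j) = ver ?s i \<and> Cod C (edg ?s i j) = ver ?s j"
      using ij assms(2) a[of i j] by cases (simp_all add: mk_simplex_simps)
  next
    fix i j k assume ijk: "i \<le> j" "j \<le> k" "k \<le> n"
    then consider "i = j" | "j = k" | "i < j \<and> j < k" by linarith
    then show "Comp C (edg ?s j k) (edg ?s i j) = edg ?s i k"
    proof cases
      case 1
      then show ?thesis using ijk a[of j k] assms(2) by (cases "j = k") (simp_all add: mk_simplex_simps)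
    next
      case 2
      then show ?thesis using ijk a[of i j] assms(2) by (cases "i = j") (simp_all add: mk_simplex_simps)
    qed (use ijk assms(4) in \<open>simp add: mk_simplex_simps\<close>)
  qed (use assms(2) in \<open>simp_all add: mk_simplex_simps\<close>, simp_all add: mk_simplex_def)
  then show ?thesis by (simp add: mk_simplex_def)
qed

lemma vtx_simps [simp]:
  "fst (vtx C x) = 0" "ver (vtx C x) 0 = x" "edg (vtx C x) 0 0 = Ident C x"
  by (simp_all add: vtx_def mk_simplex_def)

lemma edge_simps [simp]:
  "fst (edge C f) = 1" "ver (edge C f) 0 = Dom C f" "ver (edge C f) (Suc 0) = Cod C f"
  "edg (edge C f) 0 (Suc 0) = f" "edg (edge C f) 0 0 = Ident C (Dom C f)"
  "edg (edge C f) (Suc 0) (Suc 0) = Ident C (Cod C f)"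
  by (simp_all add: edge_def mk_simplex_def)

lemma tri_simps [simp]:
  "fst (tri C f g) = 2" "ver (tri C f g) 0 = Dom C f" "ver (tri C f g) 2 = Cod C g"
  "edg (tri C f g) 0 (Suc 0) = f" "edg (tri C f g) (Suc 0) 2 = g"
  "edg (tri C f g) 0 2 = Comp C g f"
  by (simp_all add: tri_def mk_simplex_def)

context opfib begin

abbreviation V0 where "V0 s \<equiv> vtx C (ver s 0)"

abbreviation toV where "toV s k \<equiv> (s, vtx C (ver s k), pt k)"

lemma simplex_vtx: "x \<in> Ob C \<Longrightarrow> is_simplex C (vtx C x)"
  unfolding vtx_def by (rule simplex_mk_simplex[OF C]) auto

lemma simplex_edge: "f \<in> Arr C \<Longrightarrow> is_simplex C (edge C f)"
  unfolding edge_def by (rule simplex_mk_simplex[OF C]) auto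

lemma simplex_tri:
  assumes "f \<in> Arr C" "g \<in> Arr C" "Cod C f = Dom C g" shows "is_simplex C (tri C f g)"
  unfolding tri_def
proof (rule simplex_mk_simplex[OF C])
  fix i j :: nat assume "i < j" "j \<le> 2"
  then have "(i = 0 \<and> j = 1) \<or> (i = 0 \<and> j = 2) \<or> (i = 1 \<and> j = 2)" by auto
  then show "(if i = 0 then if j = 1 then f else Comp C g f else g) \<in> Arr C \<and>
    Dom C (if i = 0 then if j = 1 then f else Comp C g f else g) =
      (if i = 0 then Dom C f else if i = 1 then Cod C f else Cod C g) \<and>
    Cod C (if i = 0 then if j = 1 then f else Comp C g f else g) =
      (if j = 0 then Dom C f else if j = 1 then Cod C f else Cod C g)"
    using assms by (elim disjE conjE) simp_all
next
  fix i j k :: nat assume "i < j" "j < k" "k \<le> 2"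
  then have "i = 0" "j = 1" "k = 2" by auto
  then show "Comp C (if j = 0 then if k = 1 then f else Comp C g f else g)
     (if i = 0 then if j = 1 then f else Comp C g f else g) =
    (if i = 0 then if k = 1 then f else Comp C g f else g)" by simp
qed (use assms in auto)

lemma simplex_eqI':
  assumes "is_simplex C s" "is_simplex C t" "fst s = fst t"
    and "\<And>i. i \<le> fst t \<Longrightarrow> ver s i = ver t i"
    and "\<And>i j. i \<le> j \<Longrightarrow> j \<le> fst t \<Longrightarrow> edg s i j = edg t i j"
  shows "s = t"
proof -
  have st: "is_simplex C (fst t, snd s)" "is_simplex C (fst t, snd t)"
    using assms(1,2) by (simp flip: assms(3), simp)
  have "snd s = snd t" by (rule simplex_eqI[OF st]) (use assms(4,5) in simp_all)
  then show ?thesis using assms(3) by (simp add: prod_eq_iff)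
qed

lemma simplex_face_s: "is_simplex C s \<Longrightarrow> ord_mono m (fst s) a \<Longrightarrow> is_simplex C (face s m a)"
  using simplex_face[of C "fst s" "snd s" a m] by simp

lemma to_vtx:
  assumes s: "is_simplex C s" and k: "k \<le> fst s"
  shows "toV s k \<in> Arr CC"
proof -
  note S = simplexD[of C "fst s" "snd s"]
  have "face s 0 (pt k) = vtx C (ver s k)"
    by (rule simplex_eqI')
      (use s k S simplex_face_s[OF s ord_mono_pt[OF k]] simplex_vtx in \<open>simp_all add: face_simps\<close>)
  then show ?thesis using s ord_mono_pt[OF k] by (simp add: simp_repl_Arr_iff)
qed

lemma to_edge:
  assumes s: "is_simplex C s" and kl: "k \<le> l" "l \<le> fst s"
  shows "(s, edge C (edg s k l), pr k l) \<in> Arr CC"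
proof -
  have S: "edg s k l \<in> Arr C" "Dom C (edg s k l) = ver s k"
    "Cod C (edg s k l) = ver s l" "edg s k k = Ident C (ver s k)"
    "edg s l l = Ident C (ver s l)"
    using simplexD[of C "fst s" "snd s"] s kl by simp_all
  have cases: "i = 0 \<or> i = 1" if "i \<le> 1" for i :: nat using that by auto
  have "face s 1 (pr k l) = edge C (edg s k l)"
  proof (rule simplex_eqI')
    show "is_simplex C (face s 1 (pr k l))" by (rule simplex_face_s[OF s ord_mono_pr[OF kl]])
    show "is_simplex C (edge C (edg s k l))" by (rule simplex_edge) (rule S)
  next
    fix i assume "i \<le> fst (edge C (edg s k l))"
    then have "i = 0 \<or> i = 1" using cases by simp
    then show "ver (face s 1 (pr k l)) i = ver (edge C (edg s k l)) i"
      using S by (elim disjE) (simp_all add: face_simps)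
  next
    fix i j assume "i \<le> j" "j \<le> fst (edge C (edg s k l))"
    then have "(i = 0 \<and> j = 0) \<or> (i = 0 \<and> j = 1) \<or> (i = 1 \<and> j = 1)" by auto
    then show "edg (face s 1 (pr k l)) i j = edg (edge C (edg s k l)) i j"
      using S by (elim disjE conjE) (simp_all add: face_simps)
  qed (simp add: face_simps)
  then show ?thesis using s ord_mono_pr[OF kl] by (simp add: simp_repl_Arr_iff)
qed

lemma Arr_CC_ob: "(s, u, a) \<in> Arr CC \<Longrightarrow> i \<le> fst u \<Longrightarrow> ver u i = ver s (a i)"
  using Arr_CC(4)[of s u a] face_simps(2)[of i "fst u" s a] by simp

lemma Arr_CC_arm:
  "(s, u, a) \<in> Arr CC \<Longrightarrow> i \<le> j \<Longrightarrow> j \<le> fst u \<Longrightarrow> edg u i j = edg s (a i) (a j)"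
  using Arr_CC(4)[of s u a] face_simps(3)[of i j "fst u" s a] by simp

lemma comp_pt: "(\<lambda>i \<in> {0..0}. a (pt k i)) = pt (a k)"
  by (auto simp: pt_def fun_eq_iff)

section \<open>The section of a cartesian section of the simplicial extension\<close>

definition unvert where "unvert d = (SOME u. vertical u \<and> vert u = d)"
definition uncart where "uncart d = (SOME v. opcart v \<and> cart v = d)"

lemma unvert_vert [simp]: "vertical u \<Longrightarrow> unvert (vert u) = u"
  unfolding unvert_def by (rule some_equality) (simp, blast intro: vert_inj)

lemma uncart_cart [simp]: "opcart v \<Longrightarrow> uncart (cart v) = v"
  unfolding uncart_def by (rule some_equality) (simp, blast intro: cart_inj)

lemma unvert:
  assumes "d \<in> Arr D" "arm q d = Ident C (obm p (Dom D d))"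
  shows "vertical (unvert d)" "vert (unvert d) = d" "Dom E (unvert d) = Dom D d" "Cod E (unvert d) = Cod D d"
proof -
  obtain u where u: "vertical u" "d = vert u" "Dom E u = Dom D d" "Cod E u = Cod D d"
    by (rule D_over_identity[OF assms])
  have eq: "unvert d = u" unfolding u(2) by (rule unvert_vert[OF u(1)])
  show "vertical (unvert d)" "vert (unvert d) = d" "Dom E (unvert d) = Dom D d"
    "Cod E (unvert d) = Cod D d" unfolding eq using u(1,3,4) u(2)[symmetric] by blast+
qed

lemma uncart:
  assumes "is_cart d"
  shows "opcart (uncart d)" "cart (uncart d) = d" "Dom E (uncart d) = Cod D d" "Cod E (uncart d) = Dom D d"
    "arm p (uncart d) = arm q d"
proof -
  obtain v where v: "opcart v" "d = cart v" using assms by (auto simp: is_cart_def)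
  then have "uncart d = v" by simp
  then show "opcart (uncart d)" "cart (uncart d) = d" "Dom E (uncart d) = Cod D d"
    "Cod E (uncart d) = Dom D d" "arm p (uncart d) = arm q d" using v by simp_all
qed

text \<open>Comparing the representatives \<open>(id, v)\<close> and \<open>(u, id)\<close> gives an isomorphism that equals \<open>u\<close> and inverts
  \<open>v\<close>.\<close>

lemma cart_eq_vert:
  assumes "cart v = vert u" "opcart v" "vertical u" shows "u \<cdot> v = Ident E (Dom E v)"
proof -
  have d: "Cod E v = Dom E u" "Dom E v = Cod E u"
    using arg_cong[OF assms(1), of "Dom D"] arg_cong[OF assms(1), of "Cod D"] assms(2,3) by simp_all
  have l: "legs u (Ident E (Cod E u))" using assms(3) by simp
  from tmor_eqE[OF assms(1)[unfolded cart_def vert_def] l] obtain w where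
    w: "w \<in> Arr E" "Dom E w = Cod E v" "w \<cdot> Ident E (Cod E v) = u" "w \<cdot> v = Ident E (Cod E u)" by metis
  then have "w = u" by simp
  then show ?thesis using w(4) d(2) by simp
qed

definition cart_sec where
  "cart_sec X \<longleftrightarrow> X \<in> Ob SS \<and> (\<forall>\<alpha>. segal C \<alpha> \<longrightarrow> cartesian_at E C p X \<alpha>)"

lemma cartesian_at_section:
  assumes X: "X \<in> Ob SS" and \<alpha>: "(s, u, a) \<in> Arr CC" and mn: "fst u \<le> fst s"
    and seg: "\<And>i. i \<le> fst u \<Longrightarrow> a i = i"
  shows "cartesian_at E C p X (s, u, a) \<longleftrightarrow>
    (\<forall>i\<le>fst s. is_cart (xtr X (s, u, a) (min i (fst u)) \<diamondop> xar X s (min i (fst u)) i))"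
proof -
  note A = Arr_CC[OF \<alpha>] and N = section_normal[OF X]
  have "cartesian_at E C p X ((fst s, snd s), (fst u, snd u), a) \<longleftrightarrow>
    (\<forall>i\<le>fst s. is_cart (snd (mk_nat (fst u) (xtr X (s, u, a)) (min i (fst u))) \<diamondop>
      sar (xsec X s) (min i (fst u)) i))"
    by (rule cartesian_at_iff[where T = "xsec X u"])
      (use A N(2)[OF A(1)] N(4)[OF \<alpha>] N(3)[OF \<alpha>] seg mn in \<open>simp_all add: xsec_def\<close>)
  then show ?thesis by (simp add: xar_def)
qed

lemma segal_iff:
  "segal C (s, u, a) \<longleftrightarrow> (s, u, a) \<in> Arr CC \<and> (\<forall>i\<le>fst u. a i = i)"
  by (cases s; cases u) (auto simp: segal_def)

text \<open>For a cartesian section \<open>X\<close>, \<open>opc X s i\<close> is the opcartesian arrow from the value at the first vertex of \<open>s\<close>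
  to the value of \<open>X s\<close> at \<open>i\<close>, and \<open>vtr X \<alpha> i\<close> is the vertical arrow of \<open>E\<close> that \<open>X\<close> assigns to the map \<open>\<alpha>\<close> of
  simplices. They are read off from the transpose by inverting \<open>cart\<close> and \<open>vert\<close>. The section
  \<open>base_section X\<close> of \<open>E\<close> is the value at vertices, and it acts on \<open>f\<close> through the edge \<open>f\<close>.\<close>

definition opc where "opc X s i = uncart (xtr X (toV s 0) 0 \<diamondop> xar X s 0 i)"
definition vtr where "vtr X \<alpha> i = unvert (xtr X \<alpha> i)"
definition base_ob where "base_ob X x = xob X (vtx C x) 0"
definition base_arr where "base_arr X f = vtr X (edge C f, vtx C (Cod C f), pt 1) 0 \<cdot> opc X (edge C f) 1"
definition base_section where "base_section X = \<lparr>obm = (\<lambda>x \<in> Ob C. base_ob X x), arm = (\<lambda>f \<in> Arr C. base_arr X f)\<rparr>"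

context
  fixes X assumes X: "cart_sec X"
begin

lemma X_Ob: "X \<in> Ob SS" using X by (simp add: cart_sec_def)

lemmas sys = system_of_section[OF X_Ob]

lemma xl: "is_simplex C s \<Longrightarrow> lifted (fst s) (snd s) (xob X s) (xar X s)" by (rule systemD(1)[OF sys])

lemma vtr:
  assumes \<alpha>: "(s, u, a) \<in> Arr CC" and i: "i \<le> fst u"
  shows "vertical (vtr X (s, u, a) i)" "vert (vtr X (s, u, a) i) = xtr X (s, u, a) i"
    "Dom E (vtr X (s, u, a) i) = xob X s (a i)" "Cod E (vtr X (s, u, a) i) = xob X u i"
proof -
  note A = Arr_CC[OF \<alpha>] and M = lifted_mapD[OF systemD(2)[OF sys \<alpha>]]
  have "obm p (xob X s (a i)) = ver u i"
    using liftedD(2)[OF xl[OF A(1)] ord_monoD(1)[OF A(3) i]] Arr_CC_ob[OF \<alpha> i] by simp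
  then have "arm q (xtr X (s, u, a) i) = Ident C (obm p (Dom D (xtr X (s, u, a) i)))"
    using M(2,4)[OF i] by simp
  from unvert[OF M(1)[OF i] this] M(2,3)[OF i]
  show "vertical (vtr X (s, u, a) i)" "vert (vtr X (s, u, a) i) = xtr X (s, u, a) i"
    "Dom E (vtr X (s, u, a) i) = xob X s (a i)" "Cod E (vtr X (s, u, a) i) = xob X u i"
    unfolding vtr_def by simp_all
qed

lemma vtr_comp:
  assumes \<alpha>: "(s, u, a) \<in> Arr CC" and \<beta>: "(u, v, b) \<in> Arr CC" and i: "i \<le> fst v"
  shows "vtr X (s, v, \<lambda>i \<in> {0..fst v}. a (b i)) i = vtr X (u, v, b) i \<cdot> vtr X (s, u, a) (b i)"
proof -
  have c: "(s, v, \<lambda>i \<in> {0..fst v}. a (b i)) \<in> Arr CC"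
    using category.Comp_simps(1)[OF category_simp_repl \<alpha> \<beta>] by simp
  have bi: "b i \<le> fst u" using ord_monoD(1)[OF Arr_CC(3)[OF \<beta>] i] .
  note 1 = vtr[OF \<alpha> bi] and 2 = vtr[OF \<beta> i] and 3 = vtr[OF c i]
  have "vert (vtr X (s, v, \<lambda>i \<in> {0..fst v}. a (b i)) i) = vert (vtr X (u, v, b) i \<cdot> vtr X (s, u, a) (b i))"
    using systemD(4)[OF sys \<alpha> \<beta> i] vert_comp[OF 1(1) 2(1)] 1(2-4) 2(2-4) 3(2) by simp
  moreover have "vertical (vtr X (u, v, b) i \<cdot> vtr X (s, u, a) (b i))"
    using vertical_comp[OF 1(1) 2(1)] 1 2 by simp
  ultimately show ?thesis using 3(1) by (intro vert_inj) auto
qed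

lemma vtr_pt_comp:
  assumes \<alpha>: "(s, u, a) \<in> Arr CC" and k: "k \<le> fst u"
  shows "vtr X (s, vtx C (ver u k), pt (a k)) 0 = vtr X (toV u k) 0 \<cdot> vtr X (s, u, a) k"
  using vtr_comp[OF \<alpha> to_vtx[OF Arr_CC(2)[OF \<alpha>] k], of 0] comp_pt[of a k] by simp

text \<open>The cartesian condition for the Segal map from \<open>s\<close> to its first vertex.\<close>

lemma opc:
  assumes s: "is_simplex C s" and i: "i \<le> fst s"
  shows "opcart (opc X s i)" "cart (opc X s i) = vert (vtr X (toV s 0) 0) \<diamondop> xar X s 0 i"
    "Dom E (opc X s i) = base_ob X (ver s 0)" "Cod E (opc X s i) = xob X s i"
    "arm p (opc X s i) = edg s 0 i"
proof -
  note L = liftedD[OF xl[OF s]]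
  have \<beta>: "toV s 0 \<in> Arr CC" by (rule to_vtx[OF s]) simp
  note M = lifted_mapD[OF systemD(2)[OF sys \<beta>], of 0]
  have "cartesian_at E C p X (toV s 0)"
  proof -
    have "segal C (toV s 0)" unfolding segal_iff using \<beta> by simp
    then show ?thesis using X unfolding cart_sec_def by blast
  qed
  then have c: "is_cart (xtr X (toV s 0) 0 \<diamondop> xar X s 0 i)"
    using cartesian_at_section[OF X_Ob \<beta>] i by simp
  note U = uncart[OF c]
  have sC: "edg s 0 i \<in> Arr C" "Dom C (edg s 0 i) = ver s 0"
    using simplexD[of C "fst s" "snd s"] s i by simp_all
  show "opcart (opc X s i)" "cart (opc X s i) = vert (vtr X (toV s 0) 0) \<diamondop> xar X s 0 i"
    using U(1,2) vtr(2)[OF \<beta>, of 0] by (simp_all add: opc_def)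
  show "Dom E (opc X s i) = base_ob X (ver s 0)" "Cod E (opc X s i) = xob X s i"
    "arm p (opc X s i) = edg s 0 i"
    using U(3-5) M(1-4) L(4-7)[of 0 i] i sC by (simp_all add: opc_def base_ob_def)
qed

lemma vtr_opc_0:
  assumes s: "is_simplex C s"
  shows "vtr X (toV s 0) 0 \<cdot> opc X s 0 = Ident E (base_ob X (ver s 0))"
proof -
  have \<beta>: "toV s 0 \<in> Arr CC" by (rule to_vtx[OF s]) simp
  note t = vtr[OF \<beta>, of 0] and v = opc[OF s, of 0] and L = liftedD[OF xl[OF s], of 0]
  have "cart (opc X s 0) = vert (vtr X (toV s 0) 0)"
    using v(2) L t(1,3,4) D.Ident_right[of "vert (vtr X (toV s 0) 0)" "xob X s 0"] by simp
  from cart_eq_vert[OF this] v t show ?thesis by simp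
qed

text \<open>The projection of a vertex to its first vertex is an identity of the simplicial replacement.\<close>

lemma opc_vtx:
  assumes x: "x \<in> Ob C" shows "opc X (vtx C x) 0 = Ident E (base_ob X x)"
proof -
  note s = simplex_vtx[OF x]
  have \<beta>: "(vtx C x, vtx C x, pt 0) \<in> Arr CC" using to_vtx[OF s, of 0] by simp
  have o: "base_ob X x \<in> Ob E" using liftedD(1)[OF xl[OF s], of 0] by (simp add: base_ob_def)
  have "Ident CC (vtx C x) = (vtx C x, vtx C x, pt 0)" by (simp add: pt_def fun_eq_iff)
  then have "xtr X (vtx C x, vtx C x, pt 0) 0 = Ident D (base_ob X x)"
    using systemD(3)[OF sys s, of 0] by (simp add: base_ob_def)
  then have "vert (vtr X (vtx C x, vtx C x, pt 0) 0) = vert (Ident E (base_ob X x))"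
    using vtr(2)[OF \<beta>, of 0] o by (simp add: vert_Ident)
  then have "vtr X (vtx C x, vtx C x, pt 0) 0 = Ident E (base_ob X x)"
    using vtr(1)[OF \<beta>, of 0] o by (intro vert_inj) auto
  then show ?thesis using vtr_opc_0[OF s] opc(1,4)[OF s, of 0] by (simp add: base_ob_def)
qed

definition opc_step where "opc_step s i j = uncart (xar X s i j)"

text \<open>The structure arrows of a cartesian section are cartesian by cancellation, since their composites with
  the cartesian arrows to the first vertex are cartesian.\<close>

lemma opc_step:
  assumes s: "is_simplex C s" and ij: "i \<le> j" "j \<le> fst s"
  shows "opcart (opc_step s i j)" "cart (opc_step s i j) = xar X s i j" "Dom E (opc_step s i j) = xob X s i"
    "Cod E (opc_step s i j) = xob X s j" "opc_step s i j \<cdot> opc X s i = opc X s j" "arm p (opc_step s i j) = edg s i j"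
proof -
  note L = liftedD[OF xl[OF s]]
  have i: "i \<le> fst s" using ij by simp
  note vi = opc[OF s i] and vj = opc[OF s ij(2)]
  have \<beta>: "toV s 0 \<in> Arr CC" by (rule to_vtx[OF s]) simp
  note t = vtr[OF \<beta>, of 0]
  have eq: "cart (opc X s i) \<diamondop> xar X s i j = cart (opc X s j)"
    using vi(2) vj(2) t(1,3,4) L(4-8) ij i by (simp add: D.assoc)
  have "is_cart (xar X s i j)"
    by (rule is_cart_right[of "cart (opc X s i)"]) (use eq vi(1,3,4) vj(1,3,4) L ij in simp_all)
  note U = uncart[OF this]
  show w: "opcart (opc_step s i j)" "cart (opc_step s i j) = xar X s i j" "Dom E (opc_step s i j) = xob X s i"
    "Cod E (opc_step s i j) = xob X s j" "arm p (opc_step s i j) = edg s i j"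
    unfolding opc_step_def using U L(4-7)[OF ij] by simp_all
  have "cart (opc_step s i j \<cdot> opc X s i) = cart (opc X s j)"
    using cart_comp[of "opc_step s i j" "opc X s i"] w vi(1,3,4) eq by simp
  then show "opc_step s i j \<cdot> opc X s i = opc X s j"
    by (rule cart_inj) (use w(1,3,4) vi(1,3,4) vj(1) in \<open>simp_all add: opcart_comp\<close>)
qed

text \<open>Evaluate the naturality square of \<open>X\<close> at \<open>0 \<le> i\<close>, compose it with the projection of \<open>u\<close> to its first
  vertex, and translate the resulting equation of the transpose by \<open>interchange\<close>.\<close>

lemma vtr_opc_aux:
  assumes \<alpha>: "(s, u, a) \<in> Arr CC" and i: "i \<le> fst u"
  shows "vtr X (s, u, a) i \<cdot> opc X s (a i) =
    opc X u i \<cdot> vtr X (toV s (a 0)) 0 \<cdot> opc X s (a 0)"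
proof -
  let ?b = "(u, vtx C (ver s (a 0)), pt 0)"
  note A = Arr_CC[OF \<alpha>]
  have a: "a 0 \<le> a i" "a i \<le> fst s" "a 0 \<le> fst s" using ord_monoD(2)[OF A(3), of 0 i] ord_monoD(1)[OF A(3) i] i by auto
  have u0: "ver u 0 = ver s (a 0)" using Arr_CC_ob[OF \<alpha>, of 0] by simp
  have \<epsilon>: "toV s (a 0) \<in> Arr CC" by (rule to_vtx[OF A(1) a(3)])
  have \<beta>: "?b \<in> Arr CC" using to_vtx[OF A(2), of 0] u0 by simp
  note t = vtr[OF \<alpha> i] and t0 = vtr[OF \<alpha>, of 0] and te = vtr[OF \<epsilon>, of 0] and tb = vtr[OF \<beta>, of 0]
  note w = opc_step[OF A(1) a(1,2)] and v = opc[OF A(2) i] and vs = opc[OF A(1) a(3)]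
  note Ls = liftedD[OF xl[OF A(1)]] and Lu = liftedD[OF xl[OF A(2)]]
  have te_eq: "vtr X (toV s (a 0)) 0 =
      vtr X ?b 0 \<cdot> vtr X (s, u, a) 0"
    using vtr_pt_comp[OF \<alpha>, of 0] u0 by simp
  have "vert (vtr X (toV s (a 0)) 0) \<diamondop> cart (opc_step s (a 0) (a i))
      = (vert (vtr X ?b 0) \<diamondop> xtr X (s, u, a) 0) \<diamondop> xar X s (a 0) (a i)"
    unfolding te_eq w(2) t0(2)[OF le0, symmetric]
    by (subst vert_comp) (use t0 tb in simp_all)
  also have "\<dots> = vert (vtr X ?b 0) \<diamondop> (xtr X (s, u, a) 0 \<diamondop> xar X s (a 0) (a i))"
    using lifted_mapD(1-3)[OF systemD(2)[OF sys \<alpha>], of 0] tb(1,3,4) Ls(4-6)[OF a(1,2)]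
    by (simp add: D.assoc)
  also have "\<dots> = vert (vtr X ?b 0) \<diamondop> (xar X u 0 i \<diamondop> xtr X (s, u, a) i)"
    using lifted_mapD(5)[OF systemD(2)[OF sys \<alpha>], of 0 i] i by simp
  also have "\<dots> = (vert (vtr X ?b 0) \<diamondop> xar X u 0 i) \<diamondop> xtr X (s, u, a) i"
    using lifted_mapD(1-3)[OF systemD(2)[OF sys \<alpha>], of i] tb(1,3,4) Lu(4-6)[of 0 i] i
    by (simp add: D.assoc)
  also have "\<dots> = cart (opc X u i) \<diamondop> vert (vtr X (s, u, a) i)"
    using v(2) t(2) u0 by simp
  finally have *: "vert (vtr X (toV s (a 0)) 0) \<diamondop> cart (opc_step s (a 0) (a i))
      = cart (opc X u i) \<diamondop> vert (vtr X (s, u, a) i)" .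
  have ends: "Dom E (vtr X (toV s (a 0)) 0) = Dom E (opc_step s (a 0) (a i))"
    "Cod E (vtr X (toV s (a 0)) 0) = Dom E (opc X u i)"
    "Dom E (vtr X (s, u, a) i) = Cod E (opc_step s (a 0) (a i))" "Cod E (vtr X (s, u, a) i) = Cod E (opc X u i)"
    using te t w v u0 by (simp_all add: base_ob_def)
  have sq: "vtr X (s, u, a) i \<cdot> opc_step s (a 0) (a i) = opc X u i \<cdot> vtr X (toV s (a 0)) 0"
    using interchange[OF w(1) v(1) te(1) t(1) ends] * by simp
  have "vtr X (s, u, a) i \<cdot> opc X s (a i) = (vtr X (s, u, a) i \<cdot> opc_step s (a 0) (a i)) \<cdot> opc X s (a 0)"
    using w t(1) vs ends(3) by (simp add: E.assoc)
  also have "\<dots> = (opc X u i \<cdot> vtr X (toV s (a 0)) 0) \<cdot> opc X s (a 0)"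
    by (simp only: sq)
  also have "\<dots> = opc X u i \<cdot> vtr X (toV s (a 0)) 0 \<cdot> opc X s (a 0)"
    using te(1,3) v(1) vs(1,4) ends(2) by (simp add: E.assoc)
  finally show ?thesis .
qed

text \<open>The case of a general simplex reduces to the edge from its first vertex to its \<open>k\<close>-th one.\<close>

lemma vtr_opc_vtx:
  assumes s: "is_simplex C s" and k: "k \<le> fst s"
  shows "vtr X (toV s k) 0 \<cdot> opc X s k = base_arr X (edg s 0 k)"
proof -
  let ?f = "edg s 0 k"
  have f: "?f \<in> Arr C" "Dom C ?f = ver s 0" "Cod C ?f = ver s k"
    using simplexD[of C "fst s" "snd s"] s k by simp_all
  have \<gamma>: "(s, edge C ?f, pr 0 k) \<in> Arr CC" by (rule to_edge[OF s _ k]) simp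
  have \<delta>: "(edge C ?f, vtx C (Cod C ?f), pt 1) \<in> Arr CC"
    using to_vtx[OF simplex_edge[OF f(1)], of 1] by simp
  note v = opc[OF simplex_edge[OF f(1)], of 1] and vk = opc[OF s k]
  note tg = vtr[OF \<gamma>, of 1] and td = vtr[OF \<delta>, of 0]
  have "vtr X (s, edge C ?f, pr 0 k) 1 \<cdot> opc X s k = opc X (edge C ?f) 1"
    using vtr_opc_aux[OF \<gamma>, of 1] vtr_opc_0[OF s] v f by simp
  then have "base_arr X ?f = vtr X (edge C ?f, vtx C (Cod C ?f), pt 1) 0 \<cdot> vtr X (s, edge C ?f, pr 0 k) 1 \<cdot> opc X s k"
    by (simp add: base_arr_def)
  also have "\<dots> = (vtr X (edge C ?f, vtx C (Cod C ?f), pt 1) 0 \<cdot> vtr X (s, edge C ?f, pr 0 k) 1) \<cdot> opc X s k"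
    using tg td vk by (simp add: E.assoc)
  also have "\<dots> = vtr X (toV s k) 0 \<cdot> opc X s k"
    using vtr_pt_comp[OF \<gamma>, of 1] f by simp
  finally show ?thesis by simp
qed

text \<open>The key identity: it expresses the vertical actions of a cartesian section through the section
  \<open>base_section X\<close>.\<close>

lemma vtr_opc:
  assumes \<alpha>: "(s, u, a) \<in> Arr CC" and i: "i \<le> fst u"
  shows "vtr X (s, u, a) i \<cdot> opc X s (a i) = opc X u i \<cdot> base_arr X (edg s 0 (a 0))"
  using vtr_opc_aux[OF \<alpha> i] vtr_opc_vtx[OF Arr_CC(1)[OF \<alpha>], of "a 0"] ord_monoD(1)[OF Arr_CC(3)[OF \<alpha>], of 0]
  by simp

lemma base_ob: "x \<in> Ob C \<Longrightarrow> base_ob X x \<in> Ob E" "x \<in> Ob C \<Longrightarrow> obm p (base_ob X x) = x"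
  using liftedD(1,2)[OF xl[OF simplex_vtx], of x 0] by (simp_all add: base_ob_def)

lemma base_arr:
  assumes f: "f \<in> Arr C"
  shows "base_arr X f \<in> Arr E" "Dom E (base_arr X f) = base_ob X (Dom C f)" "Cod E (base_arr X f) = base_ob X (Cod C f)"
    "arm p (base_arr X f) = f"
proof -
  have \<delta>: "(edge C f, vtx C (Cod C f), pt 1) \<in> Arr CC"
    using to_vtx[OF simplex_edge[OF f], of 1] by simp
  note v = opc[OF simplex_edge[OF f], of 1] and t = vtr[OF \<delta>, of 0]
  have o: "obm p (xob X (edge C f) 1) = Cod C f"
    using liftedD(2)[OF xl[OF simplex_edge[OF f]], of 1] by simp
  show "base_arr X f \<in> Arr E" "Dom E (base_arr X f) = base_ob X (Dom C f)" "Cod E (base_arr X f) = base_ob X (Cod C f)"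
    "arm p (base_arr X f) = f"
    using v t o f by (simp_all add: base_arr_def base_ob_def)
qed

lemma base_arr_Ident:
  assumes x: "x \<in> Ob C" shows "base_arr X (Ident C x) = Ident E (base_ob X x)"
  using vtr_opc_vtx[OF simplex_vtx[OF x], of 0] vtr_opc_0[OF simplex_vtx[OF x]] by simp

text \<open>Compute the action on the last vertex of the triangle through its last edge.\<close>

lemma base_arr_Comp:
  assumes fg: "f \<in> Arr C" "g \<in> Arr C" "Cod C f = Dom C g"
  shows "base_arr X (Comp C g f) = base_arr X g \<cdot> base_arr X f"
proof -
  let ?s = "tri C f g" and ?e = "edge C g"
  note s = simplex_tri[OF fg]
  have \<alpha>: "(?s, ?e, pr 1 2) \<in> Arr CC" using to_edge[OF s, of 1 2] by simp
  have \<delta>: "(?e, vtx C (Cod C g), pt 1) \<in> Arr CC"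
    using to_vtx[OF simplex_edge[OF fg(2)], of 1] by simp
  note v = opc[OF simplex_edge[OF fg(2)], of 1] and vs = opc[OF s, of 2] and tg = vtr[OF \<alpha>, of 1] and td = vtr[OF \<delta>, of 0]
  have "base_arr X (Comp C g f) = vtr X (?s, vtx C (Cod C g), pt 2) 0 \<cdot> opc X ?s 2"
    using vtr_opc_vtx[OF s, of 2] by simp
  also have "vtr X (?s, vtx C (Cod C g), pt 2) 0 = vtr X (?e, vtx C (Cod C g), pt 1) 0 \<cdot> vtr X (?s, ?e, pr 1 2) 1"
    using vtr_pt_comp[OF \<alpha>, of 1] by simp
  also have "(\<dots>) \<cdot> opc X ?s 2 = vtr X (?e, vtx C (Cod C g), pt 1) 0 \<cdot> vtr X (?s, ?e, pr 1 2) 1 \<cdot> opc X ?s 2"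
    using tg td vs by (simp add: E.assoc)
  also have "vtr X (?s, ?e, pr 1 2) 1 \<cdot> opc X ?s 2 = opc X ?e 1 \<cdot> base_arr X f"
    using vtr_opc[OF \<alpha>, of 1] by simp
  also have "vtr X (?e, vtx C (Cod C g), pt 1) 0 \<cdot> opc X ?e 1 \<cdot> base_arr X f = base_arr X g \<cdot> base_arr X f"
    using td v base_arr[OF fg(1)] fg by (simp add: E.assoc base_arr_def[of X g])
  finally show ?thesis .
qed

lemma base_section_in_Sect: "base_section X \<in> Ob (Sect C E p)"
proof -
  have "is_functor C E (base_section X)"
    by (rule is_functorI) (simp_all add: base_section_def base_ob base_arr base_arr_Ident base_arr_Comp)
  moreover have "ext_functor C (base_section X)" by (simp add: ext_functor_def base_section_def)
  ultimately show ?thesis by (simp add: Sect_def is_section_def) (simp add: base_section_def base_ob base_arr)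
qed

end

end


section \<open>Maps of cartesian sections\<close>

context opfib begin

lemma system_map_unvert:
  assumes X: "X \<in> Ob SS" and h: "system_map X Y h" and s: "is_simplex C s" and i: "i \<le> fst s"
  shows "vertical (unvert (h s i))" "vert (unvert (h s i)) = h s i"
    "Dom E (unvert (h s i)) = xob X s i" "Cod E (unvert (h s i)) = xob Y s i"
proof -
  have "lifted_map (fst s) (snd s) (xob X s) (xar X s) (xob Y s) (xar Y s) (h s)"
    using h s unfolding system_map_def by blast
  note M = lifted_mapD[OF this]
  have "obm p (xob X s i) = ver s i"
    using liftedD(2)[OF systemD(1)[OF system_of_section[OF X] s] i] .
  then have "arm q (h s i) = Ident C (obm p (Dom D (h s i)))" using M(2,4)[OF i] by simp
  from unvert[OF M(1)[OF i] this] M(2,3)[OF i]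
  show "vertical (unvert (h s i))" "vert (unvert (h s i)) = h s i"
    "Dom E (unvert (h s i)) = xob X s i" "Cod E (unvert (h s i)) = xob Y s i" by simp_all
qed

lemma system_map_vtr:
  assumes X: "cart_sec X" and Y: "cart_sec Y" and h: "system_map X Y h"
    and \<alpha>: "(s, u, a) \<in> Arr CC" and i: "i \<le> fst u"
  shows "unvert (h u i) \<cdot> vtr X (s, u, a) i = vtr Y (s, u, a) i \<cdot> unvert (h s (a i))"
proof -
  note A = Arr_CC[OF \<alpha>]
  have ai: "a i \<le> fst s" by (rule ord_monoD(1)[OF A(3) i])
  note U = system_map_unvert[OF X_Ob[OF X] h A(2) i] and S = system_map_unvert[OF X_Ob[OF X] h A(1) ai]
  note tX = vtr[OF X \<alpha> i] and tY = vtr[OF Y \<alpha> i]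
  have eq: "h u i \<diamondop> xtr X (s, u, a) i = xtr Y (s, u, a) i \<diamondop> h s (a i)"
    using h \<alpha> i unfolding system_map_def by blast
  have "vert (unvert (h u i) \<cdot> vtr X (s, u, a) i) = vert (vtr Y (s, u, a) i \<cdot> unvert (h s (a i)))"
    using vert_comp[OF tX(1) U(1)] vert_comp[OF S(1) tY(1)] U(2-4) S(2-4) tX(2-4) tY(2-4) eq by simp
  then show ?thesis
    by (rule vert_inj)
      (use vertical_comp[OF tX(1) U(1)] vertical_comp[OF S(1) tY(1)] U(1,3,4) S(1,3,4) tX(1,3,4) tY(1,3,4) in simp_all)
qed

text \<open>A map of sections commutes with the arrows of the transpose that define \<open>opc\<close>.\<close>

lemma system_map_opc:
  assumes X: "cart_sec X" and Y: "cart_sec Y" and h: "system_map X Y h"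
    and s: "is_simplex C s" and i: "i \<le> fst s"
  shows "unvert (h s i) \<cdot> opc X s i = opc Y s i \<cdot> unvert (h (V0 s) 0)"
proof -
  have \<beta>: "toV s 0 \<in> Arr CC" by (rule to_vtx[OF s]) simp
  note A = Arr_CC[OF \<beta>]
  note U = system_map_unvert[OF X_Ob[OF X] h s i] and U0 = system_map_unvert[OF X_Ob[OF X] h A(2), of 0]
  note vX = opc[OF X s i] and vY = opc[OF Y s i] and tX = vtr[OF X \<beta>, of 0] and tY = vtr[OF Y \<beta>, of 0]
  note LX = liftedD(4-6)[OF xl[OF X s], of 0 i] and LY = liftedD(4-6)[OF xl[OF Y s], of 0 i]
  have "lifted_map (fst s) (snd s) (xob X s) (xar X s) (xob Y s) (xar Y s) (h s)"
    using h s unfolding system_map_def by blast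
  note M = lifted_mapD[OF this]
  have eq: "h (V0 s) 0 \<diamondop> xtr X (toV s 0) 0 = xtr Y (toV s 0) 0 \<diamondop> h s 0"
    using h \<beta> unfolding system_map_def by (metis pt_0 zero_le)
  have xX: "xtr X (toV s 0) 0 \<in> Arr D" "Dom D (xtr X (toV s 0) 0) = xob X s 0"
    "Cod D (xtr X (toV s 0) 0) = xob X (V0 s) 0"
    using lifted_mapD(1-3)[OF systemD(2)[OF system_of_section[OF X_Ob[OF X]] \<beta>], of 0] by simp_all
  have xY: "xtr Y (toV s 0) 0 \<in> Arr D" "Dom D (xtr Y (toV s 0) 0) = xob Y s 0"
    using lifted_mapD(1,2)[OF systemD(2)[OF system_of_section[OF X_Ob[OF Y]] \<beta>], of 0] by simp_all
  have h0: "h (V0 s) 0 \<in> Arr D" "Dom D (h (V0 s) 0) = xob X (V0 s) 0"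
    using U0 vert_simps[OF U0(1)] by simp_all
  have "vert (unvert (h (V0 s) 0)) \<diamondop> cart (opc X s i)
      = (h (V0 s) 0 \<diamondop> xtr X (toV s 0) 0) \<diamondop> xar X s 0 i"
    using U0(2) vX(2) tX(2) xX h0 LX i by (simp add: D.assoc)
  also have "\<dots> = xtr Y (toV s 0) 0 \<diamondop> (h s 0 \<diamondop> xar X s 0 i)"
    using eq xY M(1-3)[of 0] LX i by (simp add: D.assoc)
  also have "\<dots> = (xtr Y (toV s 0) 0 \<diamondop> xar Y s 0 i) \<diamondop> h s i"
    using M(5)[of 0 i] M(1-3)[of i] xY LY i by (simp add: D.assoc)
  also have "\<dots> = cart (opc Y s i) \<diamondop> vert (unvert (h s i))"
    using U(2) vY(2) tY(2) by simp
  finally have *: "vert (unvert (h (V0 s) 0)) \<diamondop> cart (opc X s i) = cart (opc Y s i) \<diamondop> vert (unvert (h s i))" .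
  have ends: "Dom E (unvert (h (V0 s) 0)) = Dom E (opc X s i)" "Cod E (unvert (h (V0 s) 0)) = Dom E (opc Y s i)"
    "Dom E (unvert (h s i)) = Cod E (opc X s i)" "Cod E (unvert (h s i)) = Cod E (opc Y s i)"
    using U(3,4) U0(3,4) vX(3,4) vY(3,4) by (simp_all add: base_ob_def)
  show ?thesis using interchange[OF vX(1) vY(1) U0(1) U(1) ends] * by simp
qed

definition base_map where
  "base_map f = (case f of (X, Y, \<sigma>) \<Rightarrow> (base_section X, base_section Y, \<lambda>x \<in> Ob C. unvert (xcomp \<sigma> (vtx C x) 0)))"

abbreviation SC where "SC \<equiv> Sect C E p"

lemma SC_simps [simp]: "Dom SC (X, Y, \<sigma>) = X" "Cod SC (X, Y, \<sigma>) = Y"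
  by (simp_all add: Sect_def)

lemma base_section_simps [simp]: "x \<in> Ob C \<Longrightarrow> obm (base_section X) x = base_ob X x" "f \<in> Arr C \<Longrightarrow> arm (base_section X) f = base_arr X f"
  by (simp_all add: base_section_def)

lemma SC_Arr_iff:
  assumes X: "cart_sec X" and Y: "cart_sec Y"
  shows "(base_section X, base_section Y, \<rho>) \<in> Arr SC \<longleftrightarrow> \<rho> \<in> extensional (Ob C) \<and>
    (\<forall>x \<in> Ob C. vertical (\<rho> x) \<and> Dom E (\<rho> x) = base_ob X x \<and> Cod E (\<rho> x) = base_ob Y x) \<and>
    (\<forall>f \<in> Arr C. \<rho> (Cod C f) \<cdot> base_arr X f = base_arr Y f \<cdot> \<rho> (Dom C f))"
proof -
  have "\<rho> x \<in> hom E (base_ob X x) (base_ob Y x) \<and> arm p (\<rho> x) = Ident C x \<longleftrightarrow>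
      vertical (\<rho> x) \<and> Dom E (\<rho> x) = base_ob X x \<and> Cod E (\<rho> x) = base_ob Y x" if "x \<in> Ob C" for x
    using base_ob(2)[OF X that] by (auto simp: in_hom_iff)
  then show ?thesis
    using base_section_in_Sect[OF X] base_section_in_Sect[OF Y] by (simp add: Sect_def nat_trans_def) blast
qed

lemma base_map_Arr:
  assumes X: "cart_sec X" and Y: "cart_sec Y" and \<sigma>: "(X, Y, \<sigma>) \<in> Arr SS"
  shows "base_map (X, Y, \<sigma>) \<in> Arr SC"
proof -
  note h = SS_ArrD(4)[OF \<sigma>]
  define \<rho> where "\<rho> = (\<lambda>x \<in> Ob C. unvert (xcomp \<sigma> (vtx C x) 0))"
  note U = system_map_unvert[OF X_Ob[OF X] h simplex_vtx, of _ 0]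
  have "\<rho> (Cod C f) \<cdot> base_arr X f = base_arr Y f \<cdot> \<rho> (Dom C f)" if f: "f \<in> Arr C" for f
  proof -
    let ?e = "edge C f" and ?v = "vtx C (Cod C f)" and ?h = "xcomp \<sigma>"
    note e = simplex_edge[OF f]
    have \<delta>: "(?e, ?v, pt 1) \<in> Arr CC" using to_vtx[OF e, of 1] by simp
    note tX = vtr[OF X \<delta>, of 0] and tY = vtr[OF Y \<delta>, of 0] and vX = opc[OF X e, of 1] and vY = opc[OF Y e, of 1]
    note u0 = U[of "Dom C f"] and u1 = U[of "Cod C f"] and ue = system_map_unvert[OF X_Ob[OF X] h e, of 1]
    have "unvert (?h ?v 0) \<cdot> base_arr X f = (unvert (?h ?v 0) \<cdot> vtr X (?e, ?v, pt 1) 0) \<cdot> opc X ?e 1"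
      using tX vX u1 f by (simp add: base_arr_def E.assoc)
    also have "\<dots> = (vtr Y (?e, ?v, pt 1) 0 \<cdot> unvert (?h ?e 1)) \<cdot> opc X ?e 1"
      using system_map_vtr[OF X Y h \<delta>, of 0] by simp
    also have "\<dots> = vtr Y (?e, ?v, pt 1) 0 \<cdot> (unvert (?h ?e 1) \<cdot> opc X ?e 1)"
      using tY(1,3,4) ue vX by (simp add: E.assoc)
    also have "\<dots> = vtr Y (?e, ?v, pt 1) 0 \<cdot> (opc Y ?e 1 \<cdot> unvert (?h (vtx C (Dom C f)) 0))"
      using system_map_opc[OF X Y h e, of 1] by simp
    also have "\<dots> = base_arr Y f \<cdot> unvert (?h (vtx C (Dom C f)) 0)"
      using tY(1,3,4) vY u0 f by (simp add: base_arr_def E.assoc base_ob_def)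
    finally show ?thesis using f by (simp add: \<rho>_def)
  qed
  moreover have "vertical (\<rho> x) \<and> Dom E (\<rho> x) = base_ob X x \<and> Cod E (\<rho> x) = base_ob Y x" if "x \<in> Ob C" for x
    using U[OF that] that by (simp add: \<rho>_def base_ob_def)
  moreover have "\<rho> \<in> extensional (Ob C)" by (simp add: \<rho>_def)
  ultimately have "(base_section X, base_section Y, \<rho>) \<in> Arr SC" unfolding SC_Arr_iff[OF X Y] by blast
  then show ?thesis by (simp add: base_map_def \<rho>_def)
qed

lemma base_map_faithful:
  assumes X: "cart_sec X" and Y: "cart_sec Y" and \<sigma>: "(X, Y, \<sigma>) \<in> Arr SS" and \<sigma>': "(X, Y, \<sigma>') \<in> Arr SS"
    and eq: "base_map (X, Y, \<sigma>) = base_map (X, Y, \<sigma>')"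
  shows "\<sigma> = \<sigma>'"
proof -
  note h = SS_ArrD(4)[OF \<sigma>] and h' = SS_ArrD(4)[OF \<sigma>']
  have eq0: "unvert (xcomp \<sigma> (vtx C x) 0) = unvert (xcomp \<sigma>' (vtx C x) 0)" if "x \<in> Ob C" for x
    using eq that by (auto simp: base_map_def fun_eq_iff split: if_splits)
  have "xcomp \<sigma> s i = xcomp \<sigma>' s i" if s: "is_simplex C s" and i: "i \<le> fst s" for s i
  proof -
    note U = system_map_unvert[OF X_Ob[OF X] h s i] and U' = system_map_unvert[OF X_Ob[OF X] h' s i]
    have "ver s 0 \<in> Ob C" using simplexD(1)[of C "fst s" "snd s" 0] s by simp
    then have sq: "unvert (xcomp \<sigma> s i) \<cdot> opc X s i = unvert (xcomp \<sigma>' s i) \<cdot> opc X s i"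
      using system_map_opc[OF X Y h s i] system_map_opc[OF X Y h' s i] eq0 by simp
    have "unvert (xcomp \<sigma> s i) = unvert (xcomp \<sigma>' s i)"
      by (rule opcart_cancel[OF opc(1)[OF X s i]]) (use U U' opc(4)[OF X s i] sq in simp_all)
    then show ?thesis using U(2) U'(2) by metis
  qed
  then have "mk_mor X Y (xcomp \<sigma>) = mk_mor X Y (xcomp \<sigma>')" by (rule mk_mor_cong)
  then show ?thesis using SS_ArrD(3)[OF \<sigma>] SS_ArrD(3)[OF \<sigma>'] by simp
qed

text \<open>The components are the vertical arrows that \<open>system_map_opc\<close> forces. Their naturality is tested after
  composition with an opcartesian arrow, where it follows from \<open>opc_step\<close> and from the key identity
  \<open>vtr_opc\<close>.\<close>

lemma base_map_full:
  assumes X: "cart_sec X" and Y: "cart_sec Y" and \<rho>: "(base_section X, base_section Y, \<rho>) \<in> Arr SC"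
  obtains \<sigma> where "(X, Y, \<sigma>) \<in> Arr SS" "base_map (X, Y, \<sigma>) = (base_section X, base_section Y, \<rho>)"
proof -
  have R: "vertical (\<rho> x)" "Dom E (\<rho> x) = base_ob X x" "Cod E (\<rho> x) = base_ob Y x" if "x \<in> Ob C" for x
    using \<rho> that unfolding SC_Arr_iff[OF X Y] by auto
  have R_nat: "\<rho> (Cod C f) \<cdot> base_arr X f = base_arr Y f \<cdot> \<rho> (Dom C f)" if "f \<in> Arr C" for f
    using \<rho> that unfolding SC_Arr_iff[OF X Y] by blast
  have R_ext: "\<rho> \<in> extensional (Ob C)" using \<rho> unfolding SC_Arr_iff[OF X Y] by blast
  define K where "K s i = (SOME k. vertical k \<and> Dom E k = xob X s i \<and> Cod E k = xob Y s i \<and>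
    k \<cdot> opc X s i = opc Y s i \<cdot> \<rho> (ver s 0))" for s i
  have c0: "ver s 0 \<in> Ob C" if "is_simplex C s" for s
    using simplexD(1)[of C "fst s" "snd s" 0] that by simp
  have ex: "\<exists>k. vertical k \<and> Dom E k = xob X s i \<and> Cod E k = xob Y s i \<and>
    k \<cdot> opc X s i = opc Y s i \<cdot> \<rho> (ver s 0)" if s: "is_simplex C s" and i: "i \<le> fst s" for s i
  proof -
    note vX = opc[OF X s i] and vY = opc[OF Y s i] and r = R[OF c0[OF s]]
    have S: "edg s 0 i \<in> Arr C" "Dom C (edg s 0 i) = ver s 0"
      "Cod C (edg s 0 i) = ver s i" "ver s i \<in> Ob C"
      using simplexD[of C "fst s" "snd s"] s i by simp_all
    have px: "obm p (xob X s i) = ver s i" "obm p (xob Y s i) = ver s i"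
      using liftedD(2)[OF xl[OF X s] i] liftedD(2)[OF xl[OF Y s] i] by simp_all
    have "vertical (\<rho> (ver s 0))" by (rule r(1))
    then have pr: "arm p (\<rho> (ver s 0)) = Ident C (ver s 0)"
      using r(2) base_ob(2)[OF X c0[OF s]] by simp
    obtain k where "k \<in> Arr E" "Dom E k = Cod E (opc X s i)" "Cod E k = Cod E (opc Y s i \<cdot> \<rho> (ver s 0))"
      "arm p k = Ident C (ver s i)" "k \<cdot> opc X s i = opc Y s i \<cdot> \<rho> (ver s 0)"
      by (rule opcart_lift[OF vX(1), of "opc Y s i \<cdot> \<rho> (ver s 0)" "Ident C (ver s i)"])
        (use vX vY r(1)[THEN conjunct1] r(2,3) px S pr in simp_all)
    then show ?thesis using vX vY r px by (intro exI[of _ k]) simp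
  qed
  have K: "vertical (K s i)" "Dom E (K s i) = xob X s i" "Cod E (K s i) = xob Y s i"
    "K s i \<cdot> opc X s i = opc Y s i \<cdot> \<rho> (ver s 0)" if "is_simplex C s" "i \<le> fst s" for s i
    using someI_ex[OF ex[OF that]] unfolding K_def by blast+
  have "system_map X Y (\<lambda>s i. vert (K s i))"
    unfolding system_map_def
  proof (intro conjI allI impI)
    fix s assume s: "is_simplex C s"
    note k = K[OF s] and r = R[OF c0[OF s]]
    show "lifted_map (fst s) (snd s) (xob X s) (xar X s) (xob Y s) (xar Y s) (\<lambda>i. vert (K s i))"
      unfolding lifted_map_def
    proof (intro conjI allI impI)
      fix i assume i: "i \<le> fst s"
      show "vert (K s i) \<in> Arr D" "Dom D (vert (K s i)) = xob X s i" "Cod D (vert (K s i)) = xob Y s i"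
        "arm q (vert (K s i)) = Ident C (ver s i)"
        using vert_simps[OF k(1)[OF i]] k(2,3)[OF i] liftedD(2)[OF xl[OF X s] i] by simp_all
    next
      fix i j assume j: "j \<le> fst s" and ij: "i \<le> j"
      then have i: "i \<le> fst s" by simp
      note wX = opc_step[OF X s ij j] and wY = opc_step[OF Y s ij j]
      note vX = opc[OF X s i] and vY = opc[OF Y s i]
      have "K s j \<cdot> opc_step X s i j = opc_step Y s i j \<cdot> K s i"
      proof (rule opcart_cancel[OF vX(1)])
        have "(K s j \<cdot> opc_step X s i j) \<cdot> opc X s i = K s j \<cdot> opc X s j"
          using k[OF j] wX vX by (simp add: E.assoc)
        also have "\<dots> = (opc_step Y s i j \<cdot> opc Y s i) \<cdot> \<rho> (ver s 0)"
          using k(4)[OF j] wY(5) by simp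
        also have "\<dots> = opc_step Y s i j \<cdot> (K s i \<cdot> opc X s i)"
          using k(4)[OF i] wY(1,3,4) vY r by (simp add: E.assoc)
        also have "\<dots> = (opc_step Y s i j \<cdot> K s i) \<cdot> opc X s i"
          using k(1-3)[OF i] wY(1,3,4) vX by (simp add: E.assoc)
        finally show "(K s j \<cdot> opc_step X s i j) \<cdot> opc X s i = (opc_step Y s i j \<cdot> K s i) \<cdot> opc X s i" .
        have px: "obm p (xob X s i) = ver s i" "obm p (xob X s j) = ver s j"
          using liftedD(2)[OF xl[OF X s] i] liftedD(2)[OF xl[OF X s] j] by simp_all
        show "arm p (K s j \<cdot> opc_step X s i j) = arm p (opc_step Y s i j \<cdot> K s i)"
          using k(1-3)[OF i] k(1-3)[OF j] wX(1,3,4,6) wY(1,3,4,6) px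
            simplexD(2-4)[of C "fst s" "snd s" i j] s ij j by simp
      qed (use k(1-3)[OF i] k(1-3)[OF j] wX(1,3,4) wY(1,3,4) vX in simp_all)
      then have "vert (K s i) \<diamondop> cart (opc_step X s i j) = cart (opc_step Y s i j) \<diamondop> vert (K s j)"
        using interchange[OF wX(1) wY(1) k(1)[OF i] k(1)[OF j]] k(2,3)[OF i] k(2,3)[OF j] wX(3,4,6) wY(3,4,6)
        by simp
      then show "vert (K s i) \<diamondop> xar X s i j = xar Y s i j \<diamondop> vert (K s j)"
        using wX(2) wY(2) by simp
    qed
  next
    fix s u a i assume \<alpha>: "(s, u, a) \<in> Arr CC" and i: "i \<le> fst u"
    note A = Arr_CC[OF \<alpha>]
    have ai: "a i \<le> fst s" and a0: "a 0 \<le> fst s" using ord_monoD(1)[OF A(3)] i by auto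
    note ku = K[OF A(2) i] and ks = K[OF A(1) ai] and tX = vtr[OF X \<alpha> i] and tY = vtr[OF Y \<alpha> i]
    note vX = opc[OF X A(1) ai] and vY = opc[OF Y A(1) ai] and vXu = opc[OF X A(2) i] and vYu = opc[OF Y A(2) i]
    let ?f = "edg s 0 (a 0)"
    have f: "?f \<in> Arr C" "Dom C ?f = ver s 0" "Cod C ?f = ver u 0"
      using simplexD[of C "fst s" "snd s"] A(1) a0 Arr_CC_ob[OF \<alpha>, of 0] by simp_all
    note gX = base_arr[OF X f(1)] and gY = base_arr[OF Y f(1)] and r0 = R[OF c0[OF A(1)]] and r1 = R[OF c0[OF A(2)]]
    have "K u i \<cdot> vtr X (s, u, a) i = vtr Y (s, u, a) i \<cdot> K s (a i)"
    proof (rule opcart_cancel[OF vX(1)])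
      have "(K u i \<cdot> vtr X (s, u, a) i) \<cdot> opc X s (a i) = K u i \<cdot> (opc X u i \<cdot> base_arr X ?f)"
        using ku(1-3) tX vX vtr_opc[OF X \<alpha> i] by (simp add: E.assoc)
      also have "\<dots> = (K u i \<cdot> opc X u i) \<cdot> base_arr X ?f"
        using ku(1-3) vXu gX f by (simp add: E.assoc)
      also have "\<dots> = opc Y u i \<cdot> (\<rho> (ver u 0) \<cdot> base_arr X ?f)"
        using ku(4) vYu gX r1 f by (simp add: E.assoc)
      also have "\<dots> = opc Y u i \<cdot> (base_arr Y ?f \<cdot> \<rho> (ver s 0))"
        using R_nat[OF f(1)] f by simp
      also have "\<dots> = (vtr Y (s, u, a) i \<cdot> opc Y s (a i)) \<cdot> \<rho> (ver s 0)"
        using vtr_opc[OF Y \<alpha> i] vYu gY r0 f by (simp add: E.assoc)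
      also have "\<dots> = vtr Y (s, u, a) i \<cdot> (K s (a i) \<cdot> opc X s (a i))"
        using ks(4) tY vY r0 by (simp add: E.assoc)
      also have "\<dots> = (vtr Y (s, u, a) i \<cdot> K s (a i)) \<cdot> opc X s (a i)"
        using ks(1-3) tY vX by (simp add: E.assoc)
      finally show "(K u i \<cdot> vtr X (s, u, a) i) \<cdot> opc X s (a i) = (vtr Y (s, u, a) i \<cdot> K s (a i)) \<cdot> opc X s (a i)" .
      show "arm p (K u i \<cdot> vtr X (s, u, a) i) = arm p (vtr Y (s, u, a) i \<cdot> K s (a i))"
        using vertical_comp[OF tX(1) ku(1)] vertical_comp[OF ks(1) tY(1)] tX(3,4) tY(3,4) ku(2,3) ks(2,3) by simp
    qed (use ku(1-3) ks(1-3) tX(1,3,4) tY(1,3,4) vX in simp_all)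
    then show "vert (K u i) \<diamondop> xtr X (s, u, a) i = xtr Y (s, u, a) i \<diamondop> vert (K s (a i))"
      using vert_comp[OF tX(1) ku(1)] vert_comp[OF ks(1) tY(1)] tX(2-4) tY(2-4) ku(2,3) ks(2,3) by simp
  qed
  then have \<sigma>: "(X, Y, mk_mor X Y (\<lambda>s i. vert (K s i))) \<in> Arr SS"
    by (rule SS_ArrI[OF X_Ob[OF X] X_Ob[OF Y]])
  have "K (vtx C x) 0 = \<rho> x" if x: "x \<in> Ob C" for x
    using K[OF simplex_vtx[OF x], of 0] opc_vtx[OF X x] opc_vtx[OF Y x] R[OF x] by (simp add: base_ob_def)
  then have "(\<lambda>x \<in> Ob C. unvert (xcomp (mk_mor X Y (\<lambda>s i. vert (K s i))) (vtx C x) 0)) = \<rho>"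
    using R_ext R(1) simplex_vtx
    by (intro extensionalityI[of _ "Ob C"]) (simp_all add: mk_mor_simps)
  then show ?thesis using that[OF \<sigma>] by (simp add: base_map_def)
qed

section \<open>Every section comes from a cartesian section\<close>

text \<open>Lifts of identities are chosen to be identities, so that the section constructed from \<open>Y\<close> below restricts
  to \<open>Y\<close> on the nose.\<close>

lemma normal_cleavage:
  "\<exists>L. (\<forall>x f. x \<in> Ob E \<longrightarrow> f \<in> Arr C \<longrightarrow> Dom C f = obm p x \<longrightarrow>
      opcart (L x f) \<and> Dom E (L x f) = x \<and> arm p (L x f) = f) \<and>
    (\<forall>x \<in> Ob E. L x (Ident C (obm p x)) = Ident E x)"
proof -
  define L where "L x f = (if f = Ident C (obm p x) then Ident E x
    else SOME g. opcart g \<and> Dom E g = x \<and> arm p g = f)" for x f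
  have "opcart (L x f) \<and> Dom E (L x f) = x \<and> arm p (L x f) = f"
    if "x \<in> Ob E" "f \<in> Arr C" "Dom C f = obm p x" for x f
  proof (cases "f = Ident C (obm p x)")
    case False
    have "\<exists>g. opcart g \<and> Dom E g = x \<and> arm p g = f"
      using opcart_exists[OF that] by blast
    from someI_ex[OF this] show ?thesis using False by (simp add: L_def)
  qed (use that in \<open>simp add: L_def\<close>)
  moreover have "L x (Ident C (obm p x)) = Ident E x" for x by (simp add: L_def)
  ultimately show ?thesis by blast
qed

text \<open>Over a simplex \<open>s\<close> push \<open>Y c\<^sub>0\<close> forward along the arrows \<open>c\<^sub>0 \<rightarrow> c\<^sub>i\<close>. The arrow \<open>g s i j\<close> between two
  such objects and the vertical action \<open>\<tau>\<close> of a map of simplices are determined by composition with the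
  chosen lifts \<open>l s i\<close>, and so are all equations between them.\<close>

lemma base_section_surj:
  assumes Y: "Y \<in> Ob SC"
  obtains X where "cart_sec X" "base_section X = Y"
proof -
  have Yf: "is_functor C E Y" "ext_functor C Y" "\<And>x. x \<in> Ob C \<Longrightarrow> obm p (obm Y x) = x"
    "\<And>f. f \<in> Arr C \<Longrightarrow> arm p (arm Y f) = f"
    using Y by (auto simp: Sect_def is_section_def)
  note YF = is_functorD[OF Yf(1)]
  obtain L where L: "\<And>x f. x \<in> Ob E \<Longrightarrow> f \<in> Arr C \<Longrightarrow> Dom C f = obm p x \<Longrightarrow>
      opcart (L x f) \<and> Dom E (L x f) = x \<and> arm p (L x f) = f"
    and L_id: "\<And>x. x \<in> Ob E \<Longrightarrow> L x (Ident C (obm p x)) = Ident E x" using normal_cleavage by blast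
  define l where "l s i = L (obm Y (ver s 0)) (edg s 0 i)"
    for s :: "('o, 'a) simplex" and i :: nat
  define x where "x s i = Cod E (l s i)" for s i
  have SD: "i \<le> fst s \<Longrightarrow> ver s i \<in> Ob C"
    "i \<le> j \<Longrightarrow> j \<le> fst s \<Longrightarrow> edg s i j \<in> Arr C \<and> Dom C (edg s i j) = ver s i \<and>
      Cod C (edg s i j) = ver s j"
    "i \<le> fst s \<Longrightarrow> edg s i i = Ident C (ver s i)"
    "i \<le> j \<Longrightarrow> j \<le> k \<Longrightarrow> k \<le> fst s \<Longrightarrow>
      Comp C (edg s j k) (edg s i j) = edg s i k"
    if "is_simplex C s" for s :: "('o, 'a) simplex" and i j k
    using simplexD[of C "fst s" "snd s"] that by simp_all
  have l: "opcart (l s i)" "Dom E (l s i) = obm Y (ver s 0)" "Cod E (l s i) = x s i"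
    "arm p (l s i) = edg s 0 i" if "is_simplex C s" "i \<le> fst s" for s i
    using L[of "obm Y (ver s 0)" "edg s 0 i"] SD[OF that(1)] that(2) YF(1) Yf(3)
    by (simp_all add: l_def x_def)
  have x: "x s i \<in> Ob E" "obm p (x s i) = ver s i" if "is_simplex C s" "i \<le> fst s" for s i
  proof -
    show "x s i \<in> Ob E" using l[OF that] by (metis E.Ob_simps(2) opcart_Arr)
    have "Cod C (arm p (l s i)) = obm p (x s i)" using l(1,3)[OF that] by simp
    then show "obm p (x s i) = ver s i" using l(4)[OF that] SD(2)[OF that(1), of 0 i] that(2) by simp
  qed
  have l0: "l s 0 = Ident E (obm Y (ver s 0))" if "is_simplex C s" for s
    using L_id[of "obm Y (ver s 0)"] SD[OF that, of 0] YF(1) Yf(3) by (simp add: l_def)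
  have exg: "\<exists>k. k \<in> Arr E \<and> Dom E k = x s i \<and> Cod E k = x s j \<and> arm p k = edg s i j \<and>
    k \<cdot> l s i = l s j" if s: "is_simplex C s" and ij: "i \<le> j" "j \<le> fst s" for s i j
  proof -
    have i: "i \<le> fst s" using ij by simp
    note li = l[OF s i] and lj = l[OF s ij(2)] and xi = x[OF s i] and xj = x[OF s ij(2)]
    obtain k where "k \<in> Arr E" "Dom E k = Cod E (l s i)" "Cod E k = Cod E (l s j)"
      "arm p k = edg s i j" "k \<cdot> l s i = l s j"
      by (rule opcart_lift[OF li(1), of "l s j" "edg s i j"])
        (use li lj xi xj SD(2)[OF s ij] SD(4)[OF s _ ij, of 0] in simp_all)
    then show ?thesis using li lj by (intro exI[of _ k]) simp
  qed
  define g where "g s i j = (SOME k. k \<in> Arr E \<and> Dom E k = x s i \<and> Cod E k = x s j \<and>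
    arm p k = edg s i j \<and> k \<cdot> l s i = l s j)" for s i j
  have g: "g s i j \<in> Arr E" "Dom E (g s i j) = x s i" "Cod E (g s i j) = x s j"
    "arm p (g s i j) = edg s i j" "g s i j \<cdot> l s i = l s j"
    if "is_simplex C s" "i \<le> j" "j \<le> fst s" for s i j
    using someI_ex[OF exg[OF that]] unfolding g_def by blast+
  have g_oc: "opcart (g s i j)" if s: "is_simplex C s" and ij: "i \<le> j" "j \<le> fst s" for s i j
  proof (rule opcart_cancel_right[of "l s i"])
    show "opcart (l s i)" using l(1)[OF s, of i] ij by simp
    show "opcart (g s i j \<cdot> l s i)" unfolding g(5)[OF s ij] by (rule l(1)[OF s ij(2)])
  qed (use g[OF s ij] l[OF s, of i] ij in simp_all)
  have ext: "\<exists>k. vertical k \<and> Dom E k = x s (a i) \<and> Cod E k = x u i \<and>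
    k \<cdot> l s (a i) = l u i \<cdot> arm Y (edg s 0 (a 0))"
    if \<alpha>: "(s, u, a) \<in> Arr CC" and i: "i \<le> fst u" for s u a i
  proof -
    note A = Arr_CC[OF \<alpha>] and ob = Arr_CC_ob[OF \<alpha>] and ar = Arr_CC_arm[OF \<alpha>]
    have a: "a i \<le> fst s" "a 0 \<le> fst s" "a 0 \<le> a i"
      using ord_monoD(1)[OF A(3)] ord_monoD(2)[OF A(3), of 0 i] i by auto
    let ?f = "edg s 0 (a 0)"
    have f: "?f \<in> Arr C" "Dom C ?f = ver s 0" "Cod C ?f = ver u 0"
      using SD(2)[OF A(1), of 0 "a 0"] a ob[of 0] by simp_all
    note ls = l[OF A(1) a(1)] and lu = l[OF A(2) i] and xs = x[OF A(1) a(1)] and xu = x[OF A(2) i]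
    have pu: "arm p (l u i) = edg s (a 0) (a i)" using lu(4) ar[of 0 i] i by simp
    have "Comp C (edg s (a 0) (a i)) ?f = edg s 0 (a i)"
      using SD(4)[OF A(1), of 0 "a 0" "a i"] a by simp
    then have pl: "arm p (l u i \<cdot> arm Y ?f) = arm p (l s (a i))"
      using lu(1,2) pu ls(4) YF(2-4)[OF f(1)] f Yf(4)[OF f(1)] by simp
    have o: "ver s (a i) \<in> Ob C" "ver u i = ver s (a i)"
      using SD(1)[OF A(1) a(1)] ob[OF i] by simp_all
    have "Comp C (Ident C (ver s (a i))) (arm p (l s (a i))) = arm p (l s (a i))"
      unfolding ls(4) using SD(2)[OF A(1) _ a(1), of 0] by simp
    then obtain k where "k \<in> Arr E" "Dom E k = Cod E (l s (a i))" "Cod E k = Cod E (l u i \<cdot> arm Y ?f)"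
      "arm p k = Ident C (ver s (a i))" "k \<cdot> l s (a i) = l u i \<cdot> arm Y ?f"
      using opcart_lift[OF ls(1), of "l u i \<cdot> arm Y ?f" "Ident C (ver s (a i))"]
        ls(2,3) lu(1-3) xs xu o pl YF(2-4)[OF f(1)] f by auto
    then show ?thesis using ls lu xs YF(2-4)[OF f(1)] f by (intro exI[of _ k]) simp
  qed
  define \<tau> where "\<tau> \<alpha> i = (case \<alpha> of (s, u, a) \<Rightarrow> SOME k. vertical k \<and> Dom E k = x s (a i) \<and>
    Cod E k = x u i \<and> k \<cdot> l s (a i) = l u i \<cdot> arm Y (edg s 0 (a 0)))"
    for \<alpha> :: "('o, 'a) simplex_arr" and i
  have \<tau>: "vertical (\<tau> (s, u, a) i)" "Dom E (\<tau> (s, u, a) i) = x s (a i)" "Cod E (\<tau> (s, u, a) i) = x u i"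
    "\<tau> (s, u, a) i \<cdot> l s (a i) = l u i \<cdot> arm Y (edg s 0 (a 0))"
    if "(s, u, a) \<in> Arr CC" "i \<le> fst u" for s u a i
    using someI_ex[OF ext[OF that]] unfolding \<tau>_def prod.case by blast+
  have \<tau>_unique: "\<tau> (s, u, a) i = k"
    if \<alpha>: "(s, u, a) \<in> Arr CC" and i: "i \<le> fst u" and k: "vertical k" "Dom E k = x s (a i)" "Cod E k = x u i"
      "k \<cdot> l s (a i) = l u i \<cdot> arm Y (edg s 0 (a 0))" for s u a i k
  proof -
    have ai: "a i \<le> fst s" by (rule ord_monoD(1)[OF Arr_CC(3)[OF \<alpha>] i])
    note ls = l[OF Arr_CC(1)[OF \<alpha>] ai]
    show ?thesis
      by (rule opcart_cancel[OF ls(1)]) (use \<tau>[OF \<alpha> i] k ls in simp_all)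
  qed
  \<comment> \<open>A Segal map fixes the first vertex and the arrows out of it, hence the chosen lifts.\<close>
  have \<tau>_id: "\<tau> (s, u, a) i = Ident E (x s i)"
    if \<alpha>: "(s, u, a) \<in> Arr CC" and seg: "\<And>i. i \<le> fst u \<Longrightarrow> a i = i" and i: "i \<le> fst u" for s u a i
  proof (rule \<tau>_unique[OF \<alpha> i])
    note A = Arr_CC[OF \<alpha>]
    have si: "i \<le> fst s" using ord_monoD(1)[OF A(3) i] seg[OF i] by simp
    have eq: "l u i = l s i" using Arr_CC_ob[OF \<alpha>, of 0] Arr_CC_arm[OF \<alpha>, of 0 i] seg i by (simp add: l_def)
    note ls = l[OF A(1) si] and xs = x[OF A(1) si]
    show "Dom E (Ident E (x s i)) = x s (a i)" "Cod E (Ident E (x s i)) = x u i" "vertical (Ident E (x s i))"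
      using xs seg[OF i] eq by (simp_all add: x_def)
    have "arm Y (edg s 0 (a 0)) = Ident E (obm Y (ver s 0))"
      using SD(1,3)[OF A(1), of 0] seg[of 0] YF(5) by simp
    then show "Ident E (x s i) \<cdot> l s (a i) = l u i \<cdot> arm Y (edg s 0 (a 0))"
      using ls seg[OF i] eq by simp
  qed
  have sys: "system x (\<lambda>s i j. cart (g s i j)) (\<lambda>\<alpha> i. vert (\<tau> \<alpha> i))"
    unfolding system_def
  proof (intro conjI allI impI)
    fix s assume s: "is_simplex C s"
    note gs = g[OF s] and gs_oc = g_oc[OF s] and xs = x[OF s] and ls = l[OF s]
    have g_id: "g s i i = Ident E (x s i)" if i: "i \<le> fst s" for i
      by (rule opcart_cancel[OF ls(1)[OF i]])
        (use gs[OF order_refl i] ls[OF i] xs[OF i] SD(3)[OF s i] in simp_all)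
    have g_comp: "g s j k \<cdot> g s i j = g s i k" if ijk: "i \<le> j" "j \<le> k" "k \<le> fst s" for i j k
    proof -
      have o: "i \<le> fst s" "j \<le> fst s" "i \<le> k" using ijk by auto
      note gij = gs[OF ijk(1) o(2)] and gjk = gs[OF ijk(2,3)] and gik = gs[OF o(3) ijk(3)]
      show ?thesis
      proof (rule opcart_cancel[OF ls(1)[OF o(1)]])
        show "(g s j k \<cdot> g s i j) \<cdot> l s i = g s i k \<cdot> l s i"
          using gij gjk gik ls[OF o(1)] by (simp add: E.assoc)
        show "arm p (g s j k \<cdot> g s i j) = arm p (g s i k)"
          using gij gjk gik SD(4)[OF s ijk] by simp
      qed (use gij gjk gik ls[OF o(1)] in simp_all)
    qed
    show "lifted (fst s) (snd s) (x s) (\<lambda>i j. cart (g s i j))"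
      unfolding lifted_def
    proof (intro conjI allI impI)
      fix i assume i: "i \<le> fst s"
      show "x s i \<in> Ob E" "obm p (x s i) = ver s i" "cart (g s i i) = Ident D (x s i)"
        using xs[OF i] g_id[OF i] by (simp_all add: cart_Ident)
    next
      fix i j assume "j \<le> fst s" "i \<le> j"
      then show "cart (g s i j) \<in> Arr D" "Dom D (cart (g s i j)) = x s j" "Cod D (cart (g s i j)) = x s i"
        "arm q (cart (g s i j)) = edg s i j"
        using gs[of i j] gs_oc[of i j] by simp_all
    next
      fix i j k assume "k \<le> fst s" "j \<le> k" "i \<le> j"
      then show "cart (g s i j) \<diamondop> cart (g s j k) = cart (g s i k)"
        using gs[of i j] gs_oc[of i j] gs[of j k] gs_oc[of j k] g_comp[of i j k] by (simp add: cart_comp)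
    qed
    fix i assume i: "i \<le> fst s"
    have id: "(s, s, \<lambda>i\<in>{0..fst s}. i) \<in> Arr CC"
      using category.Ident_simps(1)[OF category_simp_repl, of s] s by simp
    have "\<tau> (Ident CC s) i = Ident E (x s i)"
      using \<tau>_id[OF id _ i] by simp
    then show "vert (\<tau> (Ident CC s) i) = Ident D (x s i)" using xs[OF i] by (simp add: vert_Ident)
  next
    fix s u a assume \<alpha>: "(s, u, a) \<in> Arr CC"
    note A = Arr_CC[OF \<alpha>] and ob = Arr_CC_ob[OF \<alpha>] and ar = Arr_CC_arm[OF \<alpha>] and am = ord_monoD[OF Arr_CC(3)[OF \<alpha>]]
    let ?f = "edg s 0 (a 0)"
    have f: "?f \<in> Arr C" "Dom C ?f = ver s 0" "Cod C ?f = ver u 0"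
      using SD(2)[OF A(1), of 0 "a 0"] am(1)[of 0] ob[of 0] by simp_all
    note Yff = YF(2-4)[OF f(1)]
    show "lifted_map (fst u) (snd u) (\<lambda>i. x s (a i)) (\<lambda>i j. cart (g s (a i) (a j))) (x u)
      (\<lambda>i j. cart (g u i j)) (\<lambda>i. vert (\<tau> (s, u, a) i))"
      unfolding lifted_map_def
    proof (intro conjI allI impI)
      fix i assume i: "i \<le> fst u"
      note t = \<tau>[OF \<alpha> i]
      show "vert (\<tau> (s, u, a) i) \<in> Arr D" "Dom D (vert (\<tau> (s, u, a) i)) = x s (a i)"
        "Cod D (vert (\<tau> (s, u, a) i)) = x u i" "arm q (vert (\<tau> (s, u, a) i)) = Ident C (ver u i)"
        using vert_simps[OF t(1)] t(2,3) x(2)[OF A(1) am(1)[OF i]] ob[OF i] by simp_all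
    next
      fix i j assume j: "j \<le> fst u" and ij: "i \<le> j"
      then have i: "i \<le> fst u" by simp
      note ti = \<tau>[OF \<alpha> i] and tj = \<tau>[OF \<alpha> j] and gs = g[OF A(1) am(2)[OF ij j] am(1)[OF j]]
        and gs_oc = g_oc[OF A(1) am(2)[OF ij j] am(1)[OF j]] and gu = g[OF A(2) ij j] and gu_oc = g_oc[OF A(2) ij j]
        and ls = l[OF A(1) am(1)[OF i]] and lu = l[OF A(2) i] and xs = x[OF A(1)]
      have "\<tau> (s, u, a) j \<cdot> g s (a i) (a j) = g u i j \<cdot> \<tau> (s, u, a) i"
      proof (rule opcart_cancel[OF ls(1)])
        have "(\<tau> (s, u, a) j \<cdot> g s (a i) (a j)) \<cdot> l s (a i) = (g u i j \<cdot> l u i) \<cdot> arm Y ?f"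
          using tj gs gu(5) ls by (simp add: E.assoc)
        also have "\<dots> = g u i j \<cdot> (\<tau> (s, u, a) i \<cdot> l s (a i))"
          using gu(1-3) lu ti(4) Yff f by (simp add: E.assoc)
        also have "\<dots> = (g u i j \<cdot> \<tau> (s, u, a) i) \<cdot> l s (a i)"
          using gu(1-3) ti(1-3) ls by (simp add: E.assoc)
        finally show "(\<tau> (s, u, a) j \<cdot> g s (a i) (a j)) \<cdot> l s (a i) = (g u i j \<cdot> \<tau> (s, u, a) i) \<cdot> l s (a i)" .
        have "arm p (g u i j) = edg s (a i) (a j)" using gu(4) ar[OF ij j] by simp
        then show "arm p (\<tau> (s, u, a) j \<cdot> g s (a i) (a j)) = arm p (g u i j \<cdot> \<tau> (s, u, a) i)"
          using ti(1-3) tj(1-3) gs(1-4) gu(1-3) xs(2)[OF am(1)[OF i]] xs(2)[OF am(1)[OF j]]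
            SD(2)[OF A(1) am(2)[OF ij j] am(1)[OF j]] by simp
      qed (use ti(1-3) tj(1-3) gs(1-3) gu(1-3) ls in simp_all)
      then show "vert (\<tau> (s, u, a) i) \<diamondop> cart (g s (a i) (a j)) = cart (g u i j) \<diamondop> vert (\<tau> (s, u, a) j)"
        using interchange[OF gs_oc gu_oc ti(1) tj(1)] ti(2,3) tj(2,3) gs(2-4) gu(2-4) ar[OF ij j] by simp
    qed
    fix v b i assume \<beta>: "(u, v, b) \<in> Arr CC" and i: "i \<le> fst v"
    note B = Arr_CC[OF \<beta>]
    have b: "b i \<le> fst u" "b 0 \<le> fst u" using ord_monoD(1)[OF B(3)] i by auto
    let ?c = "\<lambda>i \<in> {0..fst v}. a (b i)"
    have c: "(s, v, ?c) \<in> Arr CC"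
      using category.Comp_simps(1)[OF category_simp_repl \<alpha> \<beta>] by simp
    note t1 = \<tau>[OF \<alpha> b(1)] and t2 = \<tau>[OF \<beta> i] and ls = l[OF A(1) am(1)[OF b(1)]]
      and lu = l[OF A(2) b(1)] and lv = l[OF B(2) i]
    let ?f' = "edg u 0 (b 0)"
    have f': "?f' \<in> Arr C" "Dom C ?f' = ver u 0" "Cod C ?f' = ver v 0"
      using SD(2)[OF A(2), of 0 "b 0"] b Arr_CC_ob[OF \<beta>, of 0] by simp_all
    have "?f' = edg s (a 0) (a (b 0))" using ar[of 0 "b 0"] b by simp
    then have "Comp C ?f' ?f = edg s 0 (a (b 0))"
      using SD(4)[OF A(1), of 0 "a 0" "a (b 0)"] am(1)[OF b(2)] am(2)[of 0 "b 0"] b by simp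
    then have Yc: "arm Y (edg s 0 (a (b 0))) = arm Y ?f' \<cdot> arm Y ?f"
      using YF(6)[OF f(1) f'(1)] f f' by simp
    have "\<tau> (s, v, ?c) i = \<tau> (u, v, b) i \<cdot> \<tau> (s, u, a) (b i)"
    proof (rule \<tau>_unique[OF c i])
      have "(\<tau> (u, v, b) i \<cdot> \<tau> (s, u, a) (b i)) \<cdot> l s (a (b i)) = \<tau> (u, v, b) i \<cdot> (l u (b i) \<cdot> arm Y ?f)"
        using t1 t2(1-3) ls by (simp add: E.assoc)
      also have "\<dots> = (\<tau> (u, v, b) i \<cdot> l u (b i)) \<cdot> arm Y ?f"
        using t2(1-3) lu Yff f by (simp add: E.assoc)
      also have "\<dots> = l v i \<cdot> (arm Y ?f' \<cdot> arm Y ?f)"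
        using t2(4) lv Yff f YF(2-4)[OF f'(1)] f' by (simp add: E.assoc)
      finally show "(\<tau> (u, v, b) i \<cdot> \<tau> (s, u, a) (b i)) \<cdot> l s (?c i) = l v i \<cdot> arm Y (edg s 0 (?c 0))"
        using i Yc by simp
      show "vertical (\<tau> (u, v, b) i \<cdot> \<tau> (s, u, a) (b i))"
        using vertical_comp[OF t1(1) t2(1)] t1(1-3) t2(1-3) by simp
    qed (use t1(1-3) t2(1-3) i in simp_all)
    then show "vert (\<tau> (s, v, ?c) i) = vert (\<tau> (u, v, b) i) \<diamondop> vert (\<tau> (s, u, a) (b i))"
      using vert_comp[OF t1(1) t2(1)] t1(3) t2(2) by simp
  qed
  define X where "X = mk_section x (\<lambda>s i j. cart (g s i j)) (\<lambda>\<alpha> i. vert (\<tau> \<alpha> i))"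
  have XS: "X \<in> Ob SS" unfolding X_def by (rule section_of_system[OF sys])
  have Xob: "xob X s i = x s i" if "is_simplex C s" "i \<le> fst s" for s i
    using that by (simp add: X_def mk_section_simps)
  have Xar: "xar X s i j = cart (g s i j)" if "is_simplex C s" "i \<le> j" "j \<le> fst s" for s i j
    using that by (simp add: X_def mk_section_simps)
  have Xtr: "xtr X (s, u, a) i = vert (\<tau> (s, u, a) i)" if "(s, u, a) \<in> Arr CC" "i \<le> fst u" for s u a i
    using that by (simp add: X_def mk_section_simps)
  have "cartesian_at E C p X \<alpha>" if \<alpha>: "segal C \<alpha>" for \<alpha>
  proof -
    obtain s u a where e: "\<alpha> = (s, u, a)" by (cases \<alpha>) auto
    have sg: "(s, u, a) \<in> Arr CC" "\<And>i. i \<le> fst u \<Longrightarrow> a i = i" using \<alpha> unfolding e segal_iff by blast+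
    note A = Arr_CC[OF sg(1)]
    have mn: "fst u \<le> fst s" using ord_monoD(1)[OF A(3), of "fst u"] sg(2)[of "fst u"] by simp
    have "is_cart (xtr X (s, u, a) (min i (fst u)) \<diamondop> xar X s (min i (fst u)) i)" if i: "i \<le> fst s" for i
    proof -
      let ?m = "min i (fst u)"
      have m: "?m \<le> fst u" "?m \<le> i" "?m \<le> fst s" using i by auto
      have "xtr X (s, u, a) ?m = Ident D (x s ?m)"
        using Xtr[OF sg(1) m(1)] \<tau>_id[OF sg m(1)] x(1)[OF A(1) m(3)]
        by (simp add: vert_Ident)
      moreover have "xar X s ?m i = cart (g s ?m i)"
        by (rule Xar[OF A(1) m(2) i])
      ultimately show ?thesis using g[OF A(1) m(2) i] g_oc[OF A(1) m(2) i] by simp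
    qed
    then show ?thesis using cartesian_at_section[OF XS sg(1) mn sg(2)] unfolding e by blast
  qed
  then have cX: "cart_sec X" using XS by (simp add: cart_sec_def)
  have ob: "base_ob X z = obm Y z" if z: "z \<in> Ob C" for z
    using Xob[OF simplex_vtx[OF z], of 0] l0[OF simplex_vtx[OF z]] YF(1)[OF z]
    by (simp add: base_ob_def x_def)
  have ar: "base_arr X f = arm Y f" if f: "f \<in> Arr C" for f
  proof -
    let ?e = "edge C f" and ?v = "vtx C (Cod C f)"
    note e = simplex_edge[OF f]
    have \<delta>: "(?e, ?v, pt 1) \<in> Arr CC" using to_vtx[OF e, of 1] by simp
    have \<beta>: "(toV ?e 0) \<in> Arr CC" by (rule to_vtx[OF e]) simp
    note le = l[OF e, of 1] and ge = g[OF e, of 0 1] and xe = x[OF e]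
    have "g ?e 0 1 \<cdot> l ?e 0 = g ?e 0 1"
      using ge l0[OF e] YF(1)[of "Dom C f"] f by (simp add: x_def)
    then have gl: "g ?e 0 1 = l ?e 1" using ge by simp
    have "xtr X (toV ?e 0) 0 = Ident D (x ?e 0)"
      using Xtr[OF \<beta>, of 0] \<tau>_id[OF \<beta>, of 0] xe(1)[of 0] by (simp add: vert_Ident)
    moreover have "xar X ?e 0 1 = cart (l ?e 1)"
      using Xar[OF e, of 0 1] gl by simp
    ultimately have "opc X ?e 1 = uncart (Ident D (x ?e 0) \<diamondop> cart (l ?e 1))" by (simp add: opc_def)
    also have "\<dots> = l ?e 1"
      using le l0[OF e] YF(1) f by (simp add: x_def)
    finally have v: "opc X ?e 1 = l ?e 1" .
    have "vtr X (?e, ?v, pt 1) 0 = \<tau> (?e, ?v, pt 1) 0"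
      using Xtr[OF \<delta>, of 0] \<tau>(1)[OF \<delta>, of 0] by (simp add: vtr_def)
    then have "base_arr X f = l ?v 0 \<cdot> arm Y f"
      using \<tau>(4)[OF \<delta>, of 0] v f by (simp add: base_arr_def)
    then show ?thesis
      using l0[OF simplex_vtx[of "Cod C f"]] f YF(2-4)[OF f] by simp
  qed
  have "base_section X = Y"
  proof (rule fctr_eqI)
    show "obm (base_section X) = obm Y"
      by (rule extensionalityI[of _ "Ob C"]) (use Yf(2) ob in \<open>simp_all add: base_section_def ext_functor_def\<close>)
    show "arm (base_section X) = arm Y"
      by (rule extensionalityI[of _ "Arr C"]) (use Yf(2) ar in \<open>simp_all add: base_section_def ext_functor_def\<close>)
  qed
  then show ?thesis using that cX by blast
qed

section \<open>The equivalence\<close>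

abbreviation FS where "FS \<equiv> full_subcat SS (\<lambda>X. \<forall>\<alpha>. segal C \<alpha> \<longrightarrow> cartesian_at E C p X \<alpha>)"

lemma FS_Ob_iff: "X \<in> Ob FS \<longleftrightarrow> cart_sec X"
  by (simp add: full_subcat_def cart_sec_def)

lemma FS_Arr_iff: "(X, Y, \<sigma>) \<in> Arr FS \<longleftrightarrow> (X, Y, \<sigma>) \<in> Arr SS \<and> cart_sec X \<and> cart_sec Y"
  using SS_ArrD(1,2)[of X Y \<sigma>] by (auto simp: full_subcat_def cart_sec_def)

lemma base_map_functor: "is_functor FS SC \<lparr>obm = base_section, arm = base_map\<rparr>"
proof (rule is_functorI)
  fix X assume "X \<in> Ob FS"
  then have X: "cart_sec X" using FS_Ob_iff by blast
  show "obm \<lparr>obm = base_section, arm = base_map\<rparr> X \<in> Ob SC" using base_section_in_Sect[OF X] by simp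
  have "unvert (Ident D (xob X (vtx C z) 0)) = Ident E (base_ob X z)" if "z \<in> Ob C" for z
    using base_ob(1)[OF X that] unvert_vert[of "Ident E (base_ob X z)"] by (simp add: base_ob_def vert_Ident)
  then show "arm \<lparr>obm = base_section, arm = base_map\<rparr> (Ident FS X) = Ident SC (obm \<lparr>obm = base_section, arm = base_map\<rparr> X)"
    using SS_Ident_comp[OF X_Ob[OF X]] simplex_vtx
    by (auto simp: base_map_def mk_mor_simps Sect_def[of C] fun_eq_iff)
next
  fix f assume f: "f \<in> Arr FS"
  obtain X Y \<sigma> where e: "f = (X, Y, \<sigma>)" by (cases f)
  show "arm \<lparr>obm = base_section, arm = base_map\<rparr> f \<in> Arr SC \<and> Dom SC (arm \<lparr>obm = base_section, arm = base_map\<rparr> f) =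
    obm \<lparr>obm = base_section, arm = base_map\<rparr> (Dom FS f) \<and> Cod SC (arm \<lparr>obm = base_section, arm = base_map\<rparr> f) = obm \<lparr>obm = base_section, arm = base_map\<rparr> (Cod FS f)"
    using f base_map_Arr[of X Y \<sigma>] unfolding e FS_Arr_iff by (simp add: base_map_def)
next
  fix f g assume f: "f \<in> Arr FS" and g: "g \<in> Arr FS" and fg: "Cod FS f = Dom FS g"
  obtain X Y \<sigma> where fe: "f = (X, Y, \<sigma>)" by (cases f)
  obtain Z \<tau> where ge: "g = (Y, Z, \<tau>)" using fg fe by (cases g) auto
  have F: "(X, Y, \<sigma>) \<in> Arr SS" "(Y, Z, \<tau>) \<in> Arr SS" and X: "cart_sec X" and Y: "cart_sec Y" and Z: "cart_sec Z"
    using f g unfolding fe ge FS_Arr_iff by blast+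
  obtain \<upsilon> where u: "Comp SS (Y, Z, \<tau>) (X, Y, \<sigma>) = (X, Z, \<upsilon>)" by (simp add: Sect_def)
  have "unvert (xcomp \<upsilon> (vtx C z) 0) = unvert (xcomp \<tau> (vtx C z) 0) \<cdot> unvert (xcomp \<sigma> (vtx C z) 0)"
    if z: "z \<in> Ob C" for z
  proof -
    note s = simplex_vtx[OF z]
    note U = system_map_unvert[OF X_Ob[OF X] SS_ArrD(4)[OF F(1)] s, of 0]
      and U' = system_map_unvert[OF X_Ob[OF Y] SS_ArrD(4)[OF F(2)] s, of 0]
    have "xcomp \<upsilon> (vtx C z) 0 = xcomp \<tau> (vtx C z) 0 \<diamondop> xcomp \<sigma> (vtx C z) 0"
      using SS_Comp_comp[OF F s, of 0] u by simp
    also have "\<dots> = vert (unvert (xcomp \<tau> (vtx C z) 0) \<cdot> unvert (xcomp \<sigma> (vtx C z) 0))"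
      using vert_comp[OF U(1) U'(1)] U(2,4) U'(2,3) by simp
    finally show ?thesis
      using unvert_vert[of "unvert (xcomp \<tau> (vtx C z) 0) \<cdot> unvert (xcomp \<sigma> (vtx C z) 0)"]
        vertical_comp[OF U(1) U'(1)] U(1,3,4) U'(1,3,4) by simp
  qed
  then show "arm \<lparr>obm = base_section, arm = base_map\<rparr> (Comp FS g f) =
    Comp SC (arm \<lparr>obm = base_section, arm = base_map\<rparr> g) (arm \<lparr>obm = base_section, arm = base_map\<rparr> f)"
    using u by (auto simp: fe ge base_map_def Sect_def[of C] fun_eq_iff)
qed

lemma equivalence: "equivalent_cats SC FS"
proof (rule equivalent_cats_if_fully_faithful[OF _ _ base_map_functor])
  show "category SC" by (rule category_Sect[OF C E p_functor])
  show "category FS" by (rule category_full_subcat[OF category_SS])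
next
  fix Y assume "Y \<in> Ob SC"
  then obtain X where "cart_sec X" "base_section X = Y" by (rule base_section_surj)
  then show "\<exists>X \<in> Ob FS. obm \<lparr>obm = base_section, arm = base_map\<rparr> X = Y"
    using FS_Ob_iff by (intro bexI[of _ X]) simp_all
next
  fix X Y g assume "X \<in> Ob FS" "Y \<in> Ob FS" and g: "g \<in> Arr SC"
    "Dom SC g = obm \<lparr>obm = base_section, arm = base_map\<rparr> X" "Cod SC g = obm \<lparr>obm = base_section, arm = base_map\<rparr> Y"
  then have X: "cart_sec X" and Y: "cart_sec Y" using FS_Ob_iff by blast+
  obtain \<rho> where ge: "g = (base_section X, base_section Y, \<rho>)" using g by (cases g) auto
  obtain \<sigma> where \<sigma>: "(X, Y, \<sigma>) \<in> Arr SS" "base_map (X, Y, \<sigma>) = g"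
    using base_map_full[OF X Y] g(1) unfolding ge by metis
  show "\<exists>!f. f \<in> Arr FS \<and> Dom FS f = X \<and> Cod FS f = Y \<and> arm \<lparr>obm = base_section, arm = base_map\<rparr> f = g"
  proof (rule ex1I[of _ "(X, Y, \<sigma>)"])
    show "(X, Y, \<sigma>) \<in> Arr FS \<and> Dom FS (X, Y, \<sigma>) = X \<and> Cod FS (X, Y, \<sigma>) = Y \<and>
      arm \<lparr>obm = base_section, arm = base_map\<rparr> (X, Y, \<sigma>) = g"
      using \<sigma> X Y FS_Arr_iff by simp
  next
    fix f assume f: "f \<in> Arr FS \<and> Dom FS f = X \<and> Cod FS f = Y \<and> arm \<lparr>obm = base_section, arm = base_map\<rparr> f = g"
    then obtain \<sigma>' where fe: "f = (X, Y, \<sigma>')" by (cases f) auto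
    have "(X, Y, \<sigma>') \<in> Arr SS" "base_map (X, Y, \<sigma>') = g" using f FS_Arr_iff unfolding fe by auto
    then show "f = (X, Y, \<sigma>)" using base_map_faithful[OF X Y _ \<sigma>(1)] \<sigma>(2) fe by metis
  qed
qed

end

theorem proposition1:
  fixes C :: "('o, 'a) cat" and E :: "('p, 'b) cat" and p :: "('p, 'b, 'o, 'a) fctr"
  assumes "category C" and "category E" and "opfibration E C p"
  shows "equivalent_cats (Sect C E p)
    (full_subcat (Sect (simp_repl C) (simp_ext E C p) grothendieck_proj)
      (\<lambda>X. \<forall>\<alpha>. segal C \<alpha> \<longrightarrow> cartesian_at E C p X \<alpha>))"
proof -
  interpret opfib C E p by (rule opfib.intro) (use assms in auto)
  show ?thesis by (rule equivalence)
qed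

end
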